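(* Let $\mathbf{u}$ be a solution of the 2D Navier–Stokes equations $\frac{d\mathbf{u}}{dt}+\nu A\mathbf{u}+B(\mathbf{u},\mathbf{u})=\mathbf{f}$ on $[0,\infty)$, and let $I_h$ be a linear interpolant satisfying the approximation property $(\mathrm{I})$ of the context. Let $\tau>0$ and $N\in\mathbb{Z}^+$ be arbitrary, put $t_k=k\tau$ for $k\in\mathbb{N}$, and suppose $\beta>0$ and $h>0$ satisfy $c_0\beta h^2\le\nu$. Then, given $\mathbf{v}_{N,0}\in P_NH$, there exists a unique sequence $\{\mathbf{v}_N^k\}_{k\in\mathbb{N}}\subset P_NH$ with $\mathbf{v}_N^0=\mathbf{v}_{N,0}$ satisfying the semi-implicit Euler scheme $$\frac{\mathbf{v}_N^{k+1}-\mathbf{v}_N^k}{\tau}+\nu A\mathbf{v}_N^{k+1}+P_NB(\mathbf{v}_N^k,\mathbf{v}_N^{k+1})=P_N\mathbf{f}-\beta P_NP_\sigma I_h\big(\mathbf{v}_N^{k+1}-\mathbf{u}(t_{k+1})\big)\qquad\text{for all }k\in\mathbb{N}.$$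
   Context: Setting. $\Omega\subset\mathbb{R}^2$ is either (periodic case) $(0,L)\times(0,L)$, $L>0$, with periodic boundary conditions, or (no-slip case) an open, bounded, connected set with $C^2$ boundary, with no-slip Dirichlet boundary conditions. $\mathcal{V}$ denotes, in the periodic case, the divergence-free two-dimensional trigonometric polynomial vector fields with period $L$ in both directions and zero spatial average, and, in the no-slip case, the smooth compactly supported divergence-free vector fields on $\Omega$. $H$ and $V$ are the closures of $\mathcal{V}$ in $(L^2(\Omega))^2$ and $(H^1(\Omega))^2$. On $H$: $(\psi,\varphi)=\int_\Omega\psi\cdot\varphi\,dx$, with norm $|\cdot|$. On $V$: $((\psi,\varphi))=\int_\Omega\sum_{j=1}^2\partial_{x_j}\psi\cdot\partial_{x_j}\varphi\,dx$, with norm $\|\cdot\|$. $P_\sigma:(L^2(\Omega))^2\to H$ is the Leray–Helmholtz (orthogonal) projector; $A=-P_\sigma\Delta$ is the Stokes operator with domain $\mathcal{D}(A)=(H^2(\Omega))^2\cap V$; $B(\psi,\varphi)=P_\sigma((\psi\cdot\nabla)\varphi)$, extended continuously to $V\times V\to V'$. $A$ has an $H$-orthonormal basis of eigenvectors $\{\mathbf{w}_j\}$ with eigenvalues $0<\lambda_1\le\lambda_2\le\cdots\to\infty$, and $P_N$ is the orthogonal projector of $H$ onto $\mathrm{span}\{\mathbf{w}_1,\dots,\mathbf{w}_N\}$. $\nu>0$ is a constant, and $\mathbf{f}\in H$ is time independent. A solution of the Navier–Stokes equations on $[0,\infty)$ means $\mathbf{u}\in C([0,\infty);H)\cap L^2_{loc}(0,\infty;V)$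 with $d\mathbf{u}/dt\in L^2_{loc}(0,\infty;V')$ satisfying the displayed equation. $\mathbb{N}$ includes $0$. Property $(\mathrm{I})$: $I_h:(H^1(\Omega))^2\to(L^2(\Omega))^2$ is linear and $\|\varphi-I_h(\varphi)\|_{(L^2(\Omega))^2}\le c_0^{1/2}h\|\varphi\|_{(H^1(\Omega))^2}$ for all $\varphi\in(H^1(\Omega))^2$, where $c_0>0$ is an absolute constant; by convention, for $\varphi\in V$ the norm on the right is taken to be $\|\varphi\|$. *)

theory Defs
  imports "HOL-Analysis.Analysis"
begin

section \<open>Square-integrable planar vector fields\<close>

text \<open>
  The type \<open>l2_field\<close> is \<open>(L\<^sup>2(\<real>\<^sup>2))\<^sup>2\<close>: square-integrable fields modulo equality almost everywhere.
  The space \<open>(L\<^sup>2(\<Omega>))\<^sup>2\<close> is the subspace of the fields that vanish outside \<open>\<Omega>\<close>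
  (extension by zero), see \<open>L2_on\<close> below.
\<close>

type_synonym vec2 = "real^2"

definition sq_integrable :: "(vec2 \<Rightarrow> vec2) \<Rightarrow> bool" where
  "sq_integrable f \<longleftrightarrow> f \<in> borel_measurable lborel \<and> integrable lborel (\<lambda>x. (norm (f x))\<^sup>2)"

definition l2_eq :: "(vec2 \<Rightarrow> vec2) \<Rightarrow> (vec2 \<Rightarrow> vec2) \<Rightarrow> bool" where
  "l2_eq f g \<longleftrightarrow> sq_integrable f \<and> sq_integrable g \<and> (AE x in lborel. f x = g x)"

lemma sq_integrable_zero: "sq_integrable (\<lambda>x. 0)"
  by (simp add: sq_integrable_def)

lemma sq_integrable_scaleR: "sq_integrable f \<Longrightarrow> sq_integrable (\<lambda>x. c *\<^sub>R f x)"
  by (auto simp: sq_integrable_def power_mult_distrib)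

lemma sq_integrable_add:
  assumes "sq_integrable f" "sq_integrable g"
  shows "sq_integrable (\<lambda>x. f x + g x)"
proof -
  have [measurable]: "f \<in> borel_measurable lborel" "g \<in> borel_measurable lborel"
    using assms by (auto simp: sq_integrable_def)
  have "integrable lborel (\<lambda>x. (norm (f x + g x))\<^sup>2)"
  proof (rule Bochner_Integration.integrable_bound)
    show "integrable lborel (\<lambda>x. 2 * (norm (f x))\<^sup>2 + 2 * (norm (g x))\<^sup>2)"
      using assms by (auto simp: sq_integrable_def)
    show "AE x in lborel. norm ((norm (f x + g x))\<^sup>2)
            \<le> norm (2 * (norm (f x))\<^sup>2 + 2 * (norm (g x))\<^sup>2)"
    proof (intro AE_I2)
      fix x
      have "(norm (f x + g x))\<^sup>2 \<le> (norm (f x) + norm (g x))\<^sup>2"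
        by (intro power_mono norm_triangle_ineq) simp
      also have "\<dots> \<le> 2 * (norm (f x))\<^sup>2 + 2 * (norm (g x))\<^sup>2"
        using sum_squares_bound[of "norm (f x)" "norm (g x)"] by (simp add: power2_sum)
      finally show "norm ((norm (f x + g x))\<^sup>2) \<le> norm (2 * (norm (f x))\<^sup>2 + 2 * (norm (g x))\<^sup>2)"
        by simp
    qed
  qed simp
  then show ?thesis by (simp add: sq_integrable_def)
qed

lemma sq_integrable_uminus: "sq_integrable f \<Longrightarrow> sq_integrable (\<lambda>x. - f x)"
  using sq_integrable_scaleR[of f "-1"] by simp

lemma sq_integrable_diff:
  "sq_integrable f \<Longrightarrow> sq_integrable g \<Longrightarrow> sq_integrable (\<lambda>x. f x - g x)"
  using sq_integrable_add[of f "\<lambda>x. - g x"] sq_integrable_uminus[of g] by simp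

lemma sq_integrable_inner:
  assumes "sq_integrable f" "sq_integrable g"
  shows "integrable lborel (\<lambda>x. f x \<bullet> g x)"
proof (rule Bochner_Integration.integrable_bound)
  have [measurable]: "f \<in> borel_measurable lborel" "g \<in> borel_measurable lborel"
    using assms by (auto simp: sq_integrable_def)
  show "integrable lborel (\<lambda>x. (norm (f x))\<^sup>2 + (norm (g x))\<^sup>2)"
    using assms by (auto simp: sq_integrable_def)
  show "(\<lambda>x. f x \<bullet> g x) \<in> borel_measurable lborel" by simp
  show "AE x in lborel. norm (f x \<bullet> g x) \<le> norm ((norm (f x))\<^sup>2 + (norm (g x))\<^sup>2)"
  proof (intro AE_I2)
    fix x
    have "\<bar>f x \<bullet> g x\<bar> \<le> norm (f x) * norm (g x)" by (rule Cauchy_Schwarz_ineq2)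
    also have "\<dots> \<le> (norm (f x))\<^sup>2 + (norm (g x))\<^sup>2"
      using sum_squares_bound[of "norm (f x)" "norm (g x)"]
        mult_nonneg_nonneg[OF norm_ge_zero[of "f x"] norm_ge_zero[of "g x"]] by linarith
    finally show "norm (f x \<bullet> g x) \<le> norm ((norm (f x))\<^sup>2 + (norm (g x))\<^sup>2)" by simp
  qed
qed

quotient_type l2_field = "vec2 \<Rightarrow> vec2" / partial: l2_eq
proof (rule part_equivpI)
  show "\<exists>f. l2_eq f f"
    by (rule exI[of _ "\<lambda>x. 0"]) (simp add: l2_eq_def sq_integrable_zero)
  show "symp l2_eq"
    by (rule sympI) (auto simp: l2_eq_def)
  show "transp l2_eq"
    by (rule transpI) (auto simp: l2_eq_def elim: AE_mp)
qed

instantiation l2_field :: real_inner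
begin

lift_definition zero_l2_field :: l2_field is "\<lambda>x. 0"
  by (simp add: l2_eq_def sq_integrable_zero)

lift_definition plus_l2_field :: "l2_field \<Rightarrow> l2_field \<Rightarrow> l2_field" is "\<lambda>f g x. f x + g x"
  by (auto simp: l2_eq_def sq_integrable_add)

lift_definition minus_l2_field :: "l2_field \<Rightarrow> l2_field \<Rightarrow> l2_field" is "\<lambda>f g x. f x - g x"
  by (auto simp: l2_eq_def sq_integrable_diff)

lift_definition uminus_l2_field :: "l2_field \<Rightarrow> l2_field" is "\<lambda>f x. - f x"
  by (auto simp: l2_eq_def sq_integrable_uminus)

lift_definition scaleR_l2_field :: "real \<Rightarrow> l2_field \<Rightarrow> l2_field" is "\<lambda>c f x. c *\<^sub>R f x"
  by (auto simp: l2_eq_def sq_integrable_scaleR)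

lift_definition inner_l2_field :: "l2_field \<Rightarrow> l2_field \<Rightarrow> real"
  is "\<lambda>f g. LINT x|lborel. f x \<bullet> g x"
  unfolding l2_eq_def
  by (intro integral_cong_AE) (auto simp: sq_integrable_def)

definition norm_l2_field :: "l2_field \<Rightarrow> real" where
  "norm_l2_field f = sqrt (f \<bullet> f)"

definition sgn_l2_field :: "l2_field \<Rightarrow> l2_field" where
  "sgn_l2_field f = inverse (norm f) *\<^sub>R f"

definition dist_l2_field :: "l2_field \<Rightarrow> l2_field \<Rightarrow> real" where
  "dist_l2_field f g = norm (f - g)"

definition uniformity_l2_field :: "(l2_field \<times> l2_field) filter" where
  "uniformity_l2_field = (INF e\<in>{0<..}. principal {(f, g). dist f g < e})"

definition open_l2_field :: "l2_field set \<Rightarrow> bool" where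
  "open_l2_field U \<longleftrightarrow> (\<forall>f\<in>U. \<forall>\<^sub>F (f', g) in uniformity. f' = f \<longrightarrow> g \<in> U)"

instance
proof
  fix f g k :: l2_field and a b :: real
  show "f + g + k = f + (g + k)"
    by transfer (auto simp: l2_eq_def algebra_simps intro!: sq_integrable_add)
  show "f + g = g + f"
    by transfer (auto simp: l2_eq_def algebra_simps intro!: sq_integrable_add)
  show "0 + f = f"
    by transfer (auto simp: l2_eq_def)
  show "- f + f = 0"
    by transfer (auto simp: l2_eq_def sq_integrable_zero)
  show "f - g = f + - g"
    by transfer (auto simp: l2_eq_def intro!: sq_integrable_diff)
  show "a *\<^sub>R (f + g) = a *\<^sub>R f + a *\<^sub>R g"
    by transfer (auto simp: l2_eq_def scaleR_add_right
        intro!: sq_integrable_add sq_integrable_scaleR)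
  show "(a + b) *\<^sub>R f = a *\<^sub>R f + b *\<^sub>R f"
    by transfer (auto simp: l2_eq_def scaleR_add_left
        intro!: sq_integrable_add sq_integrable_scaleR)
  show "a *\<^sub>R b *\<^sub>R f = (a * b) *\<^sub>R f"
    by transfer (auto simp: l2_eq_def intro!: sq_integrable_scaleR)
  show "1 *\<^sub>R f = f"
    by transfer (auto simp: l2_eq_def)
  show "dist f g = norm (f - g)" by (rule dist_l2_field_def)
  show "sgn f = inverse (norm f) *\<^sub>R f" by (rule sgn_l2_field_def)
  show "norm f = sqrt (f \<bullet> f)" by (rule norm_l2_field_def)
  show "f \<bullet> g = g \<bullet> f"
    by transfer (simp add: inner_commute)
  show "(f + g) \<bullet> k = f \<bullet> k + g \<bullet> k"
    by transfer (auto simp: l2_eq_def inner_add_left sq_integrable_inner)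
  show "(a *\<^sub>R f) \<bullet> g = a * (f \<bullet> g)"
    by transfer simp
  show "0 \<le> f \<bullet> f"
    by transfer simp
  show "(f \<bullet> f = 0) \<longleftrightarrow> f = 0"
  proof (transfer, goal_cases)
    case (1 f)
    then have f: "sq_integrable f" by (simp add: l2_eq_def)
    have "(LINT x|lborel. f x \<bullet> f x) = 0 \<longleftrightarrow> (AE x in lborel. f x \<bullet> f x = 0)"
      by (intro integral_nonneg_eq_0_iff_AE sq_integrable_inner f) simp
    then show ?case using f by (simp add: l2_eq_def sq_integrable_zero)
  qed
qed (rule uniformity_l2_field_def, rule open_l2_field_def)

end

definition L2_on :: "vec2 set \<Rightarrow> l2_field set" where
  "L2_on \<Omega> = {f. AE x in lborel. x \<notin> \<Omega> \<longrightarrow> rep_l2_field f x = 0}"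

text \<open>The class in \<open>(L\<^sup>2(\<Omega>))\<^sup>2\<close> of a pointwise defined field that is square-integrable on \<open>\<Omega>\<close>.\<close>

definition L2_class :: "vec2 set \<Rightarrow> (vec2 \<Rightarrow> vec2) \<Rightarrow> l2_field" where
  "L2_class \<Omega> \<phi> = abs_l2_field (\<lambda>x. indicator \<Omega> x *\<^sub>R \<phi> x)"

text \<open>
  Orthogonal projector onto \<open>S\<close>. It is total on \<open>l2_field\<close> when \<open>S\<close> is a closed subspace.
\<close>

definition orth_proj :: "l2_field set \<Rightarrow> l2_field \<Rightarrow> l2_field" where
  "orth_proj S g = (THE p. p \<in> S \<and> (\<forall>z\<in>S. (g - p) \<bullet> z = 0))"


section \<open>Smooth functions, weak derivatives, Sobolev spaces\<close>

text \<open>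
  \<open>C\<^sup>\<infinity>\<close> on the whole space: the largest class of everywhere differentiable functions that is
  closed under taking directional derivatives.
\<close>

coinductive smooth :: "('a::euclidean_space \<Rightarrow> 'b::euclidean_space) \<Rightarrow> bool" where
  "\<lbrakk>\<And>x. \<phi> differentiable (at x); \<And>v. smooth (\<lambda>x. frechet_derivative \<phi> (at x) v)\<rbrakk> \<Longrightarrow> smooth \<phi>"

text \<open>\<open>C\<^sub>c\<^sup>\<infinity>(S)\<close>, extended by zero.\<close>

definition smooth_cs :: "'a::euclidean_space set \<Rightarrow> ('a \<Rightarrow> 'b::euclidean_space) \<Rightarrow> bool" where
  "smooth_cs S \<phi> \<longleftrightarrow> smooth \<phi> \<and> (\<exists>K. compact K \<and> K \<subseteq> S \<and> (\<forall>x. x \<notin> K \<longrightarrow> \<phi> x = 0))"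

definition pderiv_at :: "2 \<Rightarrow> (vec2 \<Rightarrow> 'b::real_normed_vector) \<Rightarrow> vec2 \<Rightarrow> 'b" where
  "pderiv_at j \<phi> x = frechet_derivative \<phi> (at x) (axis j 1)"

definition divergence :: "(vec2 \<Rightarrow> vec2) \<Rightarrow> vec2 \<Rightarrow> real" where
  "divergence \<phi> x = (\<Sum>j\<in>UNIV. pderiv_at j \<phi> x $ j)"

text \<open>\<open>(\<psi> \<cdot> \<nabla>)\<phi>\<close> is the derivative of \<open>\<phi>\<close> in the direction \<open>\<psi>\<close>.\<close>

definition convect :: "(vec2 \<Rightarrow> vec2) \<Rightarrow> (vec2 \<Rightarrow> vec2) \<Rightarrow> vec2 \<Rightarrow> vec2" where
  "convect \<psi> \<phi> x = frechet_derivative \<phi> (at x) (\<psi> x)"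

definition is_weak_deriv :: "vec2 set \<Rightarrow> 2 \<Rightarrow> l2_field \<Rightarrow> l2_field \<Rightarrow> bool" where
  "is_weak_deriv \<Omega> j \<phi> g \<longleftrightarrow> g \<in> L2_on \<Omega> \<and>
     (\<forall>\<theta> :: vec2 \<Rightarrow> real. smooth_cs \<Omega> \<theta> \<longrightarrow>
        (LINT x|lborel. pderiv_at j \<theta> x *\<^sub>R rep_l2_field \<phi> x)
          = - (LINT x|lborel. \<theta> x *\<^sub>R rep_l2_field g x))"

definition weak_deriv :: "vec2 set \<Rightarrow> 2 \<Rightarrow> l2_field \<Rightarrow> l2_field" where
  "weak_deriv \<Omega> j \<phi> = (THE g. is_weak_deriv \<Omega> j \<phi> g)"

definition H1 :: "vec2 set \<Rightarrow> l2_field set" where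
  "H1 \<Omega> = {\<phi> \<in> L2_on \<Omega>. \<forall>j. \<exists>g. is_weak_deriv \<Omega> j \<phi> g}"

definition H2 :: "vec2 set \<Rightarrow> l2_field set" where
  "H2 \<Omega> = {\<phi> \<in> H1 \<Omega>. \<forall>j. weak_deriv \<Omega> j \<phi> \<in> H1 \<Omega>}"

definition grad_inner :: "vec2 set \<Rightarrow> l2_field \<Rightarrow> l2_field \<Rightarrow> real" where
  "grad_inner \<Omega> \<psi> \<phi> = (\<Sum>j\<in>UNIV. weak_deriv \<Omega> j \<psi> \<bullet> weak_deriv \<Omega> j \<phi>)"

definition grad_norm :: "vec2 set \<Rightarrow> l2_field \<Rightarrow> real" where
  "grad_norm \<Omega> \<phi> = sqrt (grad_inner \<Omega> \<phi> \<phi>)"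

definition H1_norm :: "vec2 set \<Rightarrow> l2_field \<Rightarrow> real" where
  "H1_norm \<Omega> \<phi> = sqrt ((norm \<phi>)\<^sup>2 + (grad_norm \<Omega> \<phi>)\<^sup>2)"

definition H2_norm :: "vec2 set \<Rightarrow> l2_field \<Rightarrow> real" where
  "H2_norm \<Omega> \<phi> = sqrt ((H1_norm \<Omega> \<phi>)\<^sup>2 + (\<Sum>j\<in>UNIV. (grad_norm \<Omega> (weak_deriv \<Omega> j \<phi>))\<^sup>2))"

definition laplacian :: "vec2 set \<Rightarrow> l2_field \<Rightarrow> l2_field" where
  "laplacian \<Omega> \<phi> = (\<Sum>j\<in>UNIV. weak_deriv \<Omega> j (weak_deriv \<Omega> j \<phi>))"


section \<open>The two flow settings\<close>

datatype setting = Periodic real | No_Slip "vec2 set"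

fun flow_domain :: "setting \<Rightarrow> vec2 set" where
  "flow_domain (Periodic L) = {x. \<forall>i. 0 < x $ i \<and> x $ i < L}"
| "flow_domain (No_Slip \<Omega>) = \<Omega>"

definition C2_function :: "(real \<Rightarrow> real) \<Rightarrow> bool" where
  "C2_function \<gamma> \<longleftrightarrow> (\<exists>\<gamma>' \<gamma>''. (\<forall>s. (\<gamma> has_real_derivative \<gamma>' s) (at s))
     \<and> (\<forall>s. (\<gamma>' has_real_derivative \<gamma>'' s) (at s)) \<and> continuous_on UNIV \<gamma>'')"

text \<open>
  Near each boundary point, in suitable orthonormal coordinates, \<open>\<Omega>\<close> is the region strictly above
  the graph of a \<open>C\<^sup>2\<close> function.
\<close>

definition C2_boundary :: "vec2 set \<Rightarrow> bool" where
  "C2_boundary \<Omega> \<longleftrightarrow> (\<forall>p\<in>frontier \<Omega>. \<exists>r>0. \<exists>e1 e2 \<gamma>.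
     norm e1 = 1 \<and> norm e2 = 1 \<and> e1 \<bullet> e2 = 0 \<and> C2_function \<gamma> \<and>
     (\<forall>x\<in>ball p r. x \<in> \<Omega> \<longleftrightarrow> \<gamma> ((x - p) \<bullet> e1) < (x - p) \<bullet> e2))"

fun admissible :: "setting \<Rightarrow> bool" where
  "admissible (Periodic L) \<longleftrightarrow> 0 < L"
| "admissible (No_Slip \<Omega>) \<longleftrightarrow> open \<Omega> \<and> bounded \<Omega> \<and> connected \<Omega> \<and> C2_boundary \<Omega>"

definition trig_poly :: "real \<Rightarrow> (vec2 \<Rightarrow> vec2) \<Rightarrow> bool" where
  "trig_poly L \<phi> \<longleftrightarrow> (\<exists>(K :: (int \<times> int) set) a b. finite K \<and>
     (\<forall>x. \<phi> x = (\<Sum>(m, n)\<in>K. cos (2 * pi / L * (of_int m * x $ 1 + of_int n * x $ 2)) *\<^sub>R a (m, n)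
                          + sin (2 * pi / L * (of_int m * x $ 1 + of_int n * x $ 2)) *\<^sub>R b (m, n))))"

text \<open>The space \<open>\<V>\<close>, first as a set of pointwise defined fields.\<close>

fun smooth_fields :: "setting \<Rightarrow> (vec2 \<Rightarrow> vec2) set" where
  "smooth_fields (Periodic L) = {\<phi>. trig_poly L \<phi> \<and> (\<forall>x. divergence \<phi> x = 0)
      \<and> (LINT x:flow_domain (Periodic L)|lborel. \<phi> x) = 0}"
| "smooth_fields (No_Slip \<Omega>) = {\<phi>. smooth_cs \<Omega> \<phi> \<and> (\<forall>x. divergence \<phi> x = 0)}"

definition calV :: "setting \<Rightarrow> l2_field set" where
  "calV D = L2_class (flow_domain D) ` smooth_fields D"

definition H_space :: "setting \<Rightarrow> l2_field set" where
  "H_space D = closure (calV D)"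

definition V_space :: "setting \<Rightarrow> l2_field set" where
  "V_space D = {\<phi> \<in> H1 (flow_domain D). \<exists>s. (\<forall>n. s n \<in> calV D)
     \<and> (\<lambda>n. H1_norm (flow_domain D) (s n - \<phi>)) \<longlonglongrightarrow> 0}"

abbreviation V_inner :: "setting \<Rightarrow> l2_field \<Rightarrow> l2_field \<Rightarrow> real" where
  "V_inner D \<equiv> grad_inner (flow_domain D)"

abbreviation V_norm :: "setting \<Rightarrow> l2_field \<Rightarrow> real" where
  "V_norm D \<equiv> grad_norm (flow_domain D)"

definition leray :: "setting \<Rightarrow> l2_field \<Rightarrow> l2_field" where
  "leray D = orth_proj (H_space D)"

text \<open>
  In the periodic case the \<open>H\<^sup>2\<close>-regularity in the domain of the Stokes operator is that of periodic
  functions: without periodicity of the first derivatives, \<open>-P\<^sub>\<sigma>\<Delta>\<close> would not be symmetric.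
\<close>

fun H2_bc :: "setting \<Rightarrow> l2_field set" where
  "H2_bc (Periodic L) = (let \<Omega> = flow_domain (Periodic L) in
     {\<phi> \<in> H2 \<Omega>. \<exists>s. (\<forall>n. s n \<in> L2_class \<Omega> ` {p. trig_poly L p})
        \<and> (\<lambda>n. H2_norm \<Omega> (s n - \<phi>)) \<longlonglongrightarrow> 0})"
| "H2_bc (No_Slip \<Omega>) = H2 \<Omega>"

definition stokes_domain :: "setting \<Rightarrow> l2_field set" where
  "stokes_domain D = H2_bc D \<inter> V_space D"

definition stokes :: "setting \<Rightarrow> l2_field \<Rightarrow> l2_field" where
  "stokes D \<phi> = - leray D (laplacian (flow_domain D) \<phi>)"

text \<open>\<open>w 0, w 1, \<dots>\<close> are the eigenvectors \<open>w\<^sub>1, w\<^sub>2, \<dots>\<close> of the Stokes operator.\<close>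

definition stokes_eigenbasis :: "setting \<Rightarrow> (nat \<Rightarrow> l2_field) \<Rightarrow> (nat \<Rightarrow> real) \<Rightarrow> bool" where
  "stokes_eigenbasis D w lam \<longleftrightarrow>
     (\<forall>j. w j \<in> stokes_domain D \<and> stokes D (w j) = lam j *\<^sub>R w j) \<and>
     (\<forall>i j. w i \<bullet> w j = (if i = j then 1 else 0)) \<and>
     closure (span (range w)) = H_space D \<and>
     0 < lam 0 \<and> mono lam \<and> filterlim lam at_top sequentially"

definition galerkin :: "(nat \<Rightarrow> l2_field) \<Rightarrow> nat \<Rightarrow> l2_field \<Rightarrow> l2_field" where
  "galerkin w N = orth_proj (span (w ` {..<N}))"


section \<open>The dual of V and the bilinear term\<close>

text \<open>
  Elements of \<open>V'\<close> are represented by functions on \<open>l2_field\<close> of which only the values on \<open>V\<close> matter.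
  A field \<open>g \<in> H\<close> is identified with the functional \<open>\<zeta> \<mapsto> (g, \<zeta>)\<close>.
\<close>

definition V_dual :: "setting \<Rightarrow> (l2_field \<Rightarrow> real) set" where
  "V_dual D = {F. (\<forall>\<zeta>\<in>V_space D. \<forall>\<eta>\<in>V_space D. \<forall>a b. F (a *\<^sub>R \<zeta> + b *\<^sub>R \<eta>) = a * F \<zeta> + b * F \<eta>)
     \<and> (\<exists>C. \<forall>\<zeta>\<in>V_space D. \<bar>F \<zeta>\<bar> \<le> C * V_norm D \<zeta>)}"

definition dual_norm :: "setting \<Rightarrow> (l2_field \<Rightarrow> real) \<Rightarrow> real" where
  "dual_norm D F = (SUP \<zeta>\<in>{\<zeta> \<in> V_space D. V_norm D \<zeta> \<le> 1}. \<bar>F \<zeta>\<bar>)"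

text \<open>
  The extension of \<open>P\<^sub>N\<close> to \<open>V'\<close>; for \<open>F = (g, \<cdot>)\<close> with \<open>g \<in> H\<close> this is \<open>P\<^sub>N g = \<Sum> (g, w\<^sub>j) w\<^sub>j\<close>.
\<close>

definition galerkin_dual :: "(nat \<Rightarrow> l2_field) \<Rightarrow> nat \<Rightarrow> (l2_field \<Rightarrow> real) \<Rightarrow> l2_field" where
  "galerkin_dual w N F = (\<Sum>j<N. F (w j) *\<^sub>R w j)"

text \<open>
  \<open>B\<close> is the continuous extension to \<open>V \<times> V \<rightarrow> V'\<close> of \<open>(\<psi>, \<phi>) \<mapsto> P\<^sub>\<sigma>((\<psi> \<cdot> \<nabla>)\<phi>)\<close>, \<open>\<psi>, \<phi> \<in> \<V>\<close>.
  Since \<open>\<V>\<close> is dense in \<open>V\<close>, this determines \<open>B\<close> on \<open>V \<times> V\<close>.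
\<close>

definition is_bilinear_term :: "setting \<Rightarrow> (l2_field \<Rightarrow> l2_field \<Rightarrow> l2_field \<Rightarrow> real) \<Rightarrow> bool" where
  "is_bilinear_term D B \<longleftrightarrow>
     (\<forall>\<psi>\<in>V_space D. \<forall>\<phi>\<in>V_space D. B \<psi> \<phi> \<in> V_dual D) \<and>
     (\<forall>\<psi>\<in>smooth_fields D. \<forall>\<phi>\<in>smooth_fields D. \<forall>\<zeta>\<in>V_space D.
        B (L2_class (flow_domain D) \<psi>) (L2_class (flow_domain D) \<phi>) \<zeta>
          = leray D (L2_class (flow_domain D) (convect \<psi> \<phi>)) \<bullet> \<zeta>) \<and>
     (\<forall>\<psi>\<in>V_space D. \<forall>\<phi>\<in>V_space D. \<forall>\<psi>s \<phi>s.
        (\<forall>n. \<psi>s n \<in> V_space D \<and> \<phi>s n \<in> V_space D) \<longrightarrow>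
        (\<lambda>n. V_norm D (\<psi>s n - \<psi>)) \<longlonglongrightarrow> 0 \<longrightarrow> (\<lambda>n. V_norm D (\<phi>s n - \<phi>)) \<longlonglongrightarrow> 0 \<longrightarrow>
        (\<lambda>n. dual_norm D (\<lambda>\<zeta>. B (\<psi>s n) (\<phi>s n) \<zeta> - B \<psi> \<phi> \<zeta>)) \<longlonglongrightarrow> 0)"


section \<open>Solutions of the Navier--Stokes equations\<close>

text \<open>
  For \<open>V\<close>- and \<open>V'\<close>-valued functions of time, strong measurability is weak measurability, as both
  spaces are separable; for \<open>u\<close> it follows from the continuity into \<open>H\<close>.
\<close>

definition L2_loc_V :: "setting \<Rightarrow> (real \<Rightarrow> l2_field) \<Rightarrow> bool" where
  "L2_loc_V D u \<longleftrightarrow> (AE t in lebesgue. 0 < t \<longrightarrow> u t \<in> V_space D) \<and>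
     (\<forall>a b. 0 < a \<longrightarrow> a < b \<longrightarrow> set_integrable lebesgue {a..b} (\<lambda>t. (V_norm D (u t))\<^sup>2))"

definition L2_loc_V_dual :: "setting \<Rightarrow> (real \<Rightarrow> l2_field \<Rightarrow> real) \<Rightarrow> bool" where
  "L2_loc_V_dual D g \<longleftrightarrow> (AE t in lebesgue. 0 < t \<longrightarrow> g t \<in> V_dual D) \<and>
     (\<forall>\<zeta>\<in>V_space D. (\<lambda>t. g t \<zeta>) \<in> borel_measurable (lebesgue_on {0<..})) \<and>
     (\<forall>a b. 0 < a \<longrightarrow> a < b \<longrightarrow> set_integrable lebesgue {a..b} (\<lambda>t. (dual_norm D (g t))\<^sup>2))"

definition is_time_deriv :: "setting \<Rightarrow> (real \<Rightarrow> l2_field) \<Rightarrow> (real \<Rightarrow> l2_field \<Rightarrow> real) \<Rightarrow> bool" where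
  "is_time_deriv D u g \<longleftrightarrow> (\<forall>\<zeta>\<in>V_space D. \<forall>\<theta> :: real \<Rightarrow> real. smooth_cs {0<..} \<theta> \<longrightarrow>
     (LINT t|lebesgue. deriv \<theta> t * (u t \<bullet> \<zeta>)) = - (LINT t|lebesgue. \<theta> t * g t \<zeta>))"

text \<open>
  The equation holds in \<open>V'\<close> for almost every \<open>t\<close>, with \<open>A\<close> extended to \<open>V \<rightarrow> V'\<close> by
  \<open>\<langle>A\<psi>, \<zeta>\<rangle> = ((\<psi>, \<zeta>))\<close>.
\<close>

definition ns_solution ::
    "setting \<Rightarrow> real \<Rightarrow> l2_field \<Rightarrow> (l2_field \<Rightarrow> l2_field \<Rightarrow> l2_field \<Rightarrow> real) \<Rightarrow> (real \<Rightarrow> l2_field) \<Rightarrow> bool"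
  where
  "ns_solution D \<nu> f B u \<longleftrightarrow>
     (\<forall>t\<ge>0. u t \<in> H_space D) \<and> continuous_on {0..} u \<and> L2_loc_V D u \<and>
     (\<exists>u'. L2_loc_V_dual D u' \<and> is_time_deriv D u u' \<and>
        (AE t in lebesgue. 0 < t \<longrightarrow> (\<forall>\<zeta>\<in>V_space D.
            u' t \<zeta> + \<nu> * V_inner D (u t) \<zeta> + B (u t) (u t) \<zeta> = f \<bullet> \<zeta>)))"


section \<open>The interpolant and the scheme\<close>

text \<open>
  The operator \<open>I\<^sub>h\<close> has domain \<open>(H\<^sup>1(\<Omega>))\<^sup>2\<close>. As a total function it carries a linear extension to
  \<open>l2_field\<close>, which always exists (algebraic complement) and is otherwise unconstrained: the
  range condition and the estimate concern \<open>(H\<^sup>1(\<Omega>))\<^sup>2\<close> only.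
\<close>

definition interpolant :: "setting \<Rightarrow> real \<Rightarrow> real \<Rightarrow> (l2_field \<Rightarrow> l2_field) \<Rightarrow> bool" where
  "interpolant D c0 h I \<longleftrightarrow> linear I \<and>
     (\<forall>\<phi>\<in>H1 (flow_domain D). I \<phi> \<in> L2_on (flow_domain D) \<and>
        norm (\<phi> - I \<phi>) \<le> sqrt c0 * h *
          (if \<phi> \<in> V_space D then V_norm D \<phi> else H1_norm (flow_domain D) \<phi>))"

definition euler_scheme ::
    "setting \<Rightarrow> real \<Rightarrow> l2_field \<Rightarrow> (l2_field \<Rightarrow> l2_field \<Rightarrow> l2_field \<Rightarrow> real) \<Rightarrow> (nat \<Rightarrow> l2_field) \<Rightarrow> nat
      \<Rightarrow> real \<Rightarrow> real \<Rightarrow> (l2_field \<Rightarrow> l2_field) \<Rightarrow> (real \<Rightarrow> l2_field) \<Rightarrow> (nat \<Rightarrow> l2_field) \<Rightarrow> bool"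
  where
  "euler_scheme D \<nu> f B w N \<tau> \<beta> I u v \<longleftrightarrow> (\<forall>k.
     (v (Suc k) - v k) /\<^sub>R \<tau> + \<nu> *\<^sub>R stokes D (v (Suc k)) + galerkin_dual w N (B (v k) (v (Suc k)))
       = galerkin w N f - \<beta> *\<^sub>R galerkin w N (leray D (I (v (Suc k) - u (real (Suc k) * \<tau>)))))"

end

theory Submission
  imports Defs "HOL-Real_Asymp.Real_Asymp"
begin

text \<open>
  One step of the scheme is a linear equation \<open>T v\<^sup>k\<^sup>+\<^sup>1 = y\<close> on the finite-dimensional space \<open>P\<^sub>N H\<close>, so it
  suffices that \<open>T\<close> has trivial kernel. Pairing \<open>T x\<close> with \<open>x\<close> gives
  \<open>\<bar>x\<bar>\<^sup>2/\<tau> + \<nu>\<parallel>x\<parallel>\<^sup>2 + \<beta>(I\<^sub>h x, x)\<close>, since \<open>\<langle>B(v, x), x\<rangle> = 0\<close>. By Young's inequality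
  \<open>\<beta>(x - I\<^sub>h x, x) \<le> c\<^sub>0\<beta>h\<^sup>2\<parallel>x\<parallel>\<^sup>2/2 + \<beta>\<bar>x\<bar>\<^sup>2/2\<close>, and \<open>c\<^sub>0\<beta>h\<^sup>2 \<le> \<nu>\<close> leaves at least \<open>\<bar>x\<bar>\<^sup>2/\<tau>\<close>.

  The Leray projector exists because \<open>L\<^sup>2\<close> is complete, and weak derivatives are unique by the
  fundamental lemma of the calculus of variations. Integration by parts for smooth fields extends to \<open>V\<close> by density, which gives
  \<open>(A x, x) = \<parallel>x\<parallel>\<^sup>2\<close> and the skew symmetry of \<open>B\<close>.
\<close>

section \<open>Completeness of the space of square-integrable fields\<close>

text \<open>Three features of the definitions shape the proof. Projections and weak derivatives are
  definite descriptions, so each has to be shown to denote something before any fact about it can be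
  used; for \<open>leray\<close> the required element is built as a limit of Fourier sums in the
  Stokes eigenbasis. The bilinear term is specified only by its values on smooth fields and by
  continuity on V, and an element of V' is a function whose values off V carry no meaning; hence
  even linearity of B in its second argument has to be derived, first for smooth fields, then in the
  limit. Finally the step operator is known to be linear only on the span of the first N
  eigenvectors, a subspace of an infinite-dimensional type, so injectivity is turned into
  surjectivity by counting independent vectors in that span. The velocity u enters the linear system
  through its right-hand side alone, which is why the kernel computation does not see it.\<close>

lemma l2_eq_refl_iff: "l2_eq f f \<longleftrightarrow> sq_integrable f"
  by (simp add: l2_eq_def)

lemma sq_integrable_rep: "sq_integrable (rep_l2_field f)"
  using Quotient3_rep_reflp[OF Quotient3_l2_field, of f] by (simp add: l2_eq_def)

lemma abs_rep_l2_field: "abs_l2_field (rep_l2_field f) = f"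
  by (rule Quotient3_abs_rep[OF Quotient3_l2_field])

lemma abs_l2_field_eq_iff:
  assumes "sq_integrable f" "sq_integrable g"
  shows "abs_l2_field f = abs_l2_field g \<longleftrightarrow> (AE x in lborel. f x = g x)"
  using Quotient3_rel[OF Quotient3_l2_field, of f g] assms by (auto simp: l2_eq_def)

text \<open>A chosen representative is pinned down only up to a null set, so the pointwise arguments
  below are all a.e. statements.\<close>

lemma rep_abs_l2_field:
  assumes "sq_integrable f"
  shows "AE x in lborel. rep_l2_field (abs_l2_field f) x = f x"
  using abs_l2_field_eq_iff[OF sq_integrable_rep assms, of "abs_l2_field f"]
  by (simp add: abs_rep_l2_field)

lemma inner_abs_l2_field:
  assumes "sq_integrable f" "sq_integrable g"
  shows "abs_l2_field f \<bullet> abs_l2_field g = (LINT x|lborel. f x \<bullet> g x)"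
  using assms by (simp add: inner_l2_field.abs_eq l2_eq_refl_iff)

lemma inner_l2_field_rep: "f \<bullet> g = (LINT x|lborel. rep_l2_field f x \<bullet> rep_l2_field g x)"
  using inner_abs_l2_field[OF sq_integrable_rep sq_integrable_rep, of f g]
  by (simp add: abs_rep_l2_field)

lemma abs_l2_field_simps:
  assumes "sq_integrable f" "sq_integrable g"
  shows "abs_l2_field (\<lambda>x. f x + g x) = abs_l2_field f + abs_l2_field g"
    and "abs_l2_field (\<lambda>x. f x - g x) = abs_l2_field f - abs_l2_field g"
    and "abs_l2_field (\<lambda>x. c *\<^sub>R f x) = c *\<^sub>R abs_l2_field f"
  using assms by (simp_all add: plus_l2_field.abs_eq minus_l2_field.abs_eq
      scaleR_l2_field.abs_eq l2_eq_refl_iff)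

lemma rep_l2_field_diff:
  "AE x in lborel. rep_l2_field (f - g) x = rep_l2_field f x - rep_l2_field g x"
  using rep_abs_l2_field[OF sq_integrable_diff[OF sq_integrable_rep sq_integrable_rep], of f g]
  by (simp add: abs_l2_field_simps sq_integrable_rep abs_rep_l2_field)

lemma rep_l2_field_comb:
  "AE x in lborel. rep_l2_field (a *\<^sub>R f + b *\<^sub>R g) x
    = a *\<^sub>R rep_l2_field f x + b *\<^sub>R rep_l2_field g x"
  using rep_abs_l2_field[OF sq_integrable_add[OF sq_integrable_scaleR[OF sq_integrable_rep]
        sq_integrable_scaleR[OF sq_integrable_rep]], of a f b g]
  by (simp add: abs_l2_field_simps(1)[OF sq_integrable_scaleR[OF sq_integrable_rep]
        sq_integrable_scaleR[OF sq_integrable_rep]]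
      abs_l2_field_simps(3)[OF sq_integrable_rep sq_integrable_rep] abs_rep_l2_field)

lemma rep_l2_field_measurable [measurable]: "rep_l2_field f \<in> borel_measurable borel"
  using sq_integrable_rep[of f] by (simp add: sq_integrable_def)

text \<open>Stated for the nonnegative integral because the completeness proof uses monotone
  convergence and Fatou before integrability of the limit is known.\<close>

lemma nn_integral_rep_l2_field:
  "(\<integral>\<^sup>+x. ennreal ((norm (rep_l2_field f x))\<^sup>2) \<partial>lborel) = ennreal ((norm f)\<^sup>2)"
proof -
  have "(\<integral>\<^sup>+x. ennreal ((norm (rep_l2_field f x))\<^sup>2) \<partial>lborel)
      = ennreal (LINT x|lborel. (norm (rep_l2_field f x))\<^sup>2)"
    using sq_integrable_rep[of f] by (intro nn_integral_eq_integral) (auto simp: sq_integrable_def)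
  also have "(LINT x|lborel. (norm (rep_l2_field f x))\<^sup>2) = (norm f)\<^sup>2"
    by (simp add: power2_norm_eq_inner inner_l2_field_rep)
  finally show ?thesis .
qed

lemma nn_integral_rep_l2_field_diff:
  "(\<integral>\<^sup>+x. ennreal ((norm (rep_l2_field f x - rep_l2_field g x))\<^sup>2) \<partial>lborel) = ennreal ((norm (f - g))\<^sup>2)"
  unfolding nn_integral_rep_l2_field[symmetric]
  using rep_l2_field_diff[of f g] by (intro nn_integral_cong_AE) auto

text \<open>The weights \<open>2 ^ k\<close> turn an \<open>L\<^sup>2\<close> bound for the increments into a pointwise geometric one.\<close>

lemma AE_convergent_rep_l2_field:
  assumes Y: "\<And>k. norm (Y (Suc k) - Y k) \<le> (1/2) ^ k"
  shows "AE x in lborel. convergent (\<lambda>k. rep_l2_field (Y k) x)"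
proof -
  define d where "d k x = rep_l2_field (Y (Suc k)) x - rep_l2_field (Y k) x" for k x
  have [measurable]: "d k \<in> borel_measurable borel" for k unfolding d_def by measurable
  \<comment> \<open>Monotone convergence exchanges sum and integral; a finite integral then makes
    the series finite at almost every point.\<close>
  have "(\<integral>\<^sup>+x. (\<Sum>k. ennreal (2 ^ k * (norm (d k x))\<^sup>2)) \<partial>lborel)
      = (\<Sum>k. \<integral>\<^sup>+x. ennreal (2 ^ k * (norm (d k x))\<^sup>2) \<partial>lborel)"
    by (rule nn_integral_suminf) simp
  also have "\<dots> = (\<Sum>k. ennreal (2 ^ k * (norm (Y (Suc k) - Y k))\<^sup>2))"
    by (simp add: d_def ennreal_mult nn_integral_cmult nn_integral_rep_l2_field_diff)
  also have "\<dots> \<le> (\<Sum>k. ennreal ((1/2) ^ k))"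
  proof (intro suminf_le ennreal_leI)
    fix k
    have "(norm (Y (Suc k) - Y k))\<^sup>2 \<le> ((1/2) ^ k)\<^sup>2" using Y by (intro power_mono) auto
    then have "2 ^ k * (norm (Y (Suc k) - Y k))\<^sup>2 \<le> 2 ^ k * ((1/2) ^ k)\<^sup>2"
      by (intro mult_left_mono) auto
    also have "\<dots> = (1/2) ^ k"
      by (simp add: power2_eq_square power_divide)
    finally show "2 ^ k * (norm (Y (Suc k) - Y k))\<^sup>2 \<le> (1/2) ^ k" .
  qed auto
  also have "\<dots> = ennreal 2"
    using sums_unique[OF geometric_sums[of "1/2::real"]]
    by (subst suminf_ennreal2) (auto intro: summable_geometric)
  finally have "(\<integral>\<^sup>+x. (\<Sum>k. ennreal (2 ^ k * (norm (d k x))\<^sup>2)) \<partial>lborel) \<noteq> \<infinity>"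
    by (auto simp: top_unique)
  then have "AE x in lborel. (\<Sum>k. ennreal (2 ^ k * (norm (d k x))\<^sup>2)) \<noteq> \<infinity>"
    by (intro nn_integral_PInf_AE) auto
  then show ?thesis
  proof (eventually_elim)
    fix x assume "(\<Sum>k. ennreal (2 ^ k * (norm (d k x))\<^sup>2)) \<noteq> \<infinity>"
    then have "summable (\<lambda>k. 2 ^ k * (norm (d k x))\<^sup>2)"
      by (intro summable_suminf_not_top) auto
    \<comment> \<open>The terms of a convergent series are bounded, so the increments decay like
      \<open>sqrt (1/2) ^ k\<close> and their telescoping sum converges.\<close>
    then have "Bseq (\<lambda>k. 2 ^ k * (norm (d k x))\<^sup>2)"
      by (intro convergent_imp_Bseq convergentI[OF summable_LIMSEQ_zero])
    then obtain C where C: "\<And>k. 2 ^ k * (norm (d k x))\<^sup>2 \<le> C"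
      by (auto simp: Bseq_def)
    have "norm (d k x) \<le> sqrt C * (sqrt (1/2)) ^ k" for k
    proof -
      have "(norm (d k x))\<^sup>2 \<le> C * (1/2) ^ k"
        using C[of k] by (simp add: field_simps power_divide)
      then have "norm (d k x) \<le> sqrt (C * (1/2) ^ k)" by (rule real_le_rsqrt)
      then show ?thesis by (simp add: real_sqrt_mult real_sqrt_power)
    qed
    moreover have "summable (\<lambda>k. sqrt C * (sqrt (1/2)) ^ k)"
      by (rule summable_mult, rule summable_geometric) (simp add: real_sqrt_divide)
    ultimately have "summable (\<lambda>k. d k x)"
      by (rule summable_comparison_test'[where N = 0, rotated])
    then have "convergent (\<lambda>n. \<Sum>k<n. d k x)" by (simp add: summable_iff_convergent)
    then have "convergent (\<lambda>n. rep_l2_field (Y n) x - rep_l2_field (Y 0) x)"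
      by (simp only: d_def sum_lessThan_telescope[of "\<lambda>k. rep_l2_field (Y k) x"])
    then show "convergent (\<lambda>n. rep_l2_field (Y n) x)"
      by (simp only: convergent_diff_const_right_iff)
  qed
qed

lemma l2_field_fast_convergent:
  assumes Y: "\<And>k m. k \<le> m \<Longrightarrow> norm (Y m - Y k) \<le> (1/2) ^ k"
  shows "\<exists>g :: l2_field. Y \<longlonglongrightarrow> g"
proof -
  define y where "y k = rep_l2_field (Y k)" for k
  \<comment> \<open>Where the sequence diverges, \<open>lim\<close> is an unspecified value;
    \<open>g\<close> is still measurable, and only a null set is affected.\<close>
  define g where "g x = lim (\<lambda>k. y k x)" for x
  have [measurable]: "y k \<in> borel_measurable borel" for k by (simp add: y_def)
  have [measurable]: "g \<in> borel_measurable borel"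
    unfolding g_def by measurable
  have conv: "AE x in lborel. (\<lambda>k. y k x) \<longlonglongrightarrow> g x"
    using AE_convergent_rep_l2_field[of Y] Y by (auto simp: g_def y_def convergent_LIMSEQ_iff)
  \<comment> \<open>Fatou's lemma as m grows with k fixed.\<close>
  have bound: "(\<integral>\<^sup>+x. ennreal ((norm (g x - y k x))\<^sup>2) \<partial>lborel) \<le> ennreal (((1/2) ^ k)\<^sup>2)" for k
  proof -
    have "(\<integral>\<^sup>+x. ennreal ((norm (g x - y k x))\<^sup>2) \<partial>lborel)
        = (\<integral>\<^sup>+x. liminf (\<lambda>m. ennreal ((norm (y m x - y k x))\<^sup>2)) \<partial>lborel)"
    proof (intro nn_integral_cong_AE)
      show "AE x in lborel. ennreal ((norm (g x - y k x))\<^sup>2)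
          = liminf (\<lambda>m. ennreal ((norm (y m x - y k x))\<^sup>2))"
        using conv
      proof eventually_elim
        case (elim x)
        have "(\<lambda>m. ennreal ((norm (y m x - y k x))\<^sup>2)) \<longlonglongrightarrow> ennreal ((norm (g x - y k x))\<^sup>2)"
          by (intro tendsto_intros elim)
        then show ?case by (intro lim_imp_Liminf[symmetric]) auto
      qed
    qed
    also have "\<dots> \<le> liminf (\<lambda>m. \<integral>\<^sup>+x. ennreal ((norm (y m x - y k x))\<^sup>2) \<partial>lborel)"
      by (rule nn_integral_liminf) simp
    also have "\<dots> = liminf (\<lambda>m. ennreal ((norm (Y m - Y k))\<^sup>2))"
      by (simp add: y_def nn_integral_rep_l2_field_diff)
    also have "\<dots> \<le> limsup (\<lambda>m. ennreal ((norm (Y m - Y k))\<^sup>2))"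
      by (rule Liminf_le_Limsup) simp
    also have "\<dots> \<le> ennreal (((1/2) ^ k)\<^sup>2)"
      using Y by (intro Limsup_bounded eventually_sequentiallyI[of k] ennreal_leI power_mono) auto
    finally show ?thesis .
  qed
  have sq: "sq_integrable (\<lambda>x. g x - y k x)" for k
    unfolding sq_integrable_def integrable_iff_bounded
    using bound[of k] by (auto intro: le_less_trans)
  \<comment> \<open>Only differences with the limit are known to be square-integrable so far, so
    \<open>g\<close> is recovered from \<open>g - y 0\<close>.\<close>
  have "sq_integrable (\<lambda>x. (g x - y 0 x) + y 0 x)"
    using sq sq_integrable_rep by (intro sq_integrable_add) (auto simp: y_def)
  then have sqg: "sq_integrable g" by simp
  have "norm (Y k - abs_l2_field g) \<le> (1/2) ^ k" for k
  proof -
    have "ennreal ((norm (abs_l2_field g - Y k))\<^sup>2)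
        = (\<integral>\<^sup>+x. ennreal ((norm (rep_l2_field (abs_l2_field g) x - y k x))\<^sup>2) \<partial>lborel)"
      by (simp add: y_def nn_integral_rep_l2_field_diff)
    also have "\<dots> = (\<integral>\<^sup>+x. ennreal ((norm (g x - y k x))\<^sup>2) \<partial>lborel)"
      using rep_abs_l2_field[OF sqg] by (intro nn_integral_cong_AE) auto
    also note bound
    finally have "(norm (abs_l2_field g - Y k))\<^sup>2 \<le> ((1/2) ^ k)\<^sup>2" by simp
    then show ?thesis by (simp add: norm_minus_commute power2_le_iff_abs_le)
  qed
  then have "(\<lambda>k. Y k - abs_l2_field g) \<longlonglongrightarrow> 0"
    using Lim_null_comparison[OF _ LIMSEQ_power_zero[of "1/2::real"],
        where f = "\<lambda>k. Y k - abs_l2_field g"] by simp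
  then show ?thesis by (auto simp: LIM_zero_iff)
qed

text \<open>A Cauchy sequence converges once some subsequence does, so it suffices to extract one
  with geometrically small increments.\<close>

lemma l2_field_Cauchy_convergent:
  fixes X :: "nat \<Rightarrow> l2_field"
  assumes "Cauchy X"
  shows "convergent X"
proof -
  have "\<exists>M. \<forall>m\<ge>M. \<forall>n\<ge>M. norm (X m - X n) < (1/2) ^ k" for k
    using CauchyD[OF assms, of "(1/2) ^ k"] by simp
  then obtain M where M: "\<And>k m n. M k \<le> m \<Longrightarrow> M k \<le> n \<Longrightarrow> norm (X m - X n) < (1/2) ^ k"
    by metis
  \<comment> \<open>The maximum keeps \<open>r\<close> strictly increasing while \<open>r k\<close>
    stays at or beyond \<open>M k\<close>.\<close>
  define r where "r = rec_nat (M 0) (\<lambda>k n. max (Suc n) (M (Suc k)))"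
  have rM: "M k \<le> r k" for k by (cases k) (auto simp: r_def)
  have "r k < r (Suc k)" for k by (simp add: r_def less_max_iff_disj)
  then have r: "strict_mono r" by (simp add: strict_mono_Suc_iff)
  have "norm ((X \<circ> r) m - (X \<circ> r) k) \<le> (1/2) ^ k" if "k \<le> m" for k m
    using M[of k "r m" "r k"] rM[of k] strict_mono_leD[OF r that] by simp
  from l2_field_fast_convergent[OF this] obtain g where "(X \<circ> r) \<longlonglongrightarrow> g" by blast
  then show ?thesis
    using Cauchy_converges_subseq[OF assms r] by (auto simp: convergent_def)
qed

text \<open>Makes \<open>Cauchy_convergent\<close> available, on which the Fourier sums in
  \<open>orth_proj_exists\<close> rely.\<close>

instance l2_field :: complete_space
  by standard (rule l2_field_Cauchy_convergent)

section \<open>The fundamental lemma of the calculus of variations\<close>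

text \<open>For k = 0 this is the standard smooth function exp(-1/t) that is flat at the origin. The
  powers of 1/t make the family closed under differentiation up to linear combinations.\<close>

definition flat_exp :: "nat \<Rightarrow> real \<Rightarrow> real" where
  "flat_exp k t = (if 0 < t then (1 / t) ^ k * exp (- (1 / t)) else 0)"

text \<open>u^m / m! is a single term of the series of exp u, whose other terms are
  nonnegative.\<close>

lemma power_mult_exp_minus_le:
  assumes "0 \<le> (u::real)"
  shows "u ^ m * exp (- u) \<le> fact m"
proof -
  have "u ^ m /\<^sub>R fact m \<le> (\<Sum>n. u ^ n /\<^sub>R fact n)"
    using sum_le_suminf[OF summable_exp_generic[of u], of "{m}"] assms by simp
  then have "u ^ m \<le> fact m * exp u"
    by (simp add: exp_def field_simps)
  then show ?thesis by (simp add: exp_minus field_simps)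
qed

text \<open>Two additional powers of 1/t are absorbed by the exponential. The resulting quadratic
  decay makes the difference quotient at the origin tend to zero.\<close>

lemma flat_exp_bound: "\<bar>flat_exp k t\<bar> \<le> fact (k + 2) * t\<^sup>2"
proof (cases "0 < t")
  case True
  have "flat_exp k t = ((1 / t) ^ (k + 2) * exp (- (1 / t))) * t\<^sup>2"
    using True by (simp add: flat_exp_def power_add power2_eq_square field_simps)
  also have "\<dots> \<le> fact (k + 2) * t\<^sup>2"
    using True power_mult_exp_minus_le[of "1/t" "k + 2"] by (intro mult_right_mono) auto
  finally show ?thesis using True by (simp add: flat_exp_def)
qed (simp add: flat_exp_def)

lemma flat_exp_bounds: "0 \<le> flat_exp 0 t" "flat_exp 0 t \<le> 1"
  by (auto simp: flat_exp_def)

lemma has_real_derivative_flat_exp: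
  "(flat_exp k has_real_derivative (flat_exp (k + 2) t - real k * flat_exp (k + 1) t)) (at t)"
proof -
  consider "t < 0" | "t = 0" | "0 < t" by linarith
  then show ?thesis
  proof cases
    case 1
    have "((\<lambda>_. 0) has_real_derivative 0) (at t)" by simp
    then have "(flat_exp k has_real_derivative 0) (at t)"
      by (rule has_field_derivative_transform_within_open[where S = "{..<0}"])
        (use 1 in \<open>auto simp: flat_exp_def\<close>)
    then show ?thesis using 1 by (simp add: flat_exp_def)
  next
    case 2
    have lim: "(\<lambda>s. fact (k + 2) * \<bar>s\<bar>) \<midarrow>0\<rightarrow> (0::real)"
      by (rule tendsto_eq_intros | simp)+
    have "(\<lambda>s. flat_exp k s / s) \<midarrow>0\<rightarrow> 0"
    proof (rule Lim_null_comparison[OF _ lim])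
      have "norm (flat_exp k s / s) \<le> fact (k + 2) * \<bar>s\<bar>" if "s \<noteq> 0" for s
      proof -
        have "\<bar>flat_exp k s\<bar> \<le> (fact (k + 2) * \<bar>s\<bar>) * \<bar>s\<bar>"
          using flat_exp_bound[of k s] by (simp only: power2_eq_square mult.assoc abs_mult_self_eq)
        then show ?thesis using that by (simp add: pos_divide_le_eq del: fact_Suc)
      qed
      then show "\<forall>\<^sub>F s in at 0. norm (flat_exp k s / s) \<le> fact (k + 2) * \<bar>s\<bar>"
        by (simp add: eventually_at_filter)
    qed
    then have "(flat_exp k has_real_derivative 0) (at 0)"
      by (simp add: has_field_derivative_iff flat_exp_def)
    then show ?thesis using 2 by (simp add: flat_exp_def)
  next
    case 3
    have D: "((\<lambda>s. 1 / s) has_real_derivative - (1 / t\<^sup>2)) (at t)"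
      using 3 by (auto intro!: derivative_eq_intros simp: power2_eq_square)
    note DERIV_mult[OF DERIV_power[OF D, of k] DERIV_fun_exp[OF DERIV_minus[OF D]]]
    also have "real k * (- (1 / t\<^sup>2) * (1 / t) ^ (k - Suc 0)) * exp (- (1 / t))
          + exp (- (1 / t)) * - (- (1 / t\<^sup>2)) * (1 / t) ^ k
        = flat_exp (k + 2) t - real k * flat_exp (k + 1) t"
      \<comment> \<open>For k = 0 the exponent \<open>k - Suc 0\<close> truncates, but it comes with
        the factor \<open>real k\<close>, which is zero.\<close>
      using 3 by (cases k) (simp_all add: flat_exp_def algebra_simps power2_eq_square)
    finally show ?thesis
      by (rule has_field_derivative_transform_within_open[where S = "{0<..}"])
        (use 3 in \<open>auto simp: flat_exp_def\<close>)
  qed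
qed

text \<open>Closed under directional derivatives, hence contained in the coinductive class of smooth functions.\<close>

inductive flat_poly :: "('a::euclidean_space \<Rightarrow> real) \<Rightarrow> bool" where
  const: "flat_poly (\<lambda>x. c)"
| base: "flat_poly (\<lambda>x. flat_exp k (x \<bullet> v + c))"
| add: "flat_poly f \<Longrightarrow> flat_poly g \<Longrightarrow> flat_poly (\<lambda>x. f x + g x)"
| mult: "flat_poly f \<Longrightarrow> flat_poly g \<Longrightarrow> flat_poly (\<lambda>x. f x * g x)"

lemma flat_poly_derivative:
  "flat_poly f \<Longrightarrow> \<exists>f'. (\<forall>x. (f has_derivative f' x) (at x)) \<and> (\<forall>v. flat_poly (\<lambda>x. f' x v))"
proof (induction rule: flat_poly.induct)
  case (const c)
  show ?case by (rule exI[of _ "\<lambda>x v. 0"]) (auto intro: flat_poly.const)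
next
  case (base k v c)
  \<comment> \<open>The difference is written with the constant factor \<open>- real k\<close>
    because the rules of \<open>flat_poly\<close> offer sums and products only.\<close>
  define f' where "f' x w = (flat_exp (k + 2) (x \<bullet> v + c) + (- real k) * flat_exp (k + 1) (x \<bullet> v + c)) * (w \<bullet> v)"
    for x w
  have "((\<lambda>x. flat_exp k (x \<bullet> v + c)) has_derivative f' x) (at x)" for x
  proof -
    have 1: "((\<lambda>x. x \<bullet> v + c) has_derivative (\<lambda>w. w \<bullet> v)) (at x)"
      by (auto intro!: derivative_eq_intros)
    show ?thesis
      using DERIV_compose_FDERIV[OF has_real_derivative_flat_exp 1, of k]
      by (simp add: f'_def[abs_def] mult_ac)
  qed
  moreover have "flat_poly (\<lambda>x. f' x w)" for w
    unfolding f'_def by (intro flat_poly.intros)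
  ultimately show ?case by blast
next
  case (add f g)
  then obtain f' g' where "\<And>x. (f has_derivative f' x) (at x)" "\<And>v. flat_poly (\<lambda>x. f' x v)"
    "\<And>x. (g has_derivative g' x) (at x)" "\<And>v. flat_poly (\<lambda>x. g' x v)" by blast
  then show ?case
    by (intro exI[of _ "\<lambda>x v. f' x v + g' x v"] conjI allI has_derivative_add flat_poly.add)
next
  case (mult f g)
  then obtain f' g' where "\<And>x. (f has_derivative f' x) (at x)" "\<And>v. flat_poly (\<lambda>x. f' x v)"
    "\<And>x. (g has_derivative g' x) (at x)" "\<And>v. flat_poly (\<lambda>x. g' x v)" by blast
  then show ?case using mult.hyps
    by (intro exI[of _ "\<lambda>x v. f x * g' x v + f' x v * g x"] conjI allI has_derivative_mult
        flat_poly.add flat_poly.mult)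
qed

lemma smooth_flat_poly:
  assumes "flat_poly f"
  shows "smooth f"
  using assms
proof (coinduction arbitrary: f)
  case smooth
  from flat_poly_derivative[OF smooth] obtain f' where
    f': "\<And>x. (f has_derivative f' x) (at x)" "\<And>v. flat_poly (\<lambda>x. f' x v)" by blast
  have "frechet_derivative f (at x) = f' x" for x
    using f'(1) by (metis frechet_derivative_at)
  then show ?case using f' by (auto simp: differentiable_def)
qed

lemma flat_poly_prod:
  "finite S \<Longrightarrow> (\<And>i. i \<in> S \<Longrightarrow> flat_poly (f i)) \<Longrightarrow> flat_poly (\<lambda>x. \<Prod>i\<in>S. f i x)"
  by (induction S rule: finite_induct) (auto intro: flat_poly.intros)

text \<open>In each coordinate the factors are \<open>flat_exp 0\<close> at n (x_i - a_i) - 1 and at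
  n (b_i - x_i) - 1, written in the shape that \<open>flat_poly.base\<close> demands. The shift by 1
  keeps the support at distance 1/n from the faces.\<close>

definition box_bump :: "nat \<Rightarrow> 'a::euclidean_space \<Rightarrow> 'a \<Rightarrow> 'a \<Rightarrow> real" where
  "box_bump n a b x = (\<Prod>i\<in>Basis. flat_exp 0 (x \<bullet> (real n *\<^sub>R i) + (- real n * (a \<bullet> i) - 1))
      * flat_exp 0 (x \<bullet> (- real n *\<^sub>R i) + (real n * (b \<bullet> i) - 1)))"

lemma smooth_box_bump: "smooth (box_bump n a b)"
  unfolding box_bump_def[abs_def]
  by (intro smooth_flat_poly flat_poly_prod flat_poly.mult flat_poly.base) auto

lemma box_bump_nonzero:
  assumes "box_bump n a b x \<noteq> 0" "i \<in> Basis"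
  shows "1 < real n * (x \<bullet> i - a \<bullet> i)" "1 < real n * (b \<bullet> i - x \<bullet> i)"
  using assms by (auto simp: box_bump_def flat_exp_def algebra_simps split: if_splits)

lemma smooth_cs_box_bump:
  assumes "box a b \<subseteq> \<Omega>" "0 < n"
  shows "smooth_cs \<Omega> (box_bump n a b)"
  unfolding smooth_cs_def
proof (intro conjI exI allI impI)
  let ?K = "cbox (a + (1 / real n) *\<^sub>R One) (b - (1 / real n) *\<^sub>R One)"
  show "compact ?K" by simp
  have "?K \<subseteq> box a b"
  proof
    fix x assume x: "x \<in> ?K"
    show "x \<in> box a b"
      unfolding mem_box
    proof
      fix i :: 'a assume i: "i \<in> Basis"
      have "a \<bullet> i + 1 / real n \<le> x \<bullet> i" "x \<bullet> i \<le> b \<bullet> i - 1 / real n"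
        using x i by (auto simp: mem_box inner_add_left inner_diff_left)
      moreover have "0 < 1 / real n" using assms by simp
      ultimately show "a \<bullet> i < x \<bullet> i \<and> x \<bullet> i < b \<bullet> i" by linarith
    qed
  qed
  then show "?K \<subseteq> \<Omega>" using assms by blast
  show "box_bump n a b x = 0" if "x \<notin> ?K" for x
  proof (rule ccontr)
    assume nz: "box_bump n a b x \<noteq> 0"
    have "a \<bullet> i + 1 / real n \<le> x \<bullet> i" "x \<bullet> i \<le> b \<bullet> i - 1 / real n" if "i \<in> Basis" for i
      using box_bump_nonzero[OF nz that] assms by (auto simp: field_simps)
    then have "x \<in> ?K" by (auto simp: mem_box inner_add_left inner_diff_left)
    with that show False by simp
  qed
qed (rule smooth_box_bump)

lemma box_bump_bounds: "0 \<le> box_bump n a b x" "box_bump n a b x \<le> 1"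
  unfolding box_bump_def
  by (auto intro!: prod_nonneg prod_le_1 mult_le_one flat_exp_bounds mult_nonneg_nonneg)

lemma flat_exp_tendsto_1:
  assumes "0 < c"
  shows "(\<lambda>n. flat_exp 0 (real n * c - 1)) \<longlonglongrightarrow> 1"
proof -
  have 1: "filterlim (\<lambda>n. real n * c - 1) at_top sequentially"
    using assms by real_asymp
  have "(\<lambda>n. exp (- (1 / (real n * c - 1)))) \<longlonglongrightarrow> 1"
    using assms by real_asymp
  then show ?thesis
  proof (rule Lim_transform_eventually)
    show "\<forall>\<^sub>F n in sequentially. exp (- (1 / (real n * c - 1))) = flat_exp 0 (real n * c - 1)"
      using filterlim_at_top_dense[THEN iffD1, OF 1, rule_format, of 0]
      by eventually_elim (simp add: flat_exp_def)
  qed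
qed

text \<open>The limit holds at every point: the box is open, and all bumps vanish on its faces and
  outside.\<close>

lemma box_bump_tendsto: "(\<lambda>n. box_bump n a b x) \<longlonglongrightarrow> indicator (box a b) x"
proof (cases "x \<in> box a b")
  case True
  have "(\<lambda>n. \<Prod>i\<in>Basis. flat_exp 0 (real n * (x \<bullet> i - a \<bullet> i) - 1) * flat_exp 0 (real n * (b \<bullet> i - x \<bullet> i) - 1))
      \<longlonglongrightarrow> (\<Prod>i\<in>(Basis::'a set). 1 * 1)"
    using True by (intro tendsto_prod tendsto_mult flat_exp_tendsto_1) (auto simp: mem_box)
  then show ?thesis
    using True by (simp add: box_bump_def[abs_def] algebra_simps)
next
  case False
  then obtain i where i: "i \<in> Basis" "x \<bullet> i \<le> a \<bullet> i \<or> b \<bullet> i \<le> x \<bullet> i"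
    by (force simp: mem_box)
  have "box_bump n a b x = 0" for n
  proof (rule ccontr)
    assume "box_bump n a b x \<noteq> 0"
    from box_bump_nonzero[OF this i(1)] i(2) show False
      using mult_nonneg_nonpos[of "real n" "x \<bullet> i - a \<bullet> i"] mult_nonneg_nonpos[of "real n" "b \<bullet> i - x \<bullet> i"]
      by auto
  qed
  then show ?thesis using False by simp
qed

section \<open>From vanishing integrals to vanishing functions\<close>

lemma smooth_differentiable: "smooth \<phi> \<Longrightarrow> \<phi> differentiable (at x)"
  by (erule smooth.cases) simp

lemma smooth_continuous_on: "smooth \<phi> \<Longrightarrow> continuous_on S \<phi>"
  using smooth_differentiable differentiable_imp_continuous_within
  by (metis continuous_at_imp_continuous_on)

text \<open>A Dynkin argument: open boxes are stable under intersection and generate the Borel sets,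
  and the Borel sets over which f integrates to zero are closed under complements and countable
  disjoint unions.\<close>

lemma integral_box_zero_imp_AE_zero:
  fixes f :: "'a::euclidean_space \<Rightarrow> 'b::{banach, second_countable_topology}"
  assumes f: "integrable lborel f"
    and zero: "\<And>a b. (LINT x:box a b|lborel. f x) = 0"
  shows "AE x in lborel. f x = 0"
proof (rule sigma_finite_measure.density_zero[OF sigma_finite_lborel f])
  have int: "set_integrable lborel A f" if "A \<in> sets borel" for A
    using integrable_mult_indicator[OF _ f, of A] that by (simp add: set_integrable_def)
  \<comment> \<open>Complements need the integral over the whole space, which is exhausted by
    growing boxes.\<close>
  have UNIV: "(LINT x|lborel. f x) = 0"
  proof -
    let ?A = "\<lambda>n::nat. box (- (real n *\<^sub>R One)) (real n *\<^sub>R One) :: 'a set"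
    have "(\<lambda>n. LINT x:?A n|lborel. f x) \<longlonglongrightarrow> (LINT x|lborel. f x)"
      unfolding set_lebesgue_integral_def
    proof (rule integral_dominated_convergence)
      show "AE x in lborel. (\<lambda>n. indicator (?A n) x *\<^sub>R f x) \<longlonglongrightarrow> f x"
      proof (rule AE_I2)
        fix x :: 'a
        have "x \<in> (\<Union>n. ?A n)" by (simp only: UN_box_eq_UNIV UNIV_I)
        then obtain m where m: "x \<in> ?A m" by blast
        have "x \<in> ?A n" if "m \<le> n" for n
        proof -
          have "?A m \<subseteq> ?A n" using that by (intro subset_box_imp) auto
          then show ?thesis using m by blast
        qed
        then have "\<forall>\<^sub>F n in sequentially. indicator (?A n) x *\<^sub>R f x = f x"
          by (intro eventually_sequentiallyI[of m]) (simp add: indicator_def)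
        then show "(\<lambda>n. indicator (?A n) x *\<^sub>R f x) \<longlonglongrightarrow> f x"
          by (rule tendsto_eventually)
      qed
      show "integrable lborel (\<lambda>x. norm (f x))" using f by simp
    qed (use f in \<open>auto simp: indicator_def\<close>)
    then show ?thesis using zero LIMSEQ_unique[OF _ tendsto_const[of 0]] by simp
  qed
  fix A assume "A \<in> sets (lborel :: 'a measure)"
  then have A: "A \<in> sigma_sets UNIV (range (\<lambda>(a, b). box a b))"
    by (simp add: borel_eq_box)
  have stable: "Int_stable (range (\<lambda>(a, b). box a b :: 'a set))"
    by (auto simp: Int_stable_def box_Int_box)
  have "range (\<lambda>(a, b). box a b :: 'a set) \<subseteq> Pow UNIV" by simp
  from stable this A show "set_lebesgue_integral lborel A f = 0"
  proof (induction rule: sigma_sets_induct_disjoint)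
    case (compl A)
    then have A: "A \<in> sets borel" by (simp add: borel_eq_box)
    have "(LINT x|lborel. f x) = (LINT x:A \<union> (UNIV - A)|lborel. f x)"
      by (simp add: set_lebesgue_integral_def)
    also have "\<dots> = (LINT x:A|lborel. f x) + (LINT x:UNIV - A|lborel. f x)"
      using A by (intro set_integral_Un int) auto
    finally show ?case using UNIV compl by simp
  next
    case (union A)
    then have A: "range A \<subseteq> sets borel" by (simp add: borel_eq_box)
    then have "(LINT x:(\<Union>i. A i)|lborel. f x) = (\<Sum>i. (LINT x:(A i)|lborel. f x))"
      using union by (intro lebesgue_integral_countable_add int) (auto simp: disjoint_family_on_def)
    then show ?case using union by simp
  next
    case (basic A)
    then show ?case using zero by auto
  qed (simp add: set_lebesgue_integral_def)
qed

text \<open>Bumps approximate the indicator of any box in \<Omega>, so g integrates to zero over all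
  of these and vanishes a.e. in each; countably many of them cover \<Omega>.\<close>

lemma AE_zero_if_test_integrals_zero:
  fixes g :: "'a::euclidean_space \<Rightarrow> 'b::{banach, second_countable_topology}"
  assumes \<Omega>: "open \<Omega>" and [measurable]: "g \<in> borel_measurable borel"
    and int: "\<And>a b. set_integrable lborel (box a b) g"
    and test: "\<And>\<theta>::'a \<Rightarrow> real. smooth_cs \<Omega> \<theta> \<Longrightarrow> (LINT x|lborel. \<theta> x *\<^sub>R g x) = 0"
  shows "AE x in lborel. x \<in> \<Omega> \<longrightarrow> g x = 0"
proof -
  have box: "(LINT x:box a b|lborel. g x) = 0" if "box a b \<subseteq> \<Omega>" for a b
  proof -
    \<comment> \<open>\<open>Suc n\<close> because a bump is known to be a test function for
      positive index only.\<close>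
    have "(\<lambda>n. LINT x|lborel. box_bump (Suc n) a b x *\<^sub>R g x) \<longlonglongrightarrow> (LINT x:box a b|lborel. g x)"
      unfolding set_lebesgue_integral_def
    proof (rule integral_dominated_convergence)
      show "integrable lborel (\<lambda>x. norm (indicator (box a b) x *\<^sub>R g x))"
        using int[of a b] by (intro integrable_norm) (simp add: set_integrable_def)
      have [measurable]: "box_bump n a b \<in> borel_measurable borel" for n
        by (intro borel_measurable_continuous_onI smooth_continuous_on smooth_box_bump)
      show "(\<lambda>x. box_bump (Suc n) a b x *\<^sub>R g x) \<in> borel_measurable lborel" for n
        by simp
      show "AE x in lborel. (\<lambda>n. box_bump (Suc n) a b x *\<^sub>R g x) \<longlonglongrightarrow> indicator (box a b) x *\<^sub>R g x"
        by (intro AE_I2 tendsto_scaleR tendsto_const LIMSEQ_Suc[OF box_bump_tendsto])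
      show "AE x in lborel. norm (box_bump (Suc n) a b x *\<^sub>R g x) \<le> norm (indicator (box a b) x *\<^sub>R g x)" for n
      proof (rule AE_I2)
        fix x
        have "x \<in> box a b" if "box_bump (Suc n) a b x \<noteq> 0"
          unfolding mem_box
        proof
          fix i :: 'a assume "i \<in> Basis"
          from box_bump_nonzero[OF that this]
          have "0 < real (Suc n) * (x \<bullet> i - a \<bullet> i)" "0 < real (Suc n) * (b \<bullet> i - x \<bullet> i)" by linarith+
          then show "a \<bullet> i < x \<bullet> i \<and> x \<bullet> i < b \<bullet> i" by (simp add: zero_less_mult_iff)
        qed
        then show "norm (box_bump (Suc n) a b x *\<^sub>R g x) \<le> norm (indicator (box a b) x *\<^sub>R g x)"
          using box_bump_bounds[of "Suc n" a b x]
          by (cases "x \<in> box a b"; cases "box_bump (Suc n) a b x = 0")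
            (auto intro: mult_left_le_one_le)
      qed
    qed simp
    then show ?thesis
      using test[OF smooth_cs_box_bump[OF that]] LIMSEQ_unique[OF _ tendsto_const[of 0]] by simp
  qed
  have AE_box: "AE x in lborel. x \<in> box a b \<longrightarrow> g x = 0" if ab: "box a b \<subseteq> \<Omega>" for a b
  proof -
    \<comment> \<open>Cutting g off to the box makes it globally integrable, and two boxes meet in a
      box, so only boxes inside \<Omega> have to be tested.\<close>
    have "AE x in lborel. indicator (box a b) x *\<^sub>R g x = 0"
    proof (rule integral_box_zero_imp_AE_zero)
      show "integrable lborel (\<lambda>x. indicator (box a b) x *\<^sub>R g x)"
        using int[of a b] by (simp add: set_integrable_def)
      fix c d
      obtain p q where pq: "box c d \<inter> box a b = box p q" by (simp add: box_Int_box)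
      have "(LINT x:box c d|lborel. indicator (box a b) x *\<^sub>R g x) = (LINT x:box p q|lborel. g x)"
        unfolding set_lebesgue_integral_def pq[symmetric]
        by (simp add: indicator_inter_arith)
      also have "\<dots> = 0" using ab pq by (intro box) blast
      finally show "(LINT x:box c d|lborel. indicator (box a b) x *\<^sub>R g x) = 0" .
    qed
    then show ?thesis by eventually_elim (auto simp: indicator_def)
  qed
  obtain \<D> where \<D>: "countable \<D>" "\<D> \<subseteq> Pow \<Omega>" "\<And>X. X \<in> \<D> \<Longrightarrow> \<exists>a b. X = box a b" "\<Union>\<D> = \<Omega>"
    using open_countable_Union_open_box[OF \<Omega>] by metis
  have "AE x in lborel. \<forall>X\<in>\<D>. x \<in> X \<longrightarrow> g x = 0"
  proof (subst AE_ball_countable[OF \<D>(1)], intro ballI)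
    fix X assume "X \<in> \<D>"
    with \<D>(2) \<D>(3)[of X] obtain a b where "X = box a b" "box a b \<subseteq> \<Omega>" by blast
    then show "AE x in lborel. x \<in> X \<longrightarrow> g x = 0" using AE_box by simp
  qed
  then show ?thesis using \<D>(4) by auto
qed

section \<open>Continuously differentiable fields in the plane\<close>

text \<open>The regularity shared by trigonometric polynomials and compactly supported smooth
  fields, so that one calculus serves both flow settings.\<close>

definition C1_field :: "(vec2 \<Rightarrow> 'b::real_normed_vector) \<Rightarrow> bool" where
  "C1_field \<phi> \<longleftrightarrow> (\<forall>x. \<phi> differentiable (at x)) \<and> (\<forall>j. continuous_on UNIV (pderiv_at j \<phi>))"

lemma C1_field_has_derivative:
  "C1_field \<phi> \<Longrightarrow> (\<phi> has_derivative frechet_derivative \<phi> (at x)) (at x)"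
  by (simp add: C1_field_def frechet_derivative_works)

lemma C1_field_continuous: "C1_field \<phi> \<Longrightarrow> continuous_on S \<phi>"
  unfolding C1_field_def
  by (metis continuous_at_imp_continuous_on differentiable_imp_continuous_within)

lemma C1_field_pderiv_continuous: "C1_field \<phi> \<Longrightarrow> continuous_on S (pderiv_at j \<phi>)"
  unfolding C1_field_def by (meson continuous_on_subset subset_UNIV)

lemma pderiv_at_eqI: "(\<phi> has_derivative \<phi>') (at x) \<Longrightarrow> pderiv_at j \<phi> x = \<phi>' (axis j 1)"
  by (simp add: pderiv_at_def frechet_derivative_at[symmetric])

lemma C1_fieldI:
  assumes "\<And>x. (\<phi> has_derivative \<phi>' x) (at x)" "\<And>j. continuous_on UNIV (\<lambda>x. \<phi>' x (axis j 1))"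
  shows "C1_field \<phi>"
proof -
  have "pderiv_at j \<phi> = (\<lambda>x. \<phi>' x (axis j 1))" for j
    using pderiv_at_eqI[OF assms(1)] by blast
  then show ?thesis using assms by (auto simp: C1_field_def differentiable_def)
qed

lemma frechet_derivative_pderiv:
  assumes "\<phi> differentiable (at x)"
  shows "frechet_derivative \<phi> (at x) v = (\<Sum>j\<in>UNIV. v $ j *\<^sub>R pderiv_at j \<phi> x)"
proof -
  have lin: "linear (frechet_derivative \<phi> (at x))"
    using assms by (rule linear_frechet_derivative)
  have "v = (\<Sum>j\<in>UNIV. v $ j *\<^sub>R axis j 1)"
    using basis_expansion[of v] by (simp add: scalar_mult_eq_scaleR)
  then have "frechet_derivative \<phi> (at x) v = frechet_derivative \<phi> (at x) (\<Sum>j\<in>UNIV. v $ j *\<^sub>R axis j 1)"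
    by simp
  also have "\<dots> = (\<Sum>j\<in>UNIV. v $ j *\<^sub>R pderiv_at j \<phi> x)"
    by (simp add: linear_sum[OF lin] linear_scale[OF lin] pderiv_at_def)
  finally show ?thesis .
qed

text \<open>One product rule for inner products of fields and for products of reals.\<close>

lemma C1_field_bilinear:
  assumes pr: "bounded_bilinear pr" and f: "C1_field f" and g: "C1_field g"
  shows "C1_field (\<lambda>x. pr (f x) (g x))"
    and "pderiv_at j (\<lambda>x. pr (f x) (g x)) x = pr (f x) (pderiv_at j g x) + pr (pderiv_at j f x) (g x)"
proof -
  have D: "((\<lambda>x. pr (f x) (g x)) has_derivative
      (\<lambda>h. pr (f x) (frechet_derivative g (at x) h) + pr (frechet_derivative f (at x) h) (g x))) (at x)" for x
    by (intro bounded_bilinear.FDERIV[OF pr] C1_field_has_derivative f g)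
  show "pderiv_at j (\<lambda>x. pr (f x) (g x)) x = pr (f x) (pderiv_at j g x) + pr (pderiv_at j f x) (g x)"
    by (simp add: pderiv_at_eqI[OF D]) (simp add: pderiv_at_def)
  show "C1_field (\<lambda>x. pr (f x) (g x))"
  proof (rule C1_fieldI[OF D])
    fix j
    have "continuous_on UNIV (\<lambda>x. frechet_derivative f (at x) (axis j 1))"
      "continuous_on UNIV (\<lambda>x. frechet_derivative g (at x) (axis j 1))"
      using f g by (simp_all add: C1_field_def pderiv_at_def[abs_def])
    then show "continuous_on UNIV (\<lambda>x. pr (f x) (frechet_derivative g (at x) (axis j 1))
        + pr (frechet_derivative f (at x) (axis j 1)) (g x))"
      using f g
      by (intro continuous_on_add bounded_bilinear.continuous_on[OF pr]) (auto intro: C1_field_continuous)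
  qed
qed

lemmas C1_field_inner = C1_field_bilinear[OF bounded_bilinear_inner]
lemmas C1_field_mult = C1_field_bilinear[OF bounded_bilinear_mult[where 'a = real]]

lemma C1_field_linear:
  assumes T: "bounded_linear T" and f: "C1_field f"
  shows "C1_field (\<lambda>x. T (f x))" and "pderiv_at j (\<lambda>x. T (f x)) x = T (pderiv_at j f x)"
proof -
  have D: "((\<lambda>x. T (f x)) has_derivative (\<lambda>h. T (frechet_derivative f (at x) h))) (at x)" for x
    by (intro bounded_linear.has_derivative[OF T] C1_field_has_derivative f)
  show "pderiv_at j (\<lambda>x. T (f x)) x = T (pderiv_at j f x)"
    by (simp add: pderiv_at_eqI[OF D]) (simp add: pderiv_at_def)
  show "C1_field (\<lambda>x. T (f x))"
    using f
    by (intro C1_fieldI[OF D] bounded_linear.continuous_on[OF T]) (auto simp: C1_field_def pderiv_at_def[abs_def])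
qed

lemmas C1_field_nth = C1_field_linear[OF bounded_linear_vec_nth]

lemma C1_field_comb:
  assumes f: "C1_field f" and g: "C1_field g"
  shows "C1_field (\<lambda>x. a *\<^sub>R f x + b *\<^sub>R g x)"
    and "pderiv_at j (\<lambda>x. a *\<^sub>R f x + b *\<^sub>R g x) x = a *\<^sub>R pderiv_at j f x + b *\<^sub>R pderiv_at j g x"
proof -
  have D: "((\<lambda>x. a *\<^sub>R f x + b *\<^sub>R g x) has_derivative
      (\<lambda>h. a *\<^sub>R frechet_derivative f (at x) h + b *\<^sub>R frechet_derivative g (at x) h)) (at x)" for x
    using f g by (intro derivative_intros C1_field_has_derivative)
  show "pderiv_at j (\<lambda>x. a *\<^sub>R f x + b *\<^sub>R g x) x = a *\<^sub>R pderiv_at j f x + b *\<^sub>R pderiv_at j g x"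
    by (simp add: pderiv_at_eqI[OF D]) (simp add: pderiv_at_def)
  show "C1_field (\<lambda>x. a *\<^sub>R f x + b *\<^sub>R g x)"
    using f g
    by (intro C1_fieldI[OF D] continuous_intros) (auto simp: C1_field_def pderiv_at_def[abs_def])
qed

lemma C1_field_smooth: "smooth \<phi> \<Longrightarrow> C1_field \<phi>"
  unfolding C1_field_def pderiv_at_def[abs_def]
  by (auto elim!: smooth.cases intro!: smooth_continuous_on)

section \<open>Linear operations on smooth and compactly supported functions\<close>

lemma smooth_comb:
  assumes "smooth f" "smooth g"
  shows "smooth (\<lambda>x. a *\<^sub>R f x + b *\<^sub>R g x)"
proof -
  define h where "h = (\<lambda>x. a *\<^sub>R f x + b *\<^sub>R g x)"
  \<comment> \<open>The coinductive invariant: being a combination of two smooth functions with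
    these coefficients is inherited by directional derivatives.\<close>
  have "\<exists>f g. smooth f \<and> smooth g \<and> h = (\<lambda>x. a *\<^sub>R f x + b *\<^sub>R g x)"
    using assms h_def by blast
  then have "smooth h"
  proof (coinduction arbitrary: h)
    case (smooth h)
    then obtain f g where fg: "Defs.smooth f" "Defs.smooth g" and h: "h = (\<lambda>x. a *\<^sub>R f x + b *\<^sub>R g x)"
      by blast
    have D: "(h has_derivative (\<lambda>v. a *\<^sub>R frechet_derivative f (at x) v + b *\<^sub>R frechet_derivative g (at x) v)) (at x)" for x
      unfolding h using fg
      by (intro derivative_intros) (auto simp: frechet_derivative_works[symmetric] smooth_differentiable)
    have "frechet_derivative h (at x) v = a *\<^sub>R frechet_derivative f (at x) v + b *\<^sub>R frechet_derivative g (at x) v" for x v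
      by (simp add: frechet_derivative_at[OF D, symmetric])
    moreover have "Defs.smooth (\<lambda>x. frechet_derivative f (at x) v)" "Defs.smooth (\<lambda>x. frechet_derivative g (at x) v)" for v
      using fg by (auto elim: smooth.cases)
    moreover have "h differentiable (at x)" for x
      using D by (auto simp: differentiable_def)
    ultimately show ?case by fastforce
  qed
  then show ?thesis by (simp add: h_def)
qed

lemma smooth_linear_comp:
  assumes "smooth f" "bounded_linear T"
  shows "smooth (\<lambda>x. T (f x))"
proof -
  define h where "h = (\<lambda>x. T (f x))"
  have "\<exists>f. smooth f \<and> h = (\<lambda>x. T (f x))"
    using assms h_def by blast
  then have "smooth h"
  proof (coinduction arbitrary: h)
    case (smooth h)
    then obtain f where f: "Defs.smooth f" and h: "h = (\<lambda>x. T (f x))"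
      by blast
    have D: "(h has_derivative (\<lambda>v. T (frechet_derivative f (at x) v))) (at x)" for x
      unfolding h using f
      by (intro bounded_linear.has_derivative[OF assms(2)])
        (auto simp: frechet_derivative_works[symmetric] smooth_differentiable)
    have "frechet_derivative h (at x) v = T (frechet_derivative f (at x) v)" for x v
      by (simp add: frechet_derivative_at[OF D, symmetric])
    moreover have "Defs.smooth (\<lambda>x. frechet_derivative f (at x) v)" for v
      using f by (auto elim: smooth.cases)
    moreover have "h differentiable (at x)" for x
      using D by (auto simp: differentiable_def)
    ultimately show ?case by fastforce
  qed
  then show ?thesis by (simp add: h_def)
qed

lemma smooth_cs_linear_comp:
  assumes "smooth_cs S f" "bounded_linear T"
  shows "smooth_cs S (\<lambda>x. T (f x))"
proof -
  have "T 0 = 0" using assms(2) by (simp add: bounded_linear.linear linear_0)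
  then show ?thesis
    using assms smooth_linear_comp[OF _ assms(2), of f] unfolding smooth_cs_def by metis
qed

lemma smooth_cs_comb:
  assumes "smooth_cs S f" "smooth_cs S g"
  shows "smooth_cs S (\<lambda>x. a *\<^sub>R f x + b *\<^sub>R g x)"
proof -
  obtain K K' where "compact K" "K \<subseteq> S" "\<And>x. x \<notin> K \<Longrightarrow> f x = 0" "compact K'" "K' \<subseteq> S" "\<And>x. x \<notin> K' \<Longrightarrow> g x = 0"
    using assms unfolding smooth_cs_def by blast
  then show ?thesis
    using assms smooth_comb[of f g a b] unfolding smooth_cs_def
    by (intro conjI exI[of _ "K \<union> K'"]) auto
qed

lemma pderiv_at_zero_outside_compact:
  assumes "compact K" "\<And>x. x \<notin> K \<Longrightarrow> \<phi> x = 0" "x \<notin> K"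
  shows "pderiv_at j \<phi> x = 0"
proof -
  have "open (- K)" using assms(1) by (simp add: compact_imp_closed open_Compl)
  then have "(\<phi> has_derivative (\<lambda>h. 0)) (at x)"
    by (rule has_derivative_transform_within_open[OF has_derivative_const]) (use assms in auto)
  then show ?thesis by (rule pderiv_at_eqI)
qed

section \<open>Integration by parts in the plane\<close>

text \<open>Arithmetic in the type \<open>2\<close> is modulo 2, so \<open>j + 1\<close> names the
  other coordinate and both directions can be treated at once.\<close>

lemma exhaust_2_shift: "i = j \<or> i = j + (1::2)"
  using exhaust_2[of i] exhaust_2[of j] by auto

lemma UNIV_2_shift: "UNIV = {j, j + (1::2)}"
  using exhaust_2_shift by auto

lemma shift_2_neq: "j + 1 \<noteq> (j::2)"
  by simp

lemma forall_2_shift: "(\<forall>i. P i) \<longleftrightarrow> P j \<and> P (j + (1::2))"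
  using exhaust_2_shift by metis

section \<open>Iterated integrals over the plane\<close>

lemma measurable_plane:
  "(\<lambda>(s, t). (\<chi> i. if i = j then s else t) :: vec2) \<in> borel_measurable (lborel \<Otimes>\<^sub>M lborel)"
proof -
  have "continuous_on UNIV (\<lambda>p::real \<times> real. if i = j then fst p else snd p)" for i
    by (cases "i = j") (auto intro!: continuous_intros)
  then have "continuous_on UNIV (\<lambda>(s, t). (\<chi> i. if i = j then s else t) :: vec2)"
    unfolding case_prod_unfold by (rule continuous_on_vec_lambda)
  then show ?thesis by (simp add: lborel_prod borel_measurable_continuous_onI)
qed

text \<open>Lebesgue measure is determined by its values on boxes, and m pulls a box back to a
  product of two intervals.\<close>

lemma lborel_vec2_eq_distr:
  fixes j :: 2
  defines "m \<equiv> \<lambda>(s, t). (\<chi> i. if i = j then s else t) :: vec2"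
  shows "(lborel :: vec2 measure) = distr (lborel \<Otimes>\<^sub>M lborel) borel m"
proof (rule lborel_eqI)
  have m: "m \<in> borel_measurable (lborel \<Otimes>\<^sub>M lborel)"
    unfolding m_def by (rule measurable_plane)
  fix l u :: vec2 assume le: "\<And>b. b \<in> Basis \<Longrightarrow> l \<bullet> b \<le> u \<bullet> b"
  define k where "k = j + 1"
  have k: "k \<noteq> j" "UNIV = {j, k}" using UNIV_2_shift by (auto simp: k_def)
  have "axis i 1 \<in> (Basis :: vec2 set)" for i by (simp add: axis_in_Basis_iff)
  then have lu: "l $ i \<le> u $ i" for i using le[of "axis i 1"] by (simp add: inner_axis)
  have "m -` box l u \<inter> space (lborel \<Otimes>\<^sub>M lborel) = box (l $ j) (u $ j) \<times> box (l $ k) (u $ k)"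
    using k by (auto simp: m_def mem_box_cart set_eq_iff space_pair_measure split: if_splits)
  then have "emeasure (distr (lborel \<Otimes>\<^sub>M lborel) borel m) (box l u)
      = emeasure (lborel \<Otimes>\<^sub>M lborel) (box (l $ j) (u $ j) \<times> box (l $ k) (u $ k))"
    using m by (simp add: emeasure_distr)
  also have "\<dots> = ennreal (u $ j - l $ j) * ennreal (u $ k - l $ k)"
    using lu by (simp add: lborel.emeasure_pair_measure_Times box_real)
  also have "\<dots> = ennreal (\<Prod>b\<in>Basis. (u - l) \<bullet> b)"
  proof -
    have "(\<Prod>b\<in>Basis. (u - l) \<bullet> b) = (\<Prod>i\<in>UNIV. (u - l) \<bullet> axis i 1)"
      unfolding Basis_vec_def by (subst prod.UNION_disjoint) (auto simp: axis_eq_axis)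
    also have "\<dots> = (u $ j - l $ j) * (u $ k - l $ k)"
      by (subst k(2)) (use k(1) in \<open>simp add: inner_axis\<close>)
    finally show ?thesis using lu by (simp add: ennreal_mult)
  qed
  finally show "emeasure (distr (lborel \<Otimes>\<^sub>M lborel) borel m) (box l u) = ennreal (\<Prod>b\<in>Basis. (u - l) \<bullet> b)" .
qed simp

text \<open>Fubini with the j-th coordinate innermost, the order in which a j-th partial derivative
  can be integrated.\<close>

lemma integral_vec2_iterated:
  fixes f :: "vec2 \<Rightarrow> real"
  assumes f: "integrable lborel f"
  shows "(LINT x|lborel. f x) = (LINT t|lborel. LINT s|lborel. f (\<chi> i. if i = j then s else t))"
proof -
  define m :: "real \<times> real \<Rightarrow> vec2" where "m = (\<lambda>(s, t). \<chi> i. if i = j then s else t)"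
  have eq: "(lborel :: vec2 measure) = distr (lborel \<Otimes>\<^sub>M lborel) borel m"
    unfolding m_def by (rule lborel_vec2_eq_distr)
  have m: "m \<in> measurable (lborel \<Otimes>\<^sub>M lborel) borel"
    unfolding m_def by (rule measurable_plane)
  have fm: "f \<in> borel_measurable borel" using f by simp
  have int: "integrable (lborel \<Otimes>\<^sub>M lborel) (\<lambda>(s, t). f (m (s, t)))"
    using f integrable_distr_eq[OF m fm] eq by (simp add: case_prod_unfold)
  have "(LINT x|lborel. f x) = (LINT p|(lborel \<Otimes>\<^sub>M lborel). f (m p))"
    by (subst eq) (rule integral_distr[OF m fm])
  also have "\<dots> = (LINT t|lborel. LINT s|lborel. f (m (s, t)))"
    using lborel_pair.integral_snd[OF int] by (simp add: case_prod_unfold)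
  finally show ?thesis by (simp add: m_def)
qed

section \<open>Integrals of partial derivatives\<close>

lemma set_integrable_continuous:
  fixes f :: "'a::euclidean_space \<Rightarrow> 'b::euclidean_space"
  assumes "continuous_on UNIV f" "bounded S" "S \<in> sets borel"
  shows "set_integrable lborel S f"
proof -
  obtain a where "S \<subseteq> cbox (- a) a" using bounded_subset_cbox_symmetric[OF assms(2)] by blast
  moreover have "set_integrable lborel (cbox (- a) a) f"
    unfolding set_integrable_def
    by (rule borel_integrable_compact) (use assms in \<open>auto intro: continuous_on_subset\<close>)
  ultimately show ?thesis using assms(3) set_integrable_subset by fastforce
qed

lemma cube_eq_box: "{x :: real^'n. \<forall>i. a < x $ i \<and> x $ i < b} = box (\<chi> i. a) (\<chi> i. b)"
  by (auto simp: mem_box_cart)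

text \<open>On each line in direction j the fundamental theorem of calculus leaves the difference of
  the values on opposite faces. The hypothesis \<open>sides\<close> covers periodic functions as
  well as functions vanishing on these faces.\<close>

lemma integral_pderiv_cube:
  fixes F :: "vec2 \<Rightarrow> real"
  assumes F: "C1_field F" and ab: "a \<le> b"
    and sides: "\<And>x. x $ j = a \<Longrightarrow> F (x + (b - a) *\<^sub>R axis j 1) = F x"
  shows "(LINT x:{x. \<forall>i. a < x $ i \<and> x $ i < b}|lborel. pderiv_at j F x) = 0"
proof -
  let ?Q = "{x :: vec2. \<forall>i. a < x $ i \<and> x $ i < b}"
  define m :: "real \<Rightarrow> real \<Rightarrow> vec2" where "m s t = (\<chi> i. if i = j then s else t)" for s t
  have m: "m s t = m 0 t + s *\<^sub>R axis j 1" for s t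
    by (simp add: m_def vec_eq_iff axis_def)
  have mQ: "m s t \<in> ?Q \<longleftrightarrow> s \<in> {a<..<b} \<and> t \<in> {a<..<b}" for s t
    using shift_2_neq[of j] by (auto simp: m_def forall_2_shift[of _ j])
  have D: "((\<lambda>s. F (m s t)) has_vector_derivative pderiv_at j F (m s t)) (at s within S)" for s t S
  proof -
    have "((\<lambda>s. m s t) has_derivative (\<lambda>h. h *\<^sub>R axis j 1)) (at s within S)"
      by (subst m) (auto intro!: derivative_eq_intros)
    from has_derivative_compose[OF this C1_field_has_derivative[OF F]]
    have "((\<lambda>s. F (m s t)) has_derivative (\<lambda>h. frechet_derivative F (at (m s t)) (h *\<^sub>R axis j 1))) (at s within S)" .
    moreover have "linear (frechet_derivative F (at (m s t)))"
      using F by (intro linear_frechet_derivative) (simp add: C1_field_def)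
    ultimately show ?thesis
      unfolding has_vector_derivative_def pderiv_at_def by (simp add: linear_scale)
  qed
  have cont: "continuous_on S (\<lambda>s. pderiv_at j F (m s t))" for S t
  proof -
    have "continuous_on S (\<lambda>s. m s t)" by (subst m) (intro continuous_intros)
    then show ?thesis
      using C1_field_pderiv_continuous[OF F, of UNIV j] by (auto intro: continuous_on_compose2)
  qed
  have inner: "(LINT s|lborel. indicator ?Q (m s t) * pderiv_at j F (m s t)) = 0" for t
  proof (cases "t \<in> {a<..<b}")
    case True
    then have "(LINT s|lborel. indicator ?Q (m s t) * pderiv_at j F (m s t))
        = (LINT s:{a<..<b}|lborel. pderiv_at j F (m s t))"
      unfolding set_lebesgue_integral_def
      by (intro Bochner_Integration.integral_cong) (auto simp: indicator_def mQ simp del: mem_Collect_eq)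
    also have "\<dots> = (LBINT s=a..b. pderiv_at j F (m s t))"
      using ab by (simp add: interval_lebesgue_integral_def)
    also have "\<dots> = F (m b t) - F (m a t)"
      by (rule interval_integral_FTC_finite[OF cont D])
    also have "\<dots> = 0"
      using sides[of "m a t"] m[of b t] m[of a t] by (simp add: algebra_simps m_def scaleR_diff_left)
    finally show ?thesis .
  next
    case False
    then have "indicator ?Q (m s t) = (0::real)" for s
      using mQ[of s t] by (simp add: indicator_def del: mem_Collect_eq)
    then show ?thesis by simp
  qed
  have int: "integrable lborel (\<lambda>x. indicator ?Q x * pderiv_at j F x)"
    using set_integrable_continuous[OF C1_field_pderiv_continuous[OF F], of ?Q j]
    by (simp add: set_integrable_def cube_eq_box)
  have "(LINT x:?Q|lborel. pderiv_at j F x) = (LINT t|lborel. LINT s|lborel. indicator ?Q (m s t) * pderiv_at j F (m s t))"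
    unfolding set_lebesgue_integral_def using integral_vec2_iterated[OF int, of j] by (simp add: m_def)
  then show ?thesis by (simp add: inner)
qed

lemma integral_pderiv_compact_support:
  fixes F :: "vec2 \<Rightarrow> real"
  assumes F: "C1_field F" and K: "compact K" "K \<subseteq> \<Omega>" "\<And>x. x \<notin> K \<Longrightarrow> F x = 0"
  shows "(LINT x:\<Omega>|lborel. pderiv_at j F x) = 0"
proof -
  obtain B where B: "\<And>x. x \<in> K \<Longrightarrow> norm x \<le> B" "0 < B"
    using K(1) by (metis bounded_pos compact_imp_bounded)
  \<comment> \<open>The cube exceeds the bound of K by one unit, so that its faces miss K and F
    vanishes on them.\<close>
  let ?Q = "{x :: vec2. \<forall>i. - (B + 1) < x $ i \<and> x $ i < B + 1}"
  have KB: "\<bar>x $ i\<bar> \<le> B" if "x \<in> K" for x i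
    using B(1)[OF that] component_le_norm_cart[of x i] by linarith
  have KQ: "x \<in> ?Q" if "x \<in> K" for x
  proof -
    have "- (B + 1) < x $ i \<and> x $ i < B + 1" for i
      using KB[OF that, of i] by (simp add: abs_le_iff)
    then show ?thesis by blast
  qed
  have "indicat_real \<Omega> x *\<^sub>R pderiv_at j F x = indicat_real ?Q x *\<^sub>R pderiv_at j F x" for x
  proof (cases "x \<in> K")
    case True
    then have "x \<in> \<Omega>" "x \<in> ?Q" using K(2) KQ by blast+
    then show ?thesis by (simp add: indicator_def)
  qed (use pderiv_at_zero_outside_compact[OF K(1) K(3)] in simp)
  then have "(LINT x:\<Omega>|lborel. pderiv_at j F x) = (LINT x:?Q|lborel. pderiv_at j F x)"
    unfolding set_lebesgue_integral_def by (simp only:)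
  also have "\<dots> = 0"
  proof (rule integral_pderiv_cube[OF F])
    fix x :: vec2 assume x: "x $ j = - (B + 1)"
    have "x \<notin> K" using KB[of x j] x B(2) by auto
    moreover have "x + (B + 1 - - (B + 1)) *\<^sub>R axis j 1 \<notin> K"
      using KB[of "x + (B + 1 - - (B + 1)) *\<^sub>R axis j 1" j] x B(2) by auto
    ultimately show "F (x + (B + 1 - - (B + 1)) *\<^sub>R axis j 1) = F x" using K(3) by simp
  qed (use B in auto)
  finally show ?thesis .
qed

text \<open>The condition under which boundary terms cancel in either setting. The codomain is left
  open because the condition passes from fields to the scalar products that get integrated.\<close>

fun boundary_compatible :: "setting \<Rightarrow> (vec2 \<Rightarrow> 'b::real_normed_vector) \<Rightarrow> bool" where
  "boundary_compatible (Periodic L) F \<longleftrightarrow> (\<forall>x j. F (x + L *\<^sub>R axis j 1) = F x)"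
| "boundary_compatible (No_Slip \<Omega>) F \<longleftrightarrow> (\<exists>K. compact K \<and> K \<subseteq> \<Omega> \<and> (\<forall>x. x \<notin> K \<longrightarrow> F x = 0))"

lemma integral_pderiv_flow_domain:
  fixes F :: "vec2 \<Rightarrow> real"
  assumes "admissible D" "C1_field F" "boundary_compatible D F"
  shows "(LINT x:flow_domain D|lborel. pderiv_at j F x) = 0"
proof (cases D)
  case (Periodic L)
  then show ?thesis using assms integral_pderiv_cube[of F 0 L j] by auto
next
  case (No_Slip \<Omega>)
  then show ?thesis using assms integral_pderiv_compact_support[of F] by auto
qed

lemma open_flow_domain: "admissible D \<Longrightarrow> open (flow_domain D)"
  by (cases D) (auto simp: cube_eq_box)

lemma bounded_flow_domain: "admissible D \<Longrightarrow> bounded (flow_domain D)"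
  by (cases D) (auto simp: cube_eq_box)

section \<open>Trigonometric polynomials\<close>

definition phase :: "real \<Rightarrow> int \<times> int \<Rightarrow> vec2 \<Rightarrow> real" where
  "phase L k x = 2 * pi / L * (of_int (fst k) * x $ 1 + of_int (snd k) * x $ 2)"

definition trig_sum :: "real \<Rightarrow> (int \<times> int) set \<Rightarrow> (int \<times> int \<Rightarrow> vec2) \<Rightarrow> (int \<times> int \<Rightarrow> vec2) \<Rightarrow> vec2 \<Rightarrow> vec2" where
  "trig_sum L K a b x = (\<Sum>k\<in>K. cos (phase L k x) *\<^sub>R a k + sin (phase L k x) *\<^sub>R b k)"

lemma trig_poly_iff: "trig_poly L \<phi> \<longleftrightarrow> (\<exists>K a b. finite K \<and> \<phi> = trig_sum L K a b)"
  by (simp add: trig_poly_def trig_sum_def phase_def fun_eq_iff case_prod_unfold)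

lemma has_derivative_phase: "(phase L k has_derivative phase L k) (at x)"
proof -
  have "linear (phase L k)" by (rule linearI) (simp_all add: phase_def algebra_simps)
  then show ?thesis by (simp add: linear_conv_bounded_linear bounded_linear_imp_has_derivative)
qed

text \<open>Differentiation keeps the frequencies and exchanges the roles of cosine and sine
  coefficients, so a derivative is again a trigonometric sum over K.\<close>

lemma has_derivative_trig_sum:
  "(trig_sum L K a b has_derivative
     (\<lambda>h. trig_sum L K (\<lambda>k. phase L k h *\<^sub>R b k) (\<lambda>k. - phase L k h *\<^sub>R a k) x)) (at x)"
  unfolding trig_sum_def[abs_def]
  by (rule has_derivative_sum)
    (auto intro!: derivative_eq_intros has_derivative_phase simp: algebra_simps)

lemma continuous_on_trig_sum: "continuous_on S (trig_sum L K a b)"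
  by (meson has_derivative_trig_sum has_derivative_continuous continuous_at_imp_continuous_on)

lemma C1_field_trig_poly: "trig_poly L \<phi> \<Longrightarrow> C1_field \<phi>"
  by (auto simp: trig_poly_iff intro!: C1_fieldI[OF has_derivative_trig_sum] continuous_on_trig_sum)

lemma trig_poly_pderiv: "trig_poly L \<phi> \<Longrightarrow> trig_poly L (pderiv_at j \<phi>)"
proof -
  assume "trig_poly L \<phi>"
  then obtain K a b where K: "finite K" and \<phi>: "\<phi> = trig_sum L K a b"
    by (auto simp: trig_poly_iff)
  have "pderiv_at j \<phi> = trig_sum L K (\<lambda>k. phase L k (axis j 1) *\<^sub>R b k) (\<lambda>k. - phase L k (axis j 1) *\<^sub>R a k)"
    unfolding \<phi> using pderiv_at_eqI[OF has_derivative_trig_sum] by blast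
  then show ?thesis using K unfolding trig_poly_iff by blast
qed

text \<open>Padding with zero coefficients brings two sums to a common set of frequencies before
  they are added.\<close>

lemma trig_sum_mono:
  assumes "finite K'" "K \<subseteq> K'"
  shows "trig_sum L K a b = trig_sum L K' (\<lambda>k. if k \<in> K then a k else 0) (\<lambda>k. if k \<in> K then b k else 0)"
  unfolding trig_sum_def using assms by (intro ext sum.mono_neutral_cong_left) auto

lemma trig_sum_comb:
  "c *\<^sub>R trig_sum L K a b x + d *\<^sub>R trig_sum L K a' b' x
    = trig_sum L K (\<lambda>k. c *\<^sub>R a k + d *\<^sub>R a' k) (\<lambda>k. c *\<^sub>R b k + d *\<^sub>R b' k) x"
  unfolding trig_sum_def scaleR_sum_right sum.distrib[symmetric]
  by (rule sum.cong) (simp_all add: algebra_simps)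

lemma trig_poly_comb:
  assumes "trig_poly L \<phi>" "trig_poly L \<psi>"
  shows "trig_poly L (\<lambda>x. c *\<^sub>R \<phi> x + d *\<^sub>R \<psi> x)"
proof -
  obtain K a b where K: "finite K" "\<phi> = trig_sum L K a b"
    using assms(1) unfolding trig_poly_iff by blast
  obtain K' a' b' where K': "finite K'" "\<psi> = trig_sum L K' a' b'"
    using assms(2) unfolding trig_poly_iff by blast
  have fin: "finite (K \<union> K')" using K(1) K'(1) by (rule finite_UnI)
  obtain a1 b1 where "\<phi> = trig_sum L (K \<union> K') a1 b1"
    using trig_sum_mono[OF fin Un_upper1] K(2) by blast
  moreover obtain a2 b2 where "\<psi> = trig_sum L (K \<union> K') a2 b2"
    using trig_sum_mono[OF fin Un_upper2] K'(2) by blast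
  ultimately have "(\<lambda>x. c *\<^sub>R \<phi> x + d *\<^sub>R \<psi> x) = trig_sum L (K \<union> K')
     (\<lambda>k. c *\<^sub>R a1 k + d *\<^sub>R a2 k) (\<lambda>k. c *\<^sub>R b1 k + d *\<^sub>R b2 k)"
    by (simp only: trig_sum_comb)
  then show ?thesis using fin unfolding trig_poly_iff by blast
qed

lemma trig_poly_periodic:
  assumes "trig_poly L \<phi>" "L \<noteq> 0"
  shows "\<phi> (x + L *\<^sub>R axis j 1) = \<phi> x"
proof -
  \<comment> \<open>Frequencies are integers, so a shift by one period changes the phase by a
    multiple of 2 pi.\<close>
  have "\<exists>n::int. phase L k (x + L *\<^sub>R axis j 1) = phase L k x + of_int n * (2 * pi)" for k
  proof -
    have "2 * pi / L * (m * L) = m * (2 * pi)" for m using assms(2) by simp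
    then have *: "2 * pi / L * (m * L + y) = 2 * pi / L * y + m * (2 * pi)" for m y
      by (simp only: distrib_left)
    have "phase L k (x + L *\<^sub>R axis 1 1) = phase L k x + of_int (fst k) * (2 * pi)"
      "phase L k (x + L *\<^sub>R axis 2 1) = phase L k x + of_int (snd k) * (2 * pi)"
      unfolding phase_def *[symmetric] by (simp_all add: axis_def algebra_simps)
    then show ?thesis using exhaust_2[of j] by blast
  qed
  then obtain n :: "int \<times> int \<Rightarrow> int" where
    n: "\<And>k. phase L k (x + L *\<^sub>R axis j 1) = phase L k x + of_int (n k) * (2 * pi)" by metis
  have per: "cos (phase L k (x + L *\<^sub>R axis j 1)) = cos (phase L k x)"
    "sin (phase L k (x + L *\<^sub>R axis j 1)) = sin (phase L k x)" for k
    using cos.plus_of_int[of "phase L k x" "n k"] sin.plus_of_int[of "phase L k x" "n k"]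
    by (simp_all add: n)
  obtain K a b where "\<phi> = trig_sum L K a b" using assms(1) by (auto simp: trig_poly_iff)
  then show ?thesis by (simp only: trig_sum_def per)
qed

section \<open>Weak derivatives\<close>

text \<open>What weak derivatives use of either setting: openness for the supply of test functions,
  boundedness so that continuous fields are square-integrable on \<Omega>.\<close>

locale bounded_domain =
  fixes \<Omega> :: "vec2 set"
  assumes open_domain: "open \<Omega>" and bounded_domain: "bounded \<Omega>"
begin

lemma sets_domain [measurable]: "\<Omega> \<in> sets borel"
  using open_domain by simp

lemma sq_integrable_indicator:
  assumes "continuous_on UNIV p"
  shows "sq_integrable (\<lambda>x. indicator \<Omega> x *\<^sub>R p x)"
proof -
  have [measurable]: "p \<in> borel_measurable borel" by (rule borel_measurable_continuous_onI[OF assms])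
  have "set_integrable lborel \<Omega> (\<lambda>x. (norm (p x))\<^sup>2)"
    by (intro set_integrable_continuous continuous_intros assms bounded_domain sets_domain)
  moreover have "(norm (indicator \<Omega> x *\<^sub>R p x))\<^sup>2 = indicator \<Omega> x *\<^sub>R (norm (p x))\<^sup>2" for x
    by (simp add: indicator_def)
  ultimately show ?thesis by (simp add: sq_integrable_def set_integrable_def)
qed

lemma L2_class_in_L2_on:
  assumes "continuous_on UNIV p"
  shows "L2_class \<Omega> p \<in> L2_on \<Omega>"
  using rep_abs_l2_field[OF sq_integrable_indicator[OF assms]]
  unfolding L2_on_def L2_class_def by (auto elim!: eventually_mono)

lemma L2_class_comb:
  assumes "continuous_on UNIV p" "continuous_on UNIV q"
  shows "L2_class \<Omega> (\<lambda>x. a *\<^sub>R p x + b *\<^sub>R q x) = a *\<^sub>R L2_class \<Omega> p + b *\<^sub>R L2_class \<Omega> q"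
proof -
  let ?p = "\<lambda>x. indicator \<Omega> x *\<^sub>R p x" and ?q = "\<lambda>x. indicator \<Omega> x *\<^sub>R q x"
  have pq: "sq_integrable ?p" "sq_integrable ?q" using assms by (auto intro: sq_integrable_indicator)
  have "L2_class \<Omega> (\<lambda>x. a *\<^sub>R p x + b *\<^sub>R q x) = abs_l2_field (\<lambda>x. a *\<^sub>R ?p x + b *\<^sub>R ?q x)"
    by (simp add: L2_class_def algebra_simps)
  then show ?thesis
    by (simp only: L2_class_def abs_l2_field_simps(3)[OF pq(1) pq(1)] abs_l2_field_simps(3)[OF pq(2) pq(2)]
        abs_l2_field_simps(1)[OF sq_integrable_scaleR[OF pq(1)] sq_integrable_scaleR[OF pq(2)]])
qed

lemma L2_class_sum:
  assumes "finite S" "\<And>i. i \<in> S \<Longrightarrow> continuous_on UNIV (p i)"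
  shows "L2_class \<Omega> (\<lambda>x. \<Sum>i\<in>S. p i x) = (\<Sum>i\<in>S. L2_class \<Omega> (p i))"
  using assms
proof (induction S rule: finite_induct)
  case empty
  show ?case by (simp add: L2_class_def zero_l2_field_def)
next
  case (insert i S)
  have "continuous_on UNIV (\<lambda>x. \<Sum>i\<in>S. p i x)" using insert by (auto intro: continuous_on_sum)
  then show ?case using insert L2_class_comb[of "p i" "\<lambda>x. \<Sum>i\<in>S. p i x" 1 1] by simp
qed

lemma inner_L2_class_rep:
  assumes "continuous_on UNIV p"
  shows "L2_class \<Omega> p \<bullet> \<phi> = (LINT x:\<Omega>|lborel. p x \<bullet> rep_l2_field \<phi> x)"
  using inner_abs_l2_field[OF sq_integrable_indicator[OF assms] sq_integrable_rep, of \<phi>]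
  by (simp add: L2_class_def abs_rep_l2_field set_lebesgue_integral_def)

lemma inner_L2_class:
  assumes "continuous_on UNIV p" "continuous_on UNIV q"
  shows "L2_class \<Omega> p \<bullet> L2_class \<Omega> q = (LINT x:\<Omega>|lborel. p x \<bullet> q x)"
proof -
  have "indicator \<Omega> x *\<^sub>R p x \<bullet> indicator \<Omega> x *\<^sub>R q x = indicator \<Omega> x *\<^sub>R (p x \<bullet> q x)" for x
    by (simp add: indicator_def)
  then show ?thesis
    using inner_abs_l2_field[OF sq_integrable_indicator[OF assms(1)] sq_integrable_indicator[OF assms(2)]]
    by (simp only: L2_class_def set_lebesgue_integral_def)
qed

text \<open>Turns test integrals into inner products of \<open>l2_field\<close>, where linearity and
  continuity are available.\<close>

lemma integral_test_inner:
  fixes \<theta> :: "vec2 \<Rightarrow> real"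
  assumes \<theta>: "continuous_on UNIV \<theta>" "\<And>x. x \<notin> \<Omega> \<Longrightarrow> \<theta> x = 0"
  shows "(LINT x|lborel. \<theta> x *\<^sub>R rep_l2_field \<phi> x) \<bullet> e = L2_class \<Omega> (\<lambda>x. \<theta> x *\<^sub>R e) \<bullet> \<phi>"
proof -
  have [measurable]: "\<theta> \<in> borel_measurable borel" by (rule borel_measurable_continuous_onI[OF \<theta>(1)])
  have "integrable lborel (\<lambda>x. \<theta> x *\<^sub>R rep_l2_field \<phi> x)"
  proof (rule Bochner_Integration.integrable_bound)
    have "set_integrable lborel \<Omega> (\<lambda>x. (\<theta> x)\<^sup>2)"
      by (intro set_integrable_continuous continuous_intros \<theta> bounded_domain sets_domain)
    moreover have "(\<lambda>x. indicator \<Omega> x *\<^sub>R (\<theta> x)\<^sup>2) = (\<lambda>x. (\<theta> x)\<^sup>2)"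
    proof (rule ext)
      show "indicator \<Omega> x *\<^sub>R (\<theta> x)\<^sup>2 = (\<theta> x)\<^sup>2" for x
        using \<theta>(2)[of x] by (cases "x \<in> \<Omega>") auto
    qed
    ultimately show "integrable lborel (\<lambda>x. (\<theta> x)\<^sup>2 + (norm (rep_l2_field \<phi> x))\<^sup>2)"
      using sq_integrable_rep[of \<phi>] by (simp add: sq_integrable_def set_integrable_def)
    show "AE x in lborel. norm (\<theta> x *\<^sub>R rep_l2_field \<phi> x) \<le> norm ((\<theta> x)\<^sup>2 + (norm (rep_l2_field \<phi> x))\<^sup>2)"
    proof (rule AE_I2)
      fix x
      have "0 \<le> \<bar>\<theta> x\<bar> * norm (rep_l2_field \<phi> x)" by (rule mult_nonneg_nonneg) auto
      then show "norm (\<theta> x *\<^sub>R rep_l2_field \<phi> x) \<le> norm ((\<theta> x)\<^sup>2 + (norm (rep_l2_field \<phi> x))\<^sup>2)"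
        using sum_squares_bound[of "\<bar>\<theta> x\<bar>" "norm (rep_l2_field \<phi> x)"]
        by (simp add: mult.assoc del: mult_nonneg_nonneg zero_le_mult_iff)
    qed
  qed simp
  then have "(LINT x|lborel. \<theta> x *\<^sub>R rep_l2_field \<phi> x) \<bullet> e = (LINT x|lborel. (\<theta> x *\<^sub>R rep_l2_field \<phi> x) \<bullet> e)"
    by (intro integral_inner_left[symmetric])
  also have "\<dots> = (LINT x:\<Omega>|lborel. \<theta> x *\<^sub>R e \<bullet> rep_l2_field \<phi> x)"
    unfolding set_lebesgue_integral_def using \<theta>(2)
    by (intro Bochner_Integration.integral_cong) (auto simp: indicator_def inner_commute)
  also have "\<dots> = L2_class \<Omega> (\<lambda>x. \<theta> x *\<^sub>R e) \<bullet> \<phi>"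
    by (rule inner_L2_class_rep[symmetric]) (intro continuous_intros \<theta>)
  finally show ?thesis .
qed

lemma smooth_cs_facts:
  fixes \<theta> :: "vec2 \<Rightarrow> 'b::euclidean_space"
  assumes "smooth_cs \<Omega> \<theta>"
  shows "C1_field \<theta>" "x \<notin> \<Omega> \<Longrightarrow> \<theta> x = 0" "x \<notin> \<Omega> \<Longrightarrow> pderiv_at j \<theta> x = 0"
proof -
  obtain K where K: "compact K" "K \<subseteq> \<Omega>" "\<And>x. x \<notin> K \<Longrightarrow> \<theta> x = 0"
    using assms by (auto simp: smooth_cs_def)
  show "C1_field \<theta>" using assms by (simp add: smooth_cs_def C1_field_smooth)
  show "x \<notin> \<Omega> \<Longrightarrow> \<theta> x = 0" using K by blast
  show "x \<notin> \<Omega> \<Longrightarrow> pderiv_at j \<theta> x = 0"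
    using K by (intro pderiv_at_zero_outside_compact[of K]) auto
qed

lemma vec_expansion: "(v :: vec2) = (\<Sum>i\<in>UNIV. v $ i *\<^sub>R axis i 1)"
  using basis_expansion[of v] by (simp add: scalar_mult_eq_scaleR)

text \<open>Testing with scalar functions componentwise is testing with vector fields.\<close>

lemma is_weak_deriv_iff:
  "is_weak_deriv \<Omega> j \<phi> g \<longleftrightarrow> g \<in> L2_on \<Omega> \<and>
    (\<forall>p :: vec2 \<Rightarrow> vec2. smooth_cs \<Omega> p \<longrightarrow> L2_class \<Omega> (pderiv_at j p) \<bullet> \<phi> = - (L2_class \<Omega> p \<bullet> g))"
proof -
  have scalar: "(LINT x|lborel. pderiv_at j \<theta> x *\<^sub>R rep_l2_field \<phi> x) \<bullet> e = L2_class \<Omega> (pderiv_at j (\<lambda>x. \<theta> x *\<^sub>R e)) \<bullet> \<phi>"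
    "(LINT x|lborel. \<theta> x *\<^sub>R rep_l2_field g x) \<bullet> e = L2_class \<Omega> (\<lambda>x. \<theta> x *\<^sub>R e) \<bullet> g"
    if "smooth_cs \<Omega> \<theta>" for \<theta> :: "vec2 \<Rightarrow> real" and e
  proof -
    note \<theta> = smooth_cs_facts[OF that]
    have "pderiv_at j (\<lambda>x. \<theta> x *\<^sub>R e) = (\<lambda>x. pderiv_at j \<theta> x *\<^sub>R e)"
      using C1_field_linear(2)[OF bounded_linear_scaleR_left \<theta>(1)] by blast
    then show "(LINT x|lborel. pderiv_at j \<theta> x *\<^sub>R rep_l2_field \<phi> x) \<bullet> e = L2_class \<Omega> (pderiv_at j (\<lambda>x. \<theta> x *\<^sub>R e)) \<bullet> \<phi>"
      using integral_test_inner[of "pderiv_at j \<theta>" \<phi> e] \<theta> by (simp add: C1_field_pderiv_continuous)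
    show "(LINT x|lborel. \<theta> x *\<^sub>R rep_l2_field g x) \<bullet> e = L2_class \<Omega> (\<lambda>x. \<theta> x *\<^sub>R e) \<bullet> g"
      using integral_test_inner[of \<theta> g e] \<theta> by (simp add: C1_field_continuous)
  qed
  have "L2_class \<Omega> (pderiv_at j p) \<bullet> \<phi> = - (L2_class \<Omega> p \<bullet> g)"
    if w: "is_weak_deriv \<Omega> j \<phi> g" and p: "smooth_cs \<Omega> p" for p :: "vec2 \<Rightarrow> vec2"
  proof -
    have cs: "smooth_cs \<Omega> (\<lambda>x. p x $ i)" for i
      by (rule smooth_cs_linear_comp[OF p bounded_linear_vec_nth])
    note C1 = smooth_cs_facts(1)[OF p]
    \<comment> \<open>The test field is split into scalar components, each carried by a coordinate
      vector.\<close>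
    define q where "q i = (\<lambda>x. p x $ i *\<^sub>R (axis i 1 :: vec2))" for i
    have "bounded_linear (\<lambda>v::vec2. v $ i *\<^sub>R (axis i 1 :: vec2))" for i
      by (intro bounded_linear_scaleR_const bounded_linear_vec_nth)
    note q_C1 = C1_field_linear[OF this C1, folded q_def]
    have p_eq: "p = (\<lambda>x. \<Sum>i\<in>UNIV. q i x)"
      by (rule ext) (simp only: q_def vec_expansion[symmetric])
    have dp_eq: "pderiv_at j p = (\<lambda>x. \<Sum>i\<in>UNIV. pderiv_at j (q i) x)"
      by (rule ext) (simp only: q_C1(2) vec_expansion[symmetric])
    have "L2_class \<Omega> (pderiv_at j (q i)) \<bullet> \<phi> = - (L2_class \<Omega> (q i) \<bullet> g)" for i
    proof -
      have "(LINT x|lborel. pderiv_at j (\<lambda>x. p x $ i) x *\<^sub>R rep_l2_field \<phi> x)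
          = - (LINT x|lborel. p x $ i *\<^sub>R rep_l2_field g x)"
        using w cs[of i] by (simp add: is_weak_deriv_def)
      then show ?thesis
        unfolding q_def scalar[OF cs, of i "axis i 1", symmetric] by (simp only: inner_minus_left)
    qed
    moreover have "L2_class \<Omega> (pderiv_at j p) = (\<Sum>i\<in>UNIV. L2_class \<Omega> (pderiv_at j (q i)))"
      unfolding dp_eq using q_C1(1) by (intro L2_class_sum C1_field_pderiv_continuous) auto
    moreover have "L2_class \<Omega> p = (\<Sum>i\<in>UNIV. L2_class \<Omega> (q i))"
      unfolding p_eq using q_C1(1) by (intro L2_class_sum C1_field_continuous) auto
    ultimately show ?thesis by (simp add: inner_sum_left sum_negf)
  qed
  moreover have "(LINT x|lborel. pderiv_at j \<theta> x *\<^sub>R rep_l2_field \<phi> x) = - (LINT x|lborel. \<theta> x *\<^sub>R rep_l2_field g x)"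
    if v: "\<And>p :: vec2 \<Rightarrow> vec2. smooth_cs \<Omega> p \<Longrightarrow> L2_class \<Omega> (pderiv_at j p) \<bullet> \<phi> = - (L2_class \<Omega> p \<bullet> g)"
      and \<theta>: "smooth_cs \<Omega> \<theta>" for \<theta> :: "vec2 \<Rightarrow> real"
  proof -
    have "smooth_cs \<Omega> (\<lambda>x. \<theta> x *\<^sub>R e)" for e :: vec2
      by (rule smooth_cs_linear_comp[OF \<theta> bounded_linear_scaleR_left])
    then have "(LINT x|lborel. pderiv_at j \<theta> x *\<^sub>R rep_l2_field \<phi> x) \<bullet> e
        = (- (LINT x|lborel. \<theta> x *\<^sub>R rep_l2_field g x)) \<bullet> e" for e
      using scalar[OF \<theta>, of e] v by simp
    then have "\<forall>e. (LINT x|lborel. pderiv_at j \<theta> x *\<^sub>R rep_l2_field \<phi> x) \<bullet> e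
        = (- (LINT x|lborel. \<theta> x *\<^sub>R rep_l2_field g x)) \<bullet> e" by (rule allI)
    then show ?thesis by (rule vector_eq_rdot[THEN iffD1])
  qed
  ultimately show ?thesis unfolding is_weak_deriv_def by blast
qed

section \<open>Linearity and uniqueness of weak derivatives\<close>

lemma L2_on_comb: "f \<in> L2_on \<Omega> \<Longrightarrow> g \<in> L2_on \<Omega> \<Longrightarrow> a *\<^sub>R f + b *\<^sub>R g \<in> L2_on \<Omega>"
  unfolding L2_on_def using rep_l2_field_comb[of a f b g] by auto

lemma is_weak_deriv_comb:
  "is_weak_deriv \<Omega> j \<phi> g \<Longrightarrow> is_weak_deriv \<Omega> j \<psi> k \<Longrightarrow>
    is_weak_deriv \<Omega> j (a *\<^sub>R \<phi> + b *\<^sub>R \<psi>) (a *\<^sub>R g + b *\<^sub>R k)"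
  unfolding is_weak_deriv_iff by (auto simp: inner_add_right L2_on_comb)

text \<open>The difference d is a weak derivative of zero: the test integrals force it to vanish
  inside \<Omega>, membership in \<open>L2_on\<close> does so outside.\<close>

lemma is_weak_deriv_unique:
  assumes "is_weak_deriv \<Omega> j \<phi> g" "is_weak_deriv \<Omega> j \<phi> k"
  shows "g = k"
proof -
  define d where "d = 1 *\<^sub>R g + (-1) *\<^sub>R k"
  have "is_weak_deriv \<Omega> j (1 *\<^sub>R \<phi> + (-1) *\<^sub>R \<phi>) d"
    unfolding d_def by (rule is_weak_deriv_comb[OF assms])
  then have d: "is_weak_deriv \<Omega> j 0 d" by simp
  have zero: "AE x in lborel. rep_l2_field 0 x = 0"
    using rep_l2_field_comb[of 0 0 0 0] by simp
  have "AE x in lborel. x \<in> \<Omega> \<longrightarrow> rep_l2_field d x = 0"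
  proof (rule AE_zero_if_test_integrals_zero[OF open_domain])
    show "set_integrable lborel (box a b) (rep_l2_field d)" for a b
      unfolding set_integrable_def
    proof (rule Bochner_Integration.integrable_bound)
      have "set_integrable lborel (box a b) (\<lambda>x. 1 :: real)"
        by (rule set_integrable_continuous) auto
      then show "integrable lborel (\<lambda>x. indicator (box a b) x *\<^sub>R (1::real) + (norm (rep_l2_field d x))\<^sup>2)"
        using sq_integrable_rep[of d] by (auto simp: sq_integrable_def set_integrable_def)
      show "AE x in lborel. norm (indicator (box a b) x *\<^sub>R rep_l2_field d x)
          \<le> norm (indicator (box a b) x *\<^sub>R (1::real) + (norm (rep_l2_field d x))\<^sup>2)"
      proof (rule AE_I2)
        fix x
        \<comment> \<open>Square-integrable fields are integrable on boxes because t \<le> 1 +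
          t^2.\<close>
        have "norm (rep_l2_field d x) \<le> 1 + (norm (rep_l2_field d x))\<^sup>2"
          using sum_squares_bound[of 1 "norm (rep_l2_field d x)"] norm_ge_zero[of "rep_l2_field d x"]
          unfolding power_one by linarith
        then show "norm (indicator (box a b) x *\<^sub>R rep_l2_field d x)
          \<le> norm (indicator (box a b) x *\<^sub>R (1::real) + (norm (rep_l2_field d x))\<^sup>2)"
          by (simp add: indicator_def)
      qed
    qed simp
    show "(LINT x|lborel. \<theta> x *\<^sub>R rep_l2_field d x) = 0" if "smooth_cs \<Omega> \<theta>" for \<theta> :: "vec2 \<Rightarrow> real"
    proof -
      have "(LINT x|lborel. pderiv_at j \<theta> x *\<^sub>R rep_l2_field 0 x) = 0"
        using zero by (intro integral_eq_zero_AE) auto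
      then show ?thesis using d that by (simp add: is_weak_deriv_def)
    qed
  qed simp
  moreover have "AE x in lborel. x \<notin> \<Omega> \<longrightarrow> rep_l2_field d x = 0"
    using d by (simp add: is_weak_deriv_def L2_on_def)
  ultimately have "AE x in lborel. rep_l2_field d x = 0" by auto
  then have "abs_l2_field (rep_l2_field d) = abs_l2_field (\<lambda>x. 0)"
    by (simp add: abs_l2_field_eq_iff sq_integrable_rep sq_integrable_zero)
  then have "d = 0" by (simp add: abs_rep_l2_field zero_l2_field_def)
  then show ?thesis by (simp add: d_def)
qed

lemma weak_deriv_eqI: "is_weak_deriv \<Omega> j \<phi> g \<Longrightarrow> weak_deriv \<Omega> j \<phi> = g"
  unfolding weak_deriv_def using is_weak_deriv_unique by blast

lemma H1_weak_deriv: "\<phi> \<in> H1 \<Omega> \<Longrightarrow> is_weak_deriv \<Omega> j \<phi> (weak_deriv \<Omega> j \<phi>)"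
  unfolding H1_def using weak_deriv_eqI by fastforce

lemma weak_deriv_comb:
  assumes "\<phi> \<in> H1 \<Omega>" "\<psi> \<in> H1 \<Omega>"
  shows "weak_deriv \<Omega> j (a *\<^sub>R \<phi> + b *\<^sub>R \<psi>) = a *\<^sub>R weak_deriv \<Omega> j \<phi> + b *\<^sub>R weak_deriv \<Omega> j \<psi>"
  using assms by (intro weak_deriv_eqI is_weak_deriv_comb H1_weak_deriv)

lemma H1_comb:
  assumes "\<phi> \<in> H1 \<Omega>" "\<psi> \<in> H1 \<Omega>"
  shows "a *\<^sub>R \<phi> + b *\<^sub>R \<psi> \<in> H1 \<Omega>"
  using is_weak_deriv_comb[OF H1_weak_deriv[OF assms(1)] H1_weak_deriv[OF assms(2)]] assms
  by (auto simp: H1_def L2_on_comb)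

lemma H2_comb:
  assumes "\<phi> \<in> H2 \<Omega>" "\<psi> \<in> H2 \<Omega>"
  shows "a *\<^sub>R \<phi> + b *\<^sub>R \<psi> \<in> H2 \<Omega>"
  using assms by (simp add: H2_def H1_comb weak_deriv_comb)

lemma laplacian_comb:
  assumes "\<phi> \<in> H2 \<Omega>" "\<psi> \<in> H2 \<Omega>"
  shows "laplacian \<Omega> (a *\<^sub>R \<phi> + b *\<^sub>R \<psi>) = a *\<^sub>R laplacian \<Omega> \<phi> + b *\<^sub>R laplacian \<Omega> \<psi>"
  using assms by (simp add: laplacian_def H2_def weak_deriv_comb sum.distrib scaleR_sum_right)

text \<open>The compact support of the test field inside \<Omega> removes boundary terms, however p
  behaves at the boundary.\<close>

lemma is_weak_deriv_L2_class:
  assumes p: "C1_field p"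
  shows "is_weak_deriv \<Omega> j (L2_class \<Omega> p) (L2_class \<Omega> (pderiv_at j p))"
  unfolding is_weak_deriv_iff
proof (intro conjI allI impI)
  show "L2_class \<Omega> (pderiv_at j p) \<in> L2_on \<Omega>"
    using p by (intro L2_class_in_L2_on C1_field_pderiv_continuous)
  fix q :: "vec2 \<Rightarrow> vec2" assume cs: "smooth_cs \<Omega> q"
  then obtain K where K: "compact K" "K \<subseteq> \<Omega>" "\<And>x. x \<notin> K \<Longrightarrow> q x = 0"
    by (auto simp: smooth_cs_def)
  have q: "C1_field q" using cs by (rule smooth_cs_facts)
  note cont = C1_field_continuous[OF p] C1_field_continuous[OF q]
    C1_field_pderiv_continuous[OF p] C1_field_pderiv_continuous[OF q]
  have int: "set_integrable lborel \<Omega> (\<lambda>x. q x \<bullet> pderiv_at j p x)" "set_integrable lborel \<Omega> (\<lambda>x. pderiv_at j q x \<bullet> p x)"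
    by (intro set_integrable_continuous continuous_on_inner cont bounded_domain sets_domain)+
  have "0 = (LINT x:\<Omega>|lborel. pderiv_at j (\<lambda>x. q x \<bullet> p x) x)"
    using K by (intro integral_pderiv_compact_support[symmetric, of _ K] C1_field_inner p q) auto
  also have "\<dots> = (LINT x:\<Omega>|lborel. q x \<bullet> pderiv_at j p x + pderiv_at j q x \<bullet> p x)"
    by (simp add: C1_field_inner(2)[OF q p])
  also have "\<dots> = L2_class \<Omega> q \<bullet> L2_class \<Omega> (pderiv_at j p) + L2_class \<Omega> (pderiv_at j q) \<bullet> L2_class \<Omega> p"
    using int by (simp add: set_integral_add inner_L2_class cont)
  finally show "L2_class \<Omega> (pderiv_at j q) \<bullet> L2_class \<Omega> p = - (L2_class \<Omega> q \<bullet> L2_class \<Omega> (pderiv_at j p))"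
    by simp
qed

lemma L2_class_in_H1: "C1_field p \<Longrightarrow> L2_class \<Omega> p \<in> H1 \<Omega>"
  using is_weak_deriv_L2_class L2_class_in_L2_on C1_field_continuous unfolding H1_def by blast

lemma weak_deriv_L2_class: "C1_field p \<Longrightarrow> weak_deriv \<Omega> j (L2_class \<Omega> p) = L2_class \<Omega> (pderiv_at j p)"
  by (intro weak_deriv_eqI is_weak_deriv_L2_class)

text \<open>Collecting the weak derivatives in one vector makes \<open>grad_inner\<close> and
  \<open>grad_norm\<close> the inner product and norm of a genuine inner product space, so
  Cauchy-Schwarz and continuity come for free.\<close>

definition grad :: "l2_field \<Rightarrow> l2_field ^ 2" where
  "grad \<phi> = (\<chi> j. weak_deriv \<Omega> j \<phi>)"

lemma grad_comb:
  "\<phi> \<in> H1 \<Omega> \<Longrightarrow> \<psi> \<in> H1 \<Omega> \<Longrightarrow> grad (a *\<^sub>R \<phi> + b *\<^sub>R \<psi>) = a *\<^sub>R grad \<phi> + b *\<^sub>R grad \<psi>"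
  by (simp add: grad_def vec_eq_iff weak_deriv_comb)

lemma grad_inner_eq: "grad_inner \<Omega> \<psi> \<phi> = grad \<psi> \<bullet> grad \<phi>"
  by (simp add: grad_inner_def grad_def inner_vec_def)

lemma grad_norm_eq: "grad_norm \<Omega> \<phi> = norm (grad \<phi>)"
  by (simp add: grad_norm_def grad_inner_eq norm_eq_sqrt_inner)

lemma norm_weak_deriv_le: "norm (weak_deriv \<Omega> j \<phi>) \<le> grad_norm \<Omega> \<phi>"
  using Finite_Cartesian_Product.norm_nth_le[of "grad \<phi>" j] by (simp add: grad_norm_eq grad_def)

lemma grad_diff:
  "\<phi> \<in> H1 \<Omega> \<Longrightarrow> \<psi> \<in> H1 \<Omega> \<Longrightarrow> grad (\<phi> - \<psi>) = grad \<phi> - grad \<psi>"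
  using grad_comb[of \<phi> \<psi> 1 "-1"] by simp

lemma norm_le_H1_norm: "norm \<phi> \<le> H1_norm \<Omega> \<phi>" "grad_norm \<Omega> \<phi> \<le> H1_norm \<Omega> \<phi>"
  unfolding H1_norm_def by (auto intro!: real_le_rsqrt)

lemma grad_norm_weak_deriv_le_H2_norm: "grad_norm \<Omega> (weak_deriv \<Omega> j \<phi>) \<le> H2_norm \<Omega> \<phi>"
proof -
  have "(grad_norm \<Omega> (weak_deriv \<Omega> j \<phi>))\<^sup>2 \<le> (\<Sum>j\<in>UNIV. (grad_norm \<Omega> (weak_deriv \<Omega> j \<phi>))\<^sup>2)"
    by (rule member_le_sum) auto
  then show ?thesis unfolding H2_norm_def
    by (intro real_le_rsqrt) (simp add: add_increasing)
qed

lemma H1_norm_le_H2_norm: "H1_norm \<Omega> \<phi> \<le> H2_norm \<Omega> \<phi>"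
  unfolding H2_norm_def by (auto intro!: real_le_rsqrt sum_nonneg)

end

section \<open>The function spaces of the flow\<close>

lemma smooth_fields_facts:
  assumes "admissible D" "p \<in> smooth_fields D"
  shows "C1_field p" "boundary_compatible D p" "divergence p x = 0"
proof -
  show "C1_field p"
    using assms(2) by (cases D) (auto simp: C1_field_trig_poly smooth_cs_def C1_field_smooth)
  show "boundary_compatible D p"
    using assms by (cases D) (auto simp: trig_poly_periodic smooth_cs_def)
  show "divergence p x = 0"
    using assms(2) by (cases D) auto
qed

lemma smooth_fields_comb:
  assumes D: "admissible D" and p: "p \<in> smooth_fields D" and q: "q \<in> smooth_fields D"
  shows "(\<lambda>x. a *\<^sub>R p x + b *\<^sub>R q x) \<in> smooth_fields D"
proof -
  note C1 = smooth_fields_facts(1)[OF D p] smooth_fields_facts(1)[OF D q]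
  have div: "divergence (\<lambda>x. a *\<^sub>R p x + b *\<^sub>R q x) x = 0" for x
  proof -
    have "divergence (\<lambda>x. a *\<^sub>R p x + b *\<^sub>R q x) x = a * divergence p x + b * divergence q x"
      by (simp add: divergence_def C1_field_comb(2)[OF C1] sum.distrib sum_distrib_left)
    then show ?thesis using smooth_fields_facts(3)[OF D] p q by simp
  qed
  show ?thesis
  proof (cases D)
    case (No_Slip \<Omega>)
    then show ?thesis using p q div by (auto intro: smooth_cs_comb)
  next
    case (Periodic L)
    let ?Q = "flow_domain (Periodic L)"
    have int: "set_integrable lborel ?Q p" "set_integrable lborel ?Q q"
      using open_flow_domain[OF D] bounded_flow_domain[OF D] C1 Periodic
      by (auto intro!: set_integrable_continuous C1_field_continuous)
    have "(LINT x:?Q|lborel. a *\<^sub>R p x + b *\<^sub>R q x) = a *\<^sub>R (LINT x:?Q|lborel. p x) + b *\<^sub>R (LINT x:?Q|lborel. q x)"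
      using int by (simp add: set_integral_add)
    then show ?thesis using p q div Periodic by (auto intro: trig_poly_comb)
  qed
qed

section \<open>Approximation by smooth fields and the linear structure of V\<close>

locale flow_setting =
  fixes D :: setting
  assumes admissible: "admissible D"
begin

abbreviation \<Omega> where "\<Omega> \<equiv> flow_domain D"

sublocale bounded_domain \<Omega>
  by standard (rule open_flow_domain[OF admissible] bounded_flow_domain[OF admissible])+

lemmas smooth_fields_C1 = smooth_fields_facts(1)[OF admissible]

lemma calV_comb:
  assumes "\<phi> \<in> calV D" "\<psi> \<in> calV D"
  shows "a *\<^sub>R \<phi> + b *\<^sub>R \<psi> \<in> calV D"
proof -
  obtain p q where pq: "p \<in> smooth_fields D" "q \<in> smooth_fields D"
    and eq: "\<phi> = L2_class \<Omega> p" "\<psi> = L2_class \<Omega> q"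
    using assms by (auto simp: calV_def)
  have "a *\<^sub>R \<phi> + b *\<^sub>R \<psi> = L2_class \<Omega> (\<lambda>x. a *\<^sub>R p x + b *\<^sub>R q x)"
    unfolding eq using pq by (intro L2_class_comb[symmetric] C1_field_continuous smooth_fields_C1)
  then show ?thesis using smooth_fields_comb[OF admissible pq] by (auto simp: calV_def)
qed

lemma calV_subset_H1: "calV D \<subseteq> H1 \<Omega>"
  by (auto simp: calV_def intro: L2_class_in_H1 smooth_fields_C1)

lemma H1_norm_zero: "H1_norm \<Omega> 0 = 0"
proof -
  have "weak_deriv \<Omega> j 0 = 0" for j
    by (rule weak_deriv_eqI) (use is_weak_deriv_L2_class[of "\<lambda>x. 0" j] in
        \<open>simp add: L2_class_def zero_l2_field_def[symmetric] C1_fieldI[of _ "\<lambda>x h. 0"] pderiv_at_def frechet_derivative_const\<close>)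
  then show ?thesis by (simp add: H1_norm_def grad_norm_def grad_inner_def)
qed

lemma calV_subset_V: "calV D \<subseteq> V_space D"
proof
  fix \<phi> assume "\<phi> \<in> calV D"
  then show "\<phi> \<in> V_space D"
    using calV_subset_H1 by (auto simp: V_space_def H1_norm_zero intro!: exI[of _ "\<lambda>n. \<phi>"])
qed

lemma V_subset_H1: "V_space D \<subseteq> H1 \<Omega>"
  by (auto simp: V_space_def)

text \<open>\<open>V_space\<close> is defined by real numbers tending to zero; here this becomes
  convergence of fields and gradients, to which continuity of the inner product applies.\<close>

lemma tendsto_of_H1_norm:
  assumes "\<And>n. s n \<in> H1 \<Omega>" "\<phi> \<in> H1 \<Omega>" "(\<lambda>n. H1_norm \<Omega> (s n - \<phi>)) \<longlonglongrightarrow> 0"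
  shows "s \<longlonglongrightarrow> \<phi>" "(\<lambda>n. grad (s n)) \<longlonglongrightarrow> grad \<phi>" "(\<lambda>n. grad_norm \<Omega> (s n - \<phi>)) \<longlonglongrightarrow> 0"
proof -
  have "(\<lambda>n. s n - \<phi>) \<longlonglongrightarrow> 0"
    by (rule Lim_null_comparison[OF _ assms(3)]) (simp add: norm_le_H1_norm)
  then show "s \<longlonglongrightarrow> \<phi>" by (simp add: LIM_zero_iff)
  have "(\<lambda>n. grad (s n - \<phi>)) \<longlonglongrightarrow> 0"
    by (rule Lim_null_comparison[OF _ assms(3)]) (simp add: norm_le_H1_norm(2)[unfolded grad_norm_eq])
  then show "(\<lambda>n. grad_norm \<Omega> (s n - \<phi>)) \<longlonglongrightarrow> 0"
    unfolding grad_norm_eq by (rule tendsto_norm_zero)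
  have "(\<lambda>n. grad (s n) - grad \<phi>) \<longlonglongrightarrow> 0"
    using \<open>(\<lambda>n. grad (s n - \<phi>)) \<longlonglongrightarrow> 0\<close> assms by (simp add: grad_diff)
  then show "(\<lambda>n. grad (s n)) \<longlonglongrightarrow> grad \<phi>" by (simp add: LIM_zero_iff)
qed

lemma V_spaceE:
  assumes "\<phi> \<in> V_space D"
  obtains s where "\<And>n. s n \<in> calV D" "s \<longlonglongrightarrow> \<phi>" "(\<lambda>n. grad (s n)) \<longlonglongrightarrow> grad \<phi>"
    "(\<lambda>n. V_norm D (s n - \<phi>)) \<longlonglongrightarrow> 0"
proof -
  obtain s where s: "\<And>n. s n \<in> calV D" "(\<lambda>n. H1_norm \<Omega> (s n - \<phi>)) \<longlonglongrightarrow> 0"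
    using assms by (auto simp: V_space_def)
  have s_H1: "s n \<in> H1 \<Omega>" for n using s(1) calV_subset_H1 by blast
  have "\<phi> \<in> H1 \<Omega>" using assms V_subset_H1 by blast
  from that[OF s(1) tendsto_of_H1_norm[OF s_H1 this s(2)]] show ?thesis .
qed

lemma V_subset_H: "V_space D \<subseteq> H_space D"
proof
  fix \<phi> assume "\<phi> \<in> V_space D"
  then show "\<phi> \<in> H_space D"
    unfolding H_space_def closure_sequential by (metis V_spaceE)
qed

lemma H1_norm_comb_le:
  assumes "\<phi> \<in> H1 \<Omega>" "\<psi> \<in> H1 \<Omega>"
  shows "H1_norm \<Omega> (a *\<^sub>R \<phi> + b *\<^sub>R \<psi>) \<le> \<bar>a\<bar> * H1_norm \<Omega> \<phi> + \<bar>b\<bar> * H1_norm \<Omega> \<psi>"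
proof -
  \<comment> \<open>The H1 norm is the product norm of (\<phi>, grad \<phi>), which supplies the
    triangle inequality.\<close>
  have eq: "H1_norm \<Omega> \<phi> = norm (\<phi>, grad \<phi>)" for \<phi>
    by (simp add: H1_norm_def grad_norm_eq norm_Pair)
  have "(a *\<^sub>R \<phi> + b *\<^sub>R \<psi>, grad (a *\<^sub>R \<phi> + b *\<^sub>R \<psi>)) = a *\<^sub>R (\<phi>, grad \<phi>) + b *\<^sub>R (\<psi>, grad \<psi>)"
    using assms by (simp add: grad_comb)
  then show ?thesis
    unfolding eq by (metis norm_triangle_ineq norm_scaleR)
qed

lemma V_comb:
  assumes "\<phi> \<in> V_space D" "\<psi> \<in> V_space D"
  shows "a *\<^sub>R \<phi> + b *\<^sub>R \<psi> \<in> V_space D"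
proof -
  obtain s where s: "\<And>n. s n \<in> calV D" "(\<lambda>n. H1_norm \<Omega> (s n - \<phi>)) \<longlonglongrightarrow> 0"
    using assms by (auto simp: V_space_def)
  obtain r where r: "\<And>n. r n \<in> calV D" "(\<lambda>n. H1_norm \<Omega> (r n - \<psi>)) \<longlonglongrightarrow> 0"
    using assms by (auto simp: V_space_def)
  have H1: "\<phi> \<in> H1 \<Omega>" "\<psi> \<in> H1 \<Omega>" "s n \<in> H1 \<Omega>" "r n \<in> H1 \<Omega>" for n
    using assms V_subset_H1 s r calV_subset_H1 by blast+
  have diff: "s n - \<phi> \<in> H1 \<Omega>" "r n - \<psi> \<in> H1 \<Omega>" for n
    using H1_comb[OF H1(3,1), of 1 n "-1"] H1_comb[OF H1(4,2), of 1 n "-1"] by simp_all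
  have "(\<lambda>n. H1_norm \<Omega> ((a *\<^sub>R s n + b *\<^sub>R r n) - (a *\<^sub>R \<phi> + b *\<^sub>R \<psi>))) \<longlonglongrightarrow> 0"
  proof (rule Lim_null_comparison)
    have "H1_norm \<Omega> ((a *\<^sub>R s n + b *\<^sub>R r n) - (a *\<^sub>R \<phi> + b *\<^sub>R \<psi>))
        \<le> \<bar>a\<bar> * H1_norm \<Omega> (s n - \<phi>) + \<bar>b\<bar> * H1_norm \<Omega> (r n - \<psi>)" for n
      using H1_norm_comb_le[OF diff, of a n b n] by (simp add: algebra_simps)
    moreover have "0 \<le> H1_norm \<Omega> \<xi>" for \<xi> by (simp add: H1_norm_def)
    ultimately show "\<forall>\<^sub>F n in sequentially. norm (H1_norm \<Omega> ((a *\<^sub>R s n + b *\<^sub>R r n) - (a *\<^sub>R \<phi> + b *\<^sub>R \<psi>)))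
        \<le> \<bar>a\<bar> * H1_norm \<Omega> (s n - \<phi>) + \<bar>b\<bar> * H1_norm \<Omega> (r n - \<psi>)"
      by simp
    show "(\<lambda>n. \<bar>a\<bar> * H1_norm \<Omega> (s n - \<phi>) + \<bar>b\<bar> * H1_norm \<Omega> (r n - \<psi>)) \<longlonglongrightarrow> 0"
      using tendsto_add[OF tendsto_mult_left[OF s(2), of "\<bar>a\<bar>"] tendsto_mult_left[OF r(2), of "\<bar>b\<bar>"]] by simp
  qed
  then show ?thesis
    using calV_comb[OF s(1) r(1)] H1_comb[OF H1(1,2)] unfolding V_space_def
    by (intro CollectI conjI exI[of _ "\<lambda>n. a *\<^sub>R s n + b *\<^sub>R r n"]) auto
qed

lemma V_diff: "\<phi> \<in> V_space D \<Longrightarrow> \<psi> \<in> V_space D \<Longrightarrow> \<phi> - \<psi> \<in> V_space D"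
  using V_comb[of \<phi> \<psi> 1 "-1"] by simp

section \<open>Green's formula for the Laplacian\<close>

lemma smooth_fields_parts:
  assumes p: "C1_field p" "boundary_compatible D p" and q: "C1_field q" "boundary_compatible D q"
  shows "L2_class \<Omega> (pderiv_at j p) \<bullet> L2_class \<Omega> q = - (L2_class \<Omega> p \<bullet> L2_class \<Omega> (pderiv_at j q))"
proof -
  note cont = C1_field_continuous[OF p(1)] C1_field_continuous[OF q(1)]
    C1_field_pderiv_continuous[OF p(1)] C1_field_pderiv_continuous[OF q(1)]
  have int: "set_integrable lborel \<Omega> (\<lambda>x. p x \<bullet> pderiv_at j q x)" "set_integrable lborel \<Omega> (\<lambda>x. pderiv_at j p x \<bullet> q x)"
    by (intro set_integrable_continuous continuous_on_inner cont bounded_domain sets_domain)+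
  have bc: "boundary_compatible D (\<lambda>x. p x \<bullet> q x)"
    using p(2) q(2) by (cases D) auto
  have "0 = (LINT x:\<Omega>|lborel. pderiv_at j (\<lambda>x. p x \<bullet> q x) x)"
    by (rule integral_pderiv_flow_domain[OF admissible C1_field_inner(1)[OF p(1) q(1)] bc, symmetric])
  also have "\<dots> = (LINT x:\<Omega>|lborel. p x \<bullet> pderiv_at j q x + pderiv_at j p x \<bullet> q x)"
    by (simp add: C1_field_inner(2)[OF p(1) q(1)])
  also have "\<dots> = L2_class \<Omega> p \<bullet> L2_class \<Omega> (pderiv_at j q) + L2_class \<Omega> (pderiv_at j p) \<bullet> L2_class \<Omega> q"
    using int by (simp add: set_integral_add inner_L2_class cont)
  finally show ?thesis by simp
qed

text \<open>In the no-slip case z comes from a test field, and the definition of the weak derivative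
  applies. A periodic z need not vanish near the boundary of the cell; there \<phi> is approximated
  in H2 by trigonometric polynomials, for which opposite faces cancel. This is where the closure in
  \<open>H2_bc\<close> enters.\<close>

lemma laplacian_inner_calV:
  assumes \<phi>: "\<phi> \<in> H2_bc D" and z: "z \<in> calV D"
  shows "laplacian \<Omega> \<phi> \<bullet> z = - V_inner D \<phi> z"
proof -
  obtain q where q: "q \<in> smooth_fields D" and z_eq: "z = L2_class \<Omega> q"
    using z by (auto simp: calV_def)
  note q_C1 = smooth_fields_C1[OF q]
  have "weak_deriv \<Omega> j (weak_deriv \<Omega> j \<phi>) \<bullet> z = - (weak_deriv \<Omega> j \<phi> \<bullet> weak_deriv \<Omega> j z)" for j
  proof (cases D)
    case (No_Slip S)
    then have "weak_deriv \<Omega> j \<phi> \<in> H1 \<Omega>" "smooth_cs \<Omega> q" using \<phi> q by (auto simp: H2_def)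
    then have "L2_class \<Omega> (pderiv_at j q) \<bullet> weak_deriv \<Omega> j \<phi> = - (L2_class \<Omega> q \<bullet> weak_deriv \<Omega> j (weak_deriv \<Omega> j \<phi>))"
      using H1_weak_deriv[of "weak_deriv \<Omega> j \<phi>" j] by (simp add: is_weak_deriv_iff)
    then show ?thesis
      unfolding z_eq weak_deriv_L2_class[OF q_C1] by (simp add: inner_commute)
  next
    case (Periodic L)
    obtain s where s: "\<And>n. s n \<in> L2_class \<Omega> ` {p. trig_poly L p}"
        "(\<lambda>n. H2_norm \<Omega> (s n - \<phi>)) \<longlonglongrightarrow> 0" and \<phi>2: "\<phi> \<in> H2 \<Omega>"
      using \<phi> Periodic by (auto simp: Let_def)
    obtain p where p: "\<And>n. trig_poly L (p n)" and s_eq: "\<And>n. s n = L2_class \<Omega> (p n)"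
      using s(1) by (simp add: image_iff) metis
    have tp: "C1_field r" "boundary_compatible D r" if "trig_poly L r" for r
      using that admissible Periodic by (auto simp: trig_poly_periodic C1_field_trig_poly)
    have s_H1: "s n \<in> H1 \<Omega>" "weak_deriv \<Omega> j (s n) \<in> H1 \<Omega>" for n
      unfolding s_eq using tp[OF p] tp[OF trig_poly_pderiv[OF p]]
      by (auto simp: weak_deriv_L2_class intro: L2_class_in_H1)
    have \<phi>_H1: "\<phi> \<in> H1 \<Omega>" "weak_deriv \<Omega> j \<phi> \<in> H1 \<Omega>" using \<phi>2 by (auto simp: H2_def)
    have eq_n: "weak_deriv \<Omega> j (weak_deriv \<Omega> j (s n)) \<bullet> z = - (weak_deriv \<Omega> j (s n) \<bullet> weak_deriv \<Omega> j z)" for n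
      unfolding s_eq z_eq
      using smooth_fields_parts[OF tp[OF trig_poly_pderiv[OF p]] q_C1 smooth_fields_facts(2)[OF admissible q]]
      by (simp add: weak_deriv_L2_class tp[OF p] tp[OF trig_poly_pderiv[OF p]] q_C1)
    have d: "weak_deriv \<Omega> j (s n - \<phi>) = weak_deriv \<Omega> j (s n) - weak_deriv \<Omega> j \<phi>" for n
      using weak_deriv_comb[OF s_H1(1) \<phi>_H1(1), of j 1 n "-1"] by simp
    have dd: "weak_deriv \<Omega> j (weak_deriv \<Omega> j (s n - \<phi>)) = weak_deriv \<Omega> j (weak_deriv \<Omega> j (s n)) - weak_deriv \<Omega> j (weak_deriv \<Omega> j \<phi>)" for n
      unfolding d using weak_deriv_comb[OF s_H1(2) \<phi>_H1(2), of j 1 n "-1"] by simp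
    \<comment> \<open>The H2 norm controls first and second derivatives, so both sides of
      \<open>eq_n\<close> converge.\<close>
    have "(\<lambda>n. weak_deriv \<Omega> j (s n - \<phi>)) \<longlonglongrightarrow> 0"
      by (rule Lim_null_comparison[OF _ s(2)])
        (auto intro!: always_eventually order_trans[OF norm_weak_deriv_le] order_trans[OF norm_le_H1_norm(2)] H1_norm_le_H2_norm)
    then have 1: "(\<lambda>n. weak_deriv \<Omega> j (s n)) \<longlonglongrightarrow> weak_deriv \<Omega> j \<phi>"
      by (simp add: d LIM_zero_iff)
    have "(\<lambda>n. weak_deriv \<Omega> j (weak_deriv \<Omega> j (s n - \<phi>))) \<longlonglongrightarrow> 0"
      by (rule Lim_null_comparison[OF _ s(2)])
        (auto intro!: always_eventually order_trans[OF norm_weak_deriv_le] grad_norm_weak_deriv_le_H2_norm)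
    then have 2: "(\<lambda>n. weak_deriv \<Omega> j (weak_deriv \<Omega> j (s n))) \<longlonglongrightarrow> weak_deriv \<Omega> j (weak_deriv \<Omega> j \<phi>)"
      by (simp add: dd LIM_zero_iff)
    have "(\<lambda>n. weak_deriv \<Omega> j (weak_deriv \<Omega> j (s n)) \<bullet> z) \<longlonglongrightarrow> weak_deriv \<Omega> j (weak_deriv \<Omega> j \<phi>) \<bullet> z"
      by (rule tendsto_inner[OF 2 tendsto_const])
    moreover have "(\<lambda>n. weak_deriv \<Omega> j (weak_deriv \<Omega> j (s n)) \<bullet> z) \<longlonglongrightarrow> - (weak_deriv \<Omega> j \<phi> \<bullet> weak_deriv \<Omega> j z)"
      unfolding eq_n by (rule tendsto_minus[OF tendsto_inner[OF 1 tendsto_const]])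
    ultimately show ?thesis by (rule LIMSEQ_unique)
  qed
  then show ?thesis by (simp add: laplacian_def grad_inner_def inner_sum_left sum_negf)
qed

lemma laplacian_inner_V:
  assumes \<phi>: "\<phi> \<in> H2_bc D" and z: "z \<in> V_space D"
  shows "laplacian \<Omega> \<phi> \<bullet> z = - V_inner D \<phi> z"
proof -
  obtain s where s: "\<And>n. s n \<in> calV D" "s \<longlonglongrightarrow> z" "(\<lambda>n. grad (s n)) \<longlonglongrightarrow> grad z"
    using V_spaceE[OF z] by metis
  have "(\<lambda>n. laplacian \<Omega> \<phi> \<bullet> s n) \<longlonglongrightarrow> laplacian \<Omega> \<phi> \<bullet> z"
    by (rule tendsto_inner[OF tendsto_const s(2)])
  moreover have "(\<lambda>n. laplacian \<Omega> \<phi> \<bullet> s n) \<longlonglongrightarrow> - V_inner D \<phi> z"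
    unfolding laplacian_inner_calV[OF \<phi> s(1)] grad_inner_eq
    by (rule tendsto_minus[OF tendsto_inner[OF tendsto_const s(3)]])
  ultimately show ?thesis by (rule LIMSEQ_unique)
qed

end

section \<open>Orthogonal projections\<close>

text \<open>If p and q both qualify, then q - p is orthogonal to q and to p, hence to
  itself.\<close>

lemma orth_proj_eqI:
  assumes "p \<in> S" "\<And>z. z \<in> S \<Longrightarrow> (g - p) \<bullet> z = 0"
  shows "orth_proj S g = p"
  unfolding orth_proj_def
proof (rule the_equality)
  fix q assume q: "q \<in> S \<and> (\<forall>z\<in>S. (g - q) \<bullet> z = 0)"
  have "(q - p) \<bullet> z = 0" if "z \<in> S" for z
    using q assms(2)[OF that] that by (simp add: inner_diff_left)
  then have "(q - p) \<bullet> (q - p) = 0"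
    using q assms(1) by (simp add: inner_diff_right)
  then show "q = p" by simp
qed (use assms in simp)

locale orthonormal_seq =
  fixes w :: "nat \<Rightarrow> 'a::real_inner"
  assumes orthonormal: "w i \<bullet> w j = (if i = j then 1 else 0)"
begin

lemma inner_sum_w:
  assumes "finite S"
  shows "(\<Sum>i\<in>S. c i *\<^sub>R w i) \<bullet> w j = (if j \<in> S then c j else 0)"
proof -
  have "(\<Sum>i\<in>S. c i *\<^sub>R w i) \<bullet> w j = (\<Sum>i\<in>S. if i = j then c i else 0)"
    by (auto simp: inner_sum_left orthonormal intro: sum.cong)
  then show ?thesis using assms by simp
qed

lemma norm_sum_w:
  assumes "finite S"
  shows "(norm (\<Sum>i\<in>S. c i *\<^sub>R w i))\<^sup>2 = (\<Sum>i\<in>S. (c i)\<^sup>2)"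
  unfolding power2_norm_eq_inner inner_sum_right[of _ _ S] inner_scaleR_right inner_sum_w[OF assms]
  by (intro sum.cong) (auto simp: power2_eq_square)

text \<open>Expand the nonnegative squared distance of g from its partial Fourier sum.\<close>

lemma bessel: "(\<Sum>i<n. (g \<bullet> w i)\<^sup>2) \<le> (norm g)\<^sup>2"
proof -
  let ?p = "\<Sum>i<n. (g \<bullet> w i) *\<^sub>R w i"
  have gp: "g \<bullet> ?p = (\<Sum>i<n. (g \<bullet> w i)\<^sup>2)"
    by (simp add: inner_sum_right power2_eq_square)
  have pp: "?p \<bullet> ?p = (\<Sum>i<n. (g \<bullet> w i)\<^sup>2)"
    using norm_sum_w[of "{..<n}" "\<lambda>i. g \<bullet> w i"] by (simp add: power2_norm_eq_inner)
  have "0 \<le> (g - ?p) \<bullet> (g - ?p)" by simp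
  also have "\<dots> = (norm g)\<^sup>2 - (\<Sum>i<n. (g \<bullet> w i)\<^sup>2)"
    using gp pp by (simp add: inner_diff_left inner_diff_right inner_commute power2_norm_eq_inner)
  finally show ?thesis by simp
qed

text \<open>The vectors orthogonal to g form a closed subspace.\<close>

lemma inner_eq_0_closure_span:
  assumes "\<And>i. g \<bullet> w i = 0" "z \<in> closure (span (range w))"
  shows "g \<bullet> z = 0"
proof -
  have "span (range w) \<subseteq> {z. g \<bullet> z = 0}"
    by (rule span_minimal) (use assms(1) in \<open>auto simp: subspace_def inner_add_right\<close>)
  then have "closure (span (range w)) \<subseteq> {z. g \<bullet> z = 0}"
    by (rule closure_minimal) (intro closed_Collect_eq continuous_intros)
  then show ?thesis using assms(2) by blast
qed

lemma sum_w_in_span: "(\<Sum>i<n. c i *\<^sub>R w i) \<in> span (w ` {..<n})"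
  by (intro span_sum span_scale span_base) auto

lemma in_span_w:
  assumes "x \<in> span (w ` {..<n})"
  shows "(\<Sum>i<n. (x \<bullet> w i) *\<^sub>R w i) = x"
  using assms
proof (induction rule: span_induct_alt)
  case base
  show ?case by simp
next
  case (step c y z)
  then obtain k where k: "k < n" "y = w k" by auto
  have "(\<Sum>i<n. ((c *\<^sub>R y + z) \<bullet> w i) *\<^sub>R w i) = c *\<^sub>R (\<Sum>i<n. (w k \<bullet> w i) *\<^sub>R w i) + (\<Sum>i<n. (z \<bullet> w i) *\<^sub>R w i)"
    by (simp add: k(2) inner_add_left scaleR_add_left sum.distrib scaleR_sum_right)
  also have "(\<Sum>i<n. (w k \<bullet> w i) *\<^sub>R w i) = (\<Sum>i<n. if k = i then w i else 0)"
    by (intro sum.cong) (auto simp: orthonormal)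
  finally show ?case using k step by simp
qed

end

text \<open>The squared distance of two partial Fourier sums is a segment of the series that
  Bessel's inequality bounds, so the sums are Cauchy and completeness provides the projection as
  their limit.\<close>

lemma orth_proj_exists:
  fixes w :: "nat \<Rightarrow> l2_field"
  assumes "orthonormal_seq w"
  obtains p where "p \<in> closure (span (range w))" "\<And>z. z \<in> closure (span (range w)) \<Longrightarrow> (g - p) \<bullet> z = 0"
proof -
  interpret orthonormal_seq w by fact
  define s where "s n = (\<Sum>i<n. (g \<bullet> w i) *\<^sub>R w i)" for n
  have "summable (\<lambda>i. (g \<bullet> w i)\<^sup>2)"
    using bessel[of g] by (intro bounded_imp_summable[of _ "(norm g)\<^sup>2"])
      (auto simp: lessThan_Suc_atMost[symmetric] simp del: sum.lessThan_Suc)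
  then have "Cauchy (\<lambda>n. \<Sum>i<n. (g \<bullet> w i)\<^sup>2)"
    by (simp add: summable_iff_convergent Cauchy_convergent_iff)
  have "Cauchy s"
  proof (rule CauchyI')
    fix e :: real assume "0 < e"
    then obtain M where M: "\<And>m n. M \<le> m \<Longrightarrow> M \<le> n \<Longrightarrow> norm ((\<Sum>i<m. (g \<bullet> w i)\<^sup>2) - (\<Sum>i<n. (g \<bullet> w i)\<^sup>2)) < e\<^sup>2"
      using CauchyD[OF \<open>Cauchy (\<lambda>n. \<Sum>i<n. (g \<bullet> w i)\<^sup>2)\<close>, of "e\<^sup>2"] by auto
    have "dist (s m) (s n) < e" if "M \<le> m" "m < n" for m n
    proof -
      have "{..<n} = {..<m} \<union> {m..<n}" using that by auto
      then have split: "(\<Sum>i<n. f i) - (\<Sum>i<m. f i) = (\<Sum>i=m..<n. f i)" for f :: "nat \<Rightarrow> 'b::ab_group_add"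
        using sum.union_disjoint[of "{..<m}" "{m..<n}" f] by (simp add: ivl_disj_int)
      have "(norm (s n - s m))\<^sup>2 = (\<Sum>i=m..<n. (g \<bullet> w i)\<^sup>2)"
        unfolding s_def split by (rule norm_sum_w) simp
      also have "\<dots> = (\<Sum>i<n. (g \<bullet> w i)\<^sup>2) - (\<Sum>i<m. (g \<bullet> w i)\<^sup>2)" by (simp add: split)
      also have "\<dots> < e\<^sup>2" using M[of n m] that by simp
      finally show ?thesis
        using \<open>0 < e\<close> by (simp add: dist_norm norm_minus_commute power_less_imp_less_base)
    qed
    then show "\<exists>M. \<forall>m\<ge>M. \<forall>n>m. dist (s m) (s n) < e" by blast
  qed
  then obtain p where p: "s \<longlonglongrightarrow> p" using Cauchy_convergent convergent_def by blast
  have "s n \<in> span (range w)" for n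
    unfolding s_def by (intro span_sum span_scale span_base) auto
  then have "p \<in> closure (span (range w))" using p unfolding closure_sequential by blast
  moreover have "(g - p) \<bullet> w j = 0" for j
  proof -
    have "(\<lambda>n. s n \<bullet> w j) \<longlonglongrightarrow> p \<bullet> w j" by (rule tendsto_inner[OF p tendsto_const])
    \<comment> \<open>The j-th coefficient is present from n = j + 1 on and constant
      afterwards.\<close>
    moreover have "\<forall>\<^sub>F n in sequentially. s n \<bullet> w j = g \<bullet> w j"
      by (intro eventually_sequentiallyI[of "Suc j"]) (simp add: s_def inner_sum_w)
    ultimately have "p \<bullet> w j = g \<bullet> w j"
      by (metis LIMSEQ_unique tendsto_eventually)
    then show ?thesis by (simp add: inner_diff_left)
  qed
  ultimately show ?thesis using that inner_eq_0_closure_span by blast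
qed

section \<open>The Stokes operator and the trilinear form\<close>

text \<open>Dimension count: the image of B is independent with as many elements as B. A vector of
  the span outside the span of this image would give one independent vector too many.\<close>

lemma injective_on_span_imp_surjective:
  fixes T :: "'a::real_vector \<Rightarrow> 'a"
  assumes B: "finite B" "independent B" and T: "linear T" "\<And>x. x \<in> span B \<Longrightarrow> T x \<in> span B"
    and inj: "\<And>x. x \<in> span B \<Longrightarrow> T x = 0 \<Longrightarrow> x = 0"
    and y: "y \<in> span B"
  obtains x where "x \<in> span B" "T x = y"
proof -
  interpret T: linear T by (rule T)
  have inj_on: "inj_on T (span B)"
  proof (rule inj_onI)
    fix x x' assume "x \<in> span B" "x' \<in> span B" "T x = T x'"
    then have "T (x - x') = 0" "x - x' \<in> span B" by (auto simp: T.diff span_diff)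
    then have "x - x' = 0" using inj by blast
    then show "x = x'" by simp
  qed
  then have indep: "independent (T ` B)"
    by (rule linear_independent_injective_image[OF T(1) B(2)])
  have card: "card (T ` B) = card B"
    by (rule card_image[OF inj_on_subset[OF inj_on]]) (simp add: span_superset)
  have "y \<in> span (T ` B)"
  proof (rule ccontr)
    assume y_notin: "y \<notin> span (T ` B)"
    then have indep_y: "independent (insert y (T ` B))" using indep by (rule independent_insertI)
    have "T ` B \<subseteq> span B" using T(2)[OF span_base] by (rule image_subsetI)
    then have "insert y (T ` B) \<subseteq> span B" using y by simp
    then have "card (insert y (T ` B)) \<le> card B"
      using independent_span_bound[OF B(1) indep_y] by simp
    moreover have "y \<notin> T ` B" using y_notin span_superset[of "T ` B"] by (rule contra_subsetD[rotated])
    ultimately show False using B(1) card by simp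
  qed
  then have "y \<in> T ` span B" by (simp only: linear_span_image[OF T(1)])
  then show ?thesis using that by blast
qed

lemma (in orthonormal_seq) independent_w: "independent (w ` S)"
proof (rule pairwise_orthogonal_independent)
  show "pairwise orthogonal (w ` S)"
    by (auto simp: pairwise_def orthogonal_def orthonormal)
  have "0 \<noteq> w i" for i using orthonormal[of i i] by auto
  then show "0 \<notin> w ` S" by (simp add: image_iff)
qed

section \<open>The Stokes operator on the Galerkin spaces\<close>

locale stokes_setting = flow_setting +
  fixes w :: "nat \<Rightarrow> l2_field" and lam :: "nat \<Rightarrow> real"
  assumes basis: "stokes_eigenbasis D w lam"
begin

sublocale orthonormal_seq w
  by standard (use basis in \<open>auto simp: stokes_eigenbasis_def\<close>)

lemma w_facts: "w j \<in> H2_bc D" "w j \<in> V_space D" "stokes D (w j) = lam j *\<^sub>R w j"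
  using basis by (auto simp: stokes_eigenbasis_def stokes_domain_def)

lemma H_eq: "H_space D = closure (span (range w))"
  using basis by (simp add: stokes_eigenbasis_def)

text \<open>H is the closed span of the orthonormal eigenvectors, so \<open>orth_proj_exists\<close>
  supplies the element that \<open>leray\<close> describes.\<close>

lemma leray_inner: "z \<in> H_space D \<Longrightarrow> leray D g \<bullet> z = g \<bullet> z"
proof -
  obtain p where p: "p \<in> H_space D" "\<And>z. z \<in> H_space D \<Longrightarrow> (g - p) \<bullet> z = 0"
    using orth_proj_exists[OF orthonormal_seq_axioms, of g] unfolding H_eq by metis
  have "leray D g = p" unfolding leray_def by (rule orth_proj_eqI) (use p in auto)
  then show "z \<in> H_space D \<Longrightarrow> leray D g \<bullet> z = g \<bullet> z" using p(2) by (simp add: inner_diff_left)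
qed

lemma leray_eqI: "p \<in> H_space D \<Longrightarrow> (\<And>z. z \<in> H_space D \<Longrightarrow> g \<bullet> z = p \<bullet> z) \<Longrightarrow> leray D g = p"
  unfolding leray_def by (intro orth_proj_eqI) (auto simp: inner_diff_left)

lemma galerkin_eq: "galerkin w N g = (\<Sum>j<N. (g \<bullet> w j) *\<^sub>R w j)"
  unfolding galerkin_def
proof (rule orth_proj_eqI[OF sum_w_in_span])
  fix z assume "z \<in> span (w ` {..<N})"
  then have "z = (\<Sum>j<N. (z \<bullet> w j) *\<^sub>R w j)" by (rule in_span_w[symmetric])
  moreover have "(g - (\<Sum>j<N. (g \<bullet> w j) *\<^sub>R w j)) \<bullet> (\<Sum>j<N. (z \<bullet> w j) *\<^sub>R w j) = 0"
    by (simp add: inner_sum_right inner_diff_left inner_sum_w)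
  ultimately show "(g - (\<Sum>j<N. (g \<bullet> w j) *\<^sub>R w j)) \<bullet> z = 0" by metis
qed

lemma span_w_subset_V: "span (w ` S) \<subseteq> V_space D"
proof (rule span_minimal)
  show "subspace (V_space D)"
    unfolding subspace_def
    using V_comb[of "w 0" "w 0" 0 0] V_comb[of _ _ 1 1] V_comb[of _ "w 0" _ 0] w_facts(2) by simp
qed (use w_facts in auto)

lemma span_w_subset_H: "span (w ` S) \<subseteq> H_space D"
  using span_w_subset_V V_subset_H by blast

lemma galerkin_image: "galerkin w N ` H_space D = span (w ` {..<N})"
proof
  show "galerkin w N ` H_space D \<subseteq> span (w ` {..<N})"
    by (auto simp: galerkin_eq sum_w_in_span)
  show "span (w ` {..<N}) \<subseteq> galerkin w N ` H_space D"
  proof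
    fix x assume x: "x \<in> span (w ` {..<N})"
    then have "x = galerkin w N x" by (simp add: galerkin_eq in_span_w)
    then show "x \<in> galerkin w N ` H_space D" using x span_w_subset_H by blast
  qed
qed

lemma H2_bc_subset_H2: "H2_bc D \<subseteq> H2 \<Omega>"
  by (cases D) (auto simp: Let_def)

text \<open>The linearity laws for \<open>laplacian\<close> and \<open>grad\<close> require
  membership in H2 and H1, so membership is carried through the same induction.\<close>

lemma sum_w_differentials:
  defines "x n c \<equiv> \<Sum>j<n. c j *\<^sub>R w j"
  shows "x n c \<in> H2 \<Omega> \<and> laplacian \<Omega> (x n c) = (\<Sum>j<n. c j *\<^sub>R laplacian \<Omega> (w j))
    \<and> grad (x n c) = (\<Sum>j<n. c j *\<^sub>R grad (w j))"
proof (induction n)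
  have w: "w j \<in> H2 \<Omega>" "w j \<in> H1 \<Omega>" for j
    using w_facts(1) H2_bc_subset_H2 by (auto simp: H2_def)
  {
    case 0
    show ?case
      using H2_comb[OF w(1,1), of 0 0 0 0] laplacian_comb[OF w(1,1), of 0 0 0 0] grad_comb[OF w(2,2), of 0 0 0 0]
      by (simp add: x_def)
  next
    case (Suc n)
    then have H: "x n c \<in> H2 \<Omega>" "x n c \<in> H1 \<Omega>" by (auto simp: H2_def)
    have eq: "x (Suc n) c = 1 *\<^sub>R x n c + c n *\<^sub>R w n" by (simp add: x_def)
    have "x (Suc n) c \<in> H2 \<Omega>"
      unfolding eq by (rule H2_comb[OF H(1) w(1)])
    moreover have "laplacian \<Omega> (x (Suc n) c) = (\<Sum>j<Suc n. c j *\<^sub>R laplacian \<Omega> (w j))"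
      unfolding eq laplacian_comb[OF H(1) w(1)] using Suc by simp
    moreover have "grad (x (Suc n) c) = (\<Sum>j<Suc n. c j *\<^sub>R grad (w j))"
      unfolding eq grad_comb[OF H(2) w(2)] using Suc by simp
    ultimately show ?case by blast
  }
qed

lemma laplacian_w_inner: "z \<in> H_space D \<Longrightarrow> laplacian \<Omega> (w j) \<bullet> z = - (lam j * (w j \<bullet> z))"
proof -
  assume "z \<in> H_space D"
  then have "laplacian \<Omega> (w j) \<bullet> z = - (stokes D (w j) \<bullet> z)"
    by (simp add: stokes_def leray_inner)
  then show ?thesis by (simp add: w_facts(3))
qed

text \<open>The Laplacian of x has the same inner products with H as minus the eigenvector sum,
  which itself lies in H and is therefore the projection.\<close>

lemma stokes_span:
  assumes "x \<in> span (w ` {..<N})"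
  shows "stokes D x = (\<Sum>j<N. (lam j * (x \<bullet> w j)) *\<^sub>R w j)"
proof -
  let ?y = "\<Sum>j<N. (lam j * (x \<bullet> w j)) *\<^sub>R w j"
  note d = sum_w_differentials[where n = N and c = "\<lambda>j. x \<bullet> w j", unfolded in_span_w[OF assms]]
  have lap: "laplacian \<Omega> x = (\<Sum>j<N. (x \<bullet> w j) *\<^sub>R laplacian \<Omega> (w j))"
    using d by (elim conjE)
  have "leray D (laplacian \<Omega> x) = - ?y"
  proof (rule leray_eqI)
    show "- ?y \<in> H_space D"
      by (rule subsetD[OF span_w_subset_H span_neg[OF sum_w_in_span]])
    show "laplacian \<Omega> x \<bullet> z = - ?y \<bullet> z" if "z \<in> H_space D" for z
      unfolding lap using that
      by (simp add: inner_sum_left laplacian_w_inner sum_negf mult_ac)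
  qed
  then show ?thesis by (simp add: stokes_def)
qed

text \<open>Expanding x reduces the claim to eigenvectors. These lie in \<open>H2_bc\<close>, so the
  inner product of their Laplacian with z can be evaluated both by Green's formula and by the
  eigenvalue equation.\<close>

lemma stokes_span_inner:
  assumes x: "x \<in> span (w ` {..<N})" and z: "z \<in> V_space D"
  shows "stokes D x \<bullet> z = V_inner D x z"
proof -
  note d = sum_w_differentials[where n = N and c = "\<lambda>j. x \<bullet> w j", unfolded in_span_w[OF x]]
  have zH: "z \<in> H_space D" using z V_subset_H by blast
  have "grad x = (\<Sum>j<N. (x \<bullet> w j) *\<^sub>R grad (w j))"
    using d by (elim conjE)
  moreover have "V_inner D (w j) z = lam j * (w j \<bullet> z)" for j
    using laplacian_inner_V[OF w_facts(1) z, of j] laplacian_w_inner[OF zH, of j] by simp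
  ultimately have "V_inner D x z = (\<Sum>j<N. (x \<bullet> w j) * (lam j * (w j \<bullet> z)))"
    by (simp add: grad_inner_eq inner_sum_left)
  then show ?thesis by (simp add: stokes_span[OF x] inner_sum_left mult_ac)
qed

section \<open>Bounds for functionals on V\<close>

lemma V_norm_scaleR: "\<zeta> \<in> V_space D \<Longrightarrow> V_norm D (a *\<^sub>R \<zeta>) = \<bar>a\<bar> * V_norm D \<zeta>"
  using grad_comb[of \<zeta> \<zeta> a 0] V_subset_H1 by (auto simp: grad_norm_eq)

lemma V_dual_bound:
  assumes F: "F \<in> V_dual D" and \<zeta>: "\<zeta> \<in> V_space D"
  shows "\<bar>F \<zeta>\<bar> \<le> dual_norm D F * V_norm D \<zeta>"
proof -
  obtain C where C: "\<And>\<zeta>. \<zeta> \<in> V_space D \<Longrightarrow> \<bar>F \<zeta>\<bar> \<le> C * V_norm D \<zeta>"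
    using F unfolding V_dual_def by blast
  show ?thesis
  proof (cases "V_norm D \<zeta> = 0")
    \<comment> \<open>A vector of V-norm zero cannot be normalized; the bound with C gives F \<zeta>
      = 0 directly.\<close>
    case True
    then show ?thesis using C[OF \<zeta>] by simp
  next
    case False
    have nonneg: "0 \<le> V_norm D \<xi>" for \<xi> by (simp add: grad_norm_eq)
    then have pos: "0 < V_norm D \<zeta>" using False by (simp add: order_less_le)
    define \<xi> where "\<xi> = (1 / V_norm D \<zeta>) *\<^sub>R \<zeta>"
    have \<xi>: "\<xi> \<in> V_space D" using V_comb[OF \<zeta> \<zeta>, of "1 / V_norm D \<zeta>" 0] by (simp add: \<xi>_def)
    have "V_norm D \<xi> = 1" using pos \<zeta> by (simp add: \<xi>_def V_norm_scaleR)
    \<comment> \<open>A supremum of reals bounds its members only if the set is bounded above. The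
      bound is \<open>\<bar>C\<bar>\<close> because C is not known to be nonnegative.\<close>
    moreover have "bdd_above ((\<lambda>\<zeta>. \<bar>F \<zeta>\<bar>) ` {\<zeta> \<in> V_space D. V_norm D \<zeta> \<le> 1})"
    proof (rule bdd_aboveI2)
      fix \<eta> assume "\<eta> \<in> {\<zeta> \<in> V_space D. V_norm D \<zeta> \<le> 1}"
      then have \<eta>: "\<eta> \<in> V_space D" "V_norm D \<eta> \<le> 1" by auto
      have "\<bar>F \<eta>\<bar> \<le> \<bar>C\<bar> * V_norm D \<eta>"
        by (rule order_trans[OF C[OF \<eta>(1)] mult_right_mono]) (auto simp: nonneg)
      also have "\<dots> \<le> \<bar>C\<bar> * 1" by (rule mult_left_mono[OF \<eta>(2)]) simp
      finally show "\<bar>F \<eta>\<bar> \<le> \<bar>C\<bar>" by simp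
    qed
    ultimately have "\<bar>F \<xi>\<bar> \<le> dual_norm D F"
      unfolding dual_norm_def using \<xi> by (intro cSUP_upper) auto
    moreover have "F (a *\<^sub>R \<zeta> + b *\<^sub>R \<zeta>) = a * F \<zeta> + b * F \<zeta>" for a b
      using F \<zeta> by (simp add: V_dual_def)
    from this[of "1 / V_norm D \<zeta>" 0] have "F \<xi> = F \<zeta> / V_norm D \<zeta>" by (simp add: \<xi>_def)
    ultimately show ?thesis using pos by (simp add: pos_divide_le_eq)
  qed
qed

lemma V_dual_diff:
  assumes "F \<in> V_dual D" "G \<in> V_dual D"
  shows "(\<lambda>\<zeta>. F \<zeta> - G \<zeta>) \<in> V_dual D"
proof -
  obtain C C' where C: "\<And>\<zeta>. \<zeta> \<in> V_space D \<Longrightarrow> \<bar>F \<zeta>\<bar> \<le> C * V_norm D \<zeta>"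
    "\<And>\<zeta>. \<zeta> \<in> V_space D \<Longrightarrow> \<bar>G \<zeta>\<bar> \<le> C' * V_norm D \<zeta>"
    using assms unfolding V_dual_def by blast
  have "\<bar>F \<zeta> - G \<zeta>\<bar> \<le> (C + C') * V_norm D \<zeta>" if "\<zeta> \<in> V_space D" for \<zeta>
    using C[OF that] by (simp add: distrib_right abs_le_iff)
  moreover have "F (a *\<^sub>R \<zeta> + b *\<^sub>R \<eta>) - G (a *\<^sub>R \<zeta> + b *\<^sub>R \<eta>) = a * (F \<zeta> - G \<zeta>) + b * (F \<eta> - G \<eta>)"
    if "\<zeta> \<in> V_space D" "\<eta> \<in> V_space D" for \<zeta> \<eta> a b
    using assms that by (simp add: V_dual_def algebra_simps)
  ultimately show ?thesis unfolding V_dual_def by blast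
qed

lemma V_norm_diff_tendsto_0:
  assumes "\<And>n. s n \<in> V_space D" "\<phi> \<in> V_space D" "(\<lambda>n. grad (s n)) \<longlonglongrightarrow> grad \<phi>"
  shows "(\<lambda>n. V_norm D (s n - \<phi>)) \<longlonglongrightarrow> 0"
proof -
  have "grad (s n - \<phi>) = grad (s n) - grad \<phi>" for n
    using assms V_subset_H1 by (intro grad_diff) auto
  then show ?thesis
    using assms(3) unfolding grad_norm_eq by (simp add: LIM_zero_iff tendsto_norm_zero_iff)
qed

end

section \<open>The trilinear form on V\<close>

locale bilinear_setting = stokes_setting +
  fixes B :: "l2_field \<Rightarrow> l2_field \<Rightarrow> l2_field \<Rightarrow> real"
  assumes bilinear_term: "is_bilinear_term D B"
begin

lemma B_in_V_dual: "\<psi> \<in> V_space D \<Longrightarrow> \<phi> \<in> V_space D \<Longrightarrow> B \<psi> \<phi> \<in> V_dual D"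
  using bilinear_term by (simp add: is_bilinear_term_def)

lemma B_comb_right:
  assumes "\<psi> \<in> V_space D" "\<phi> \<in> V_space D" "\<zeta> \<in> V_space D" "\<eta> \<in> V_space D"
  shows "B \<psi> \<phi> (a *\<^sub>R \<zeta> + b *\<^sub>R \<eta>) = a * B \<psi> \<phi> \<zeta> + b * B \<psi> \<phi> \<eta>"
  using B_in_V_dual[OF assms(1,2)] assms(3,4) by (simp add: V_dual_def)

lemma continuous_convect:
  assumes "C1_field p" "C1_field q"
  shows "continuous_on UNIV (convect p q)"
    "convect p q x = (\<Sum>j\<in>UNIV. p x $ j *\<^sub>R pderiv_at j q x)"
proof -
  show eq: "convect p q x = (\<Sum>j\<in>UNIV. p x $ j *\<^sub>R pderiv_at j q x)" for x
    using assms(2) by (simp add: convect_def frechet_derivative_pderiv C1_field_def)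
  have "continuous_on UNIV (\<lambda>x. \<Sum>j\<in>UNIV. p x $ j *\<^sub>R pderiv_at j q x)"
    using assms by (intro continuous_on_sum continuous_on_scaleR continuous_on_component
        C1_field_continuous C1_field_pderiv_continuous)
  then show "continuous_on UNIV (convect p q)" by (simp add: eq[abs_def])
qed

text \<open>Since V is contained in H, the Leray projector drops out against \<zeta>.\<close>

lemma B_smooth:
  assumes "p \<in> smooth_fields D" "q \<in> smooth_fields D" "\<zeta> \<in> V_space D"
  shows "B (L2_class \<Omega> p) (L2_class \<Omega> q) \<zeta> = L2_class \<Omega> (convect p q) \<bullet> \<zeta>"
proof -
  have "\<zeta> \<in> H_space D" using assms(3) V_subset_H by blast
  then show ?thesis
    using bilinear_term assms by (simp add: is_bilinear_term_def leray_inner)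
qed

text \<open>\<open>is_bilinear_term\<close> does not postulate linearity in the second argument; for
  smooth fields it comes from the linearity of differentiation.\<close>

lemma B_calV_comb:
  assumes s: "s \<in> calV D" and r: "r1 \<in> calV D" "r2 \<in> calV D" and \<zeta>: "\<zeta> \<in> V_space D"
  shows "B s (a *\<^sub>R r1 + b *\<^sub>R r2) \<zeta> = a * B s r1 \<zeta> + b * B s r2 \<zeta>"
proof -
  obtain p q1 q2 where pq: "p \<in> smooth_fields D" "q1 \<in> smooth_fields D" "q2 \<in> smooth_fields D"
    and eq: "s = L2_class \<Omega> p" "r1 = L2_class \<Omega> q1" "r2 = L2_class \<Omega> q2"
    using s r by (auto simp: calV_def)
  note C1 = pq[THEN smooth_fields_C1]
  let ?q = "\<lambda>x. a *\<^sub>R q1 x + b *\<^sub>R q2 x"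
  have q: "?q \<in> smooth_fields D" by (rule smooth_fields_comb[OF admissible pq(2,3)])
  have "a *\<^sub>R r1 + b *\<^sub>R r2 = L2_class \<Omega> ?q"
    unfolding eq using C1 by (intro L2_class_comb[symmetric] C1_field_continuous)
  moreover have "convect p ?q = (\<lambda>x. a *\<^sub>R convect p q1 x + b *\<^sub>R convect p q2 x)"
    unfolding continuous_convect(2)[OF C1(1,2), abs_def] continuous_convect(2)[OF C1(1,3), abs_def]
      continuous_convect(2)[OF C1(1) smooth_fields_C1[OF q], abs_def] C1_field_comb(2)[OF C1(2,3)]
    by (simp add: scaleR_sum_right sum.distrib algebra_simps)
  moreover have "L2_class \<Omega> (\<lambda>x. a *\<^sub>R convect p q1 x + b *\<^sub>R convect p q2 x)
      = a *\<^sub>R L2_class \<Omega> (convect p q1) + b *\<^sub>R L2_class \<Omega> (convect p q2)"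
    by (intro L2_class_comb continuous_convect C1)
  ultimately show ?thesis
    unfolding eq using pq q \<zeta> by (simp add: B_smooth inner_add_left)
qed

text \<open>Integration by parts: \<open>2 (\<psi> \<cdot> \<nabla>)\<phi> \<cdot> \<phi>\<close> is the divergence of \<open>\<bar>\<phi>\<bar>\<^sup>2 \<psi>\<close>.\<close>

lemma B_calV_skew:
  assumes "s \<in> calV D" "r \<in> calV D"
  shows "B s r r = 0"
proof -
  obtain p q where pq: "p \<in> smooth_fields D" "q \<in> smooth_fields D"
    and eq: "s = L2_class \<Omega> p" "r = L2_class \<Omega> q"
    using assms by (auto simp: calV_def)
  note p = smooth_fields_facts[OF admissible pq(1)] and q = smooth_fields_facts[OF admissible pq(2)]
  define F where "F j x = p x $ j * (q x \<bullet> q x)" for j x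
  note pj = C1_field_nth[OF p(1)] and qq = C1_field_inner[OF q(1,1)]
  have F: "C1_field (F j)" for j
    unfolding F_def by (rule C1_field_mult(1)[OF pj(1) qq(1)])
  have dF: "pderiv_at j (F j) x = 2 * (p x $ j * (pderiv_at j q x \<bullet> q x)) + pderiv_at j p x $ j * (q x \<bullet> q x)" for j x
    unfolding F_def C1_field_mult(2)[OF pj(1) qq(1)] pj(2) qq(2) by (simp add: inner_commute algebra_simps)
  have bc: "boundary_compatible D (F j)" for j
    using p(2) q(2) by (cases D) (auto simp: F_def)
  have "2 * (convect p q x \<bullet> q x) = (\<Sum>j\<in>UNIV. pderiv_at j (F j) x)" for x
  proof -
    have "(\<Sum>j\<in>UNIV. pderiv_at j (F j) x) = 2 * (convect p q x \<bullet> q x) + divergence p x * (q x \<bullet> q x)"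
      unfolding dF continuous_convect(2)[OF p(1) q(1)] divergence_def
      by (simp add: sum.distrib inner_sum_left sum_distrib_left sum_distrib_right)
    then show ?thesis using p(3) by simp
  qed
  then have "2 * (LINT x:\<Omega>|lborel. convect p q x \<bullet> q x) = (LINT x:\<Omega>|lborel. (\<Sum>j\<in>UNIV. pderiv_at j (F j) x))"
    by (simp flip: set_integral_mult_right)
  also have "\<dots> = (\<Sum>j\<in>UNIV. LINT x:\<Omega>|lborel. pderiv_at j (F j) x)"
    unfolding set_lebesgue_integral_def scaleR_sum_right
    by (rule Bochner_Integration.integral_sum, fold set_integrable_def)
      (intro set_integrable_continuous C1_field_pderiv_continuous F bounded_domain sets_domain)
  also have "\<dots> = 0"
    by (simp add: integral_pderiv_flow_domain[OF admissible F bc])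
  finally have "(LINT x:\<Omega>|lborel. convect p q x \<bullet> q x) = 0" by simp
  moreover have "r \<in> V_space D" using assms calV_subset_V by blast
  ultimately show ?thesis
    unfolding eq
    by (simp add: B_smooth pq eq inner_L2_class[OF continuous_convect(1)[OF p(1) q(1)] C1_field_continuous[OF q(1)]])
qed

text \<open>The assumed continuity is in the dual norm and concerns two arguments; adding the third
  makes every identity for smooth fields pass to V.\<close>

lemma B_tendsto:
  assumes "\<And>n. \<psi>s n \<in> V_space D" "\<And>n. \<phi>s n \<in> V_space D" "\<And>n. \<zeta>s n \<in> V_space D"
    and V: "\<psi> \<in> V_space D" "\<phi> \<in> V_space D" "\<zeta> \<in> V_space D"
    and "(\<lambda>n. grad (\<psi>s n)) \<longlonglongrightarrow> grad \<psi>" "(\<lambda>n. grad (\<phi>s n)) \<longlonglongrightarrow> grad \<phi>"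
    and \<zeta>s: "(\<lambda>n. grad (\<zeta>s n)) \<longlonglongrightarrow> grad \<zeta>"
  shows "(\<lambda>n. B (\<psi>s n) (\<phi>s n) (\<zeta>s n)) \<longlonglongrightarrow> B \<psi> \<phi> \<zeta>"
proof -
  define d where "d n = (\<lambda>\<zeta>. B (\<psi>s n) (\<phi>s n) \<zeta> - B \<psi> \<phi> \<zeta>)" for n
  have d: "d n \<in> V_dual D" for n
    unfolding d_def using assms by (intro V_dual_diff B_in_V_dual)
  have lim: "(\<lambda>n. dual_norm D (d n)) \<longlonglongrightarrow> 0"
    unfolding d_def
    using bilinear_term V_norm_diff_tendsto_0[of \<psi>s \<psi>] V_norm_diff_tendsto_0[of \<phi>s \<phi>] assms
    unfolding is_bilinear_term_def by blast
  \<comment> \<open>The first summand is a dual norm tending to zero times a convergent V-norm; the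
    second is a fixed functional applied to a null sequence.\<close>
  have "B (\<psi>s n) (\<phi>s n) (\<zeta>s n) - B \<psi> \<phi> \<zeta> = d n (\<zeta>s n) + B \<psi> \<phi> (\<zeta>s n - \<zeta>)" for n
    using B_comb_right[OF V(1,2) assms(3) V(3), of 1 n "-1"] by (simp add: d_def)
  moreover have "(\<lambda>n. d n (\<zeta>s n)) \<longlonglongrightarrow> 0"
  proof (rule Lim_null_comparison)
    show "\<forall>\<^sub>F n in sequentially. norm (d n (\<zeta>s n)) \<le> dual_norm D (d n) * V_norm D (\<zeta>s n)"
      using V_dual_bound[OF d assms(3)] by simp
    show "(\<lambda>n. dual_norm D (d n) * V_norm D (\<zeta>s n)) \<longlonglongrightarrow> 0"
      using tendsto_mult[OF lim tendsto_norm[OF \<zeta>s]] by (simp add: grad_norm_eq)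
  qed
  moreover have "(\<lambda>n. B \<psi> \<phi> (\<zeta>s n - \<zeta>)) \<longlonglongrightarrow> 0"
  proof (rule Lim_null_comparison)
    show "\<forall>\<^sub>F n in sequentially. norm (B \<psi> \<phi> (\<zeta>s n - \<zeta>)) \<le> dual_norm D (B \<psi> \<phi>) * V_norm D (\<zeta>s n - \<zeta>)"
      using V_dual_bound[OF B_in_V_dual[OF V(1,2)] V_diff[OF assms(3) V(3)]] by simp
    show "(\<lambda>n. dual_norm D (B \<psi> \<phi>) * V_norm D (\<zeta>s n - \<zeta>)) \<longlonglongrightarrow> 0"
      using tendsto_mult_left[OF V_norm_diff_tendsto_0[OF assms(3) V(3) \<zeta>s]] by simp
  qed
  ultimately have "(\<lambda>n. B (\<psi>s n) (\<phi>s n) (\<zeta>s n) - B \<psi> \<phi> \<zeta>) \<longlonglongrightarrow> 0"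
    using tendsto_add[of "\<lambda>n. d n (\<zeta>s n)" 0 sequentially "\<lambda>n. B \<psi> \<phi> (\<zeta>s n - \<zeta>)" 0] by simp
  then show ?thesis by (simp add: LIM_zero_iff)
qed

lemma B_comb:
  assumes V: "\<psi> \<in> V_space D" "\<phi>1 \<in> V_space D" "\<phi>2 \<in> V_space D" "\<zeta> \<in> V_space D"
  shows "B \<psi> (a *\<^sub>R \<phi>1 + b *\<^sub>R \<phi>2) \<zeta> = a * B \<psi> \<phi>1 \<zeta> + b * B \<psi> \<phi>2 \<zeta>"
proof -
  obtain s where s: "\<And>n. s n \<in> calV D" "(\<lambda>n. grad (s n)) \<longlonglongrightarrow> grad \<psi>" using V_spaceE[OF V(1)] by metis
  obtain r1 where r1: "\<And>n. r1 n \<in> calV D" "(\<lambda>n. grad (r1 n)) \<longlonglongrightarrow> grad \<phi>1" using V_spaceE[OF V(2)] by metis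
  obtain r2 where r2: "\<And>n. r2 n \<in> calV D" "(\<lambda>n. grad (r2 n)) \<longlonglongrightarrow> grad \<phi>2" using V_spaceE[OF V(3)] by metis
  have inV: "s n \<in> V_space D" "r1 n \<in> V_space D" "r2 n \<in> V_space D" for n
    using s r1 r2 calV_subset_V by blast+
  have H1: "\<phi>1 \<in> H1 \<Omega>" "\<phi>2 \<in> H1 \<Omega>" "r1 n \<in> H1 \<Omega>" "r2 n \<in> H1 \<Omega>" for n
    using V inV V_subset_H1 by blast+
  have comb: "(\<lambda>n. grad (a *\<^sub>R r1 n + b *\<^sub>R r2 n)) \<longlonglongrightarrow> grad (a *\<^sub>R \<phi>1 + b *\<^sub>R \<phi>2)"
    unfolding grad_comb[OF H1(1,2)] grad_comb[OF H1(3,4)] by (intro tendsto_intros r1 r2)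
  have "(\<lambda>n. B (s n) (a *\<^sub>R r1 n + b *\<^sub>R r2 n) \<zeta>) \<longlonglongrightarrow> B \<psi> (a *\<^sub>R \<phi>1 + b *\<^sub>R \<phi>2) \<zeta>"
    by (rule B_tendsto) (use V inV s comb in \<open>auto intro: V_comb\<close>)
  moreover have "(\<lambda>n. a * B (s n) (r1 n) \<zeta> + b * B (s n) (r2 n) \<zeta>) \<longlonglongrightarrow> a * B \<psi> \<phi>1 \<zeta> + b * B \<psi> \<phi>2 \<zeta>"
    by (intro tendsto_add tendsto_mult_left B_tendsto V inV s r1 r2 tendsto_const)
  ultimately show ?thesis
    unfolding B_calV_comb[OF s(1) r1(1) r2(1) V(4)] by (rule LIMSEQ_unique)
qed

text \<open>One approximating sequence serves both the second and the third argument, so every term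
  of the limit is zero by \<open>B_calV_skew\<close>.\<close>

lemma B_skew:
  assumes V: "\<psi> \<in> V_space D" "\<phi> \<in> V_space D"
  shows "B \<psi> \<phi> \<phi> = 0"
proof -
  obtain s where s: "\<And>n. s n \<in> calV D" "(\<lambda>n. grad (s n)) \<longlonglongrightarrow> grad \<psi>" using V_spaceE[OF V(1)] by metis
  obtain r where r: "\<And>n. r n \<in> calV D" "(\<lambda>n. grad (r n)) \<longlonglongrightarrow> grad \<phi>" using V_spaceE[OF V(2)] by metis
  have inV: "s n \<in> V_space D" "r n \<in> V_space D" for n
    using s r calV_subset_V by blast+
  have "(\<lambda>n. B (s n) (r n) (r n)) \<longlonglongrightarrow> B \<psi> \<phi> \<phi>"
    by (intro B_tendsto V inV s r)
  then show ?thesis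
    unfolding B_calV_skew[OF s(1) r(1)] using LIMSEQ_unique[OF tendsto_const] by metis
qed

end

section \<open>One step of the scheme\<close>

context bilinear_setting
begin

text \<open>The part of the scheme that is linear in the new iterate x. \<open>leray\<close> is left
  out because \<open>galerkin_leray\<close> absorbs it into the Galerkin projector.\<close>

definition euler_op ::
    "real \<Rightarrow> real \<Rightarrow> real \<Rightarrow> (l2_field \<Rightarrow> l2_field) \<Rightarrow> nat \<Rightarrow> l2_field \<Rightarrow> l2_field \<Rightarrow> l2_field" where
  "euler_op \<nu> \<tau> \<beta> I N v x = x /\<^sub>R \<tau> + \<nu> *\<^sub>R stokes D x + galerkin_dual w N (B v x) + \<beta> *\<^sub>R galerkin w N (I x)"

lemma galerkin_leray: "galerkin w N (leray D g) = galerkin w N g"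
proof -
  have "w j \<in> H_space D" for j using w_facts(2) V_subset_H by blast
  then show ?thesis by (simp add: galerkin_eq leray_inner)
qed

lemma galerkin_comb: "galerkin w N (a *\<^sub>R f + b *\<^sub>R g) = a *\<^sub>R galerkin w N f + b *\<^sub>R galerkin w N g"
  by (simp add: galerkin_eq inner_add_left scaleR_add_left sum.distrib scaleR_sum_right)

lemma galerkin_diff: "galerkin w N (f - g) = galerkin w N f - galerkin w N g"
  using galerkin_comb[of N 1 f "-1" g] by simp

lemma galerkin_in_span: "galerkin w N g \<in> span (w ` {..<N})"
  by (simp add: galerkin_eq sum_w_in_span)

lemma galerkin_span: "x \<in> span (w ` {..<N}) \<Longrightarrow> galerkin w N x = x"
  by (simp add: galerkin_eq in_span_w)

lemma galerkin_inner_span: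
  assumes "x \<in> span (w ` {..<N})"
  shows "galerkin w N g \<bullet> x = g \<bullet> x"
proof -
  have "galerkin w N g \<bullet> (\<Sum>i<N. (x \<bullet> w i) *\<^sub>R w i) = g \<bullet> (\<Sum>i<N. (x \<bullet> w i) *\<^sub>R w i)"
    by (simp add: galerkin_eq inner_sum_right inner_sum_w)
  then show ?thesis by (simp only: in_span_w[OF assms])
qed

text \<open>The projection records only the values at eigenvectors; linearity of B v y on V recovers
  the value at x from them.\<close>

lemma galerkin_dual_inner_span:
  assumes v: "v \<in> V_space D" and y: "y \<in> V_space D" and x: "x \<in> span (w ` {..<N})"
  shows "galerkin_dual w N (B v y) \<bullet> x = B v y x"
proof -
  have "B v y (\<Sum>j<n. c j *\<^sub>R w j) = (\<Sum>j<n. c j * B v y (w j))" for n c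
  proof (induction n)
    case 0
    show ?case using B_comb_right[OF v y v v, of 0 0] by simp
  next
    case (Suc n)
    have "(\<Sum>j<n. c j *\<^sub>R w j) \<in> V_space D"
      by (rule subsetD[OF span_w_subset_V sum_w_in_span])
    from B_comb_right[OF v y this w_facts(2), of 1 "c n" n] Suc show ?case by simp
  qed
  from this[where n = N and c = "\<lambda>j. x \<bullet> w j"]
  have "B v y x = (\<Sum>j<N. (x \<bullet> w j) * B v y (w j))" by (simp only: in_span_w[OF x])
  then show ?thesis
    by (simp add: galerkin_dual_def inner_commute[of _ x] inner_sum_right mult.commute)
qed

section \<open>The linear operator of a single step\<close>

context
  fixes \<nu> \<tau> \<beta> h c0 :: real and I :: "l2_field \<Rightarrow> l2_field" and N :: nat and v :: l2_field
  assumes params: "0 < \<nu>" "0 < \<tau>" "0 < \<beta>" "0 < h" "0 < c0" "c0 * \<beta> * h\<^sup>2 \<le> \<nu>"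
    and I: "interpolant D c0 h I" and v: "v \<in> span (w ` {..<N})"
begin

private abbreviation "E \<equiv> span (w ` {..<N})"
private abbreviation "T \<equiv> euler_op \<nu> \<tau> \<beta> I N v"

private lemma linear_I: "linear I"
  using I by (simp add: interpolant_def)

private lemma E_subset_V: "x \<in> E \<Longrightarrow> x \<in> V_space D"
  using span_w_subset_V by blast

text \<open>The span is invariant under A because eigenvectors generate it, which explains why the
  viscous term carries no P_N.\<close>

lemma euler_op_in_span:
  assumes "x \<in> E"
  shows "T x \<in> E"
  unfolding euler_op_def stokes_span[OF assms] galerkin_dual_def galerkin_eq
  by (intro span_add span_scale sum_w_in_span assms)

lemma euler_op_comb:
  assumes x: "x \<in> E" and y: "y \<in> E"
  shows "T (a *\<^sub>R x + b *\<^sub>R y) = a *\<^sub>R T x + b *\<^sub>R T y"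
proof -
  have xy: "a *\<^sub>R x + b *\<^sub>R y \<in> E" using x y by (intro span_add span_scale)
  have stokes: "stokes D (a *\<^sub>R x + b *\<^sub>R y) = a *\<^sub>R stokes D x + b *\<^sub>R stokes D y"
    by (simp add: stokes_span[OF xy] stokes_span[OF x] stokes_span[OF y] inner_add_left
        algebra_simps sum.distrib scaleR_sum_right)
  have "B v (a *\<^sub>R x + b *\<^sub>R y) (w j) = a * B v x (w j) + b * B v y (w j)" for j
    using x y v by (intro B_comb E_subset_V w_facts)
  then have B: "galerkin_dual w N (B v (a *\<^sub>R x + b *\<^sub>R y))
      = a *\<^sub>R galerkin_dual w N (B v x) + b *\<^sub>R galerkin_dual w N (B v y)"
    by (simp add: galerkin_dual_def algebra_simps sum.distrib scaleR_sum_right)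
  have "I (a *\<^sub>R x + b *\<^sub>R y) = a *\<^sub>R I x + b *\<^sub>R I y"
    by (simp add: linear_add[OF linear_I] linear_scale[OF linear_I])
  then have I: "galerkin w N (I (a *\<^sub>R x + b *\<^sub>R y)) = a *\<^sub>R galerkin w N (I x) + b *\<^sub>R galerkin w N (I y)"
    by (simp add: galerkin_comb)
  show ?thesis unfolding euler_op_def stokes B I by (simp add: algebra_simps)
qed

text \<open>The hypothesis \<open>c\<^sub>0 \<beta> h\<^sup>2 \<le> \<nu>\<close> lets the viscous term absorb the interpolation error.\<close>

lemma euler_op_coercive:
  assumes x: "x \<in> E"
  shows "(norm x)\<^sup>2 / \<tau> \<le> T x \<bullet> x"
proof -
  note xV = E_subset_V[OF x] and vV = E_subset_V[OF v]
  \<comment> \<open>The interpolation error bound in its V-norm form, which is the applicable branch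
    because x lies in V.\<close>
  define a where "a = sqrt c0 * h * V_norm D x"
  have "x \<in> H1 \<Omega>" using xV V_subset_H1 by blast
  then have err: "norm (x - I x) \<le> a"
    using I xV unfolding interpolant_def a_def by metis
  have "(x - I x) \<bullet> x \<le> norm (x - I x) * norm x"
    by (rule norm_cauchy_schwarz)
  also have "\<dots> \<le> a * norm x" by (intro mult_right_mono err norm_ge_zero)
  also have "\<dots> \<le> (a\<^sup>2 + (norm x)\<^sup>2) / 2"
    using sum_squares_bound[of a "norm x"] by simp
  finally have "(norm x)\<^sup>2 - (a\<^sup>2 + (norm x)\<^sup>2) / 2 \<le> I x \<bullet> x"
    unfolding inner_diff_left power2_norm_eq_inner[of x] by linarith
  then have "\<beta> * ((norm x)\<^sup>2 - (a\<^sup>2 + (norm x)\<^sup>2) / 2) \<le> \<beta> * (I x \<bullet> x)"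
    using params by (intro mult_left_mono) auto
  then have "\<beta> * (norm x)\<^sup>2 \<le> \<beta> * a\<^sup>2 + 2 * (\<beta> * (I x \<bullet> x))"
    by (simp add: field_simps)
  moreover have "\<beta> * a\<^sup>2 \<le> \<nu> * (V_norm D x)\<^sup>2"
  proof -
    \<comment> \<open>Squaring \<open>sqrt c0 * h\<close> produces the constant c0 h^2 of the
      smallness condition.\<close>
    have "\<beta> * a\<^sup>2 = (c0 * \<beta> * h\<^sup>2) * (V_norm D x)\<^sup>2"
      using params by (simp add: a_def power_mult_distrib)
    also have "\<dots> \<le> \<nu> * (V_norm D x)\<^sup>2" using params by (intro mult_right_mono) auto
    finally show ?thesis .
  qed
  moreover have "0 \<le> \<beta> * (norm x)\<^sup>2" "0 \<le> \<nu> * (V_norm D x)\<^sup>2" using params by auto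
  ultimately have "0 \<le> \<nu> * (V_norm D x)\<^sup>2 + \<beta> * (I x \<bullet> x)"
    by linarith
  moreover have "T x \<bullet> x = (norm x)\<^sup>2 / \<tau> + \<nu> * (V_norm D x)\<^sup>2 + \<beta> * (I x \<bullet> x)"
  proof -
    have "stokes D x \<bullet> x = (V_norm D x)\<^sup>2"
      by (simp add: stokes_span_inner[OF x xV] grad_norm_eq grad_inner_eq power2_norm_eq_inner)
    moreover have "galerkin_dual w N (B v x) \<bullet> x = 0"
      by (simp add: galerkin_dual_inner_span[OF vV xV x] B_skew[OF vV xV])
    ultimately show ?thesis
      by (simp add: euler_op_def inner_add_left galerkin_inner_span[OF x] power2_norm_eq_inner
          divide_inverse mult.commute)
  qed
  ultimately show ?thesis by simp
qed

lemma euler_op_bij: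
  assumes y: "y \<in> E"
  shows "\<exists>!x. x \<in> E \<and> T x = y"
proof -
  have inj: "x = 0" if x: "x \<in> E" "T x = 0" for x
  proof -
    have "(norm x)\<^sup>2 / \<tau> \<le> 0" using euler_op_coercive[OF x(1)] x(2) by simp
    then show ?thesis using params(2) by (simp add: divide_le_0_iff)
  qed
  \<comment> \<open>Composition with P_N extends T from the span to a map that is linear on the
    whole type, as \<open>injective_on_span_imp_surjective\<close> requires.\<close>
  define T' where "T' x = T (galerkin w N x)" for x
  have T': "T' x = T x" if "x \<in> E" for x using that by (simp add: T'_def galerkin_span)
  have comb: "T' (a *\<^sub>R x + b *\<^sub>R z) = a *\<^sub>R T' x + b *\<^sub>R T' z" for a b x z
    unfolding T'_def galerkin_comb by (rule euler_op_comb[OF galerkin_in_span galerkin_in_span])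
  have "linear T'"
    using comb[of 1 _ 1] comb[of _ _ 0] by (intro linearI) simp_all
  moreover have "T' x \<in> E" for x
    unfolding T'_def by (rule euler_op_in_span[OF galerkin_in_span])
  ultimately obtain x where x: "x \<in> E" "T' x = y"
    using injective_on_span_imp_surjective[OF _ independent_w, of "{..<N}" T' y] inj T' y
    by (metis finite_imageI finite_lessThan)
  show ?thesis
  proof (rule ex1I)
    show "x \<in> E \<and> T x = y" using x T' by simp
    fix z assume z: "z \<in> E \<and> T z = y"
    have "T (1 *\<^sub>R z + (-1) *\<^sub>R x) = 0"
      using euler_op_comb[of z x 1 "-1"] z x T' by simp
    moreover have "1 *\<^sub>R z + (-1) *\<^sub>R x \<in> E" using z x by (intro span_add span_scale) auto
    ultimately have "1 *\<^sub>R z + (-1) *\<^sub>R x = 0" using inj by blast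
    then show "z = x" by simp
  qed
qed

text \<open>Linearity of I separates the unknown from the data; old iterate, forcing and
  interpolated velocity together form a right-hand side in the span.\<close>

lemma euler_step_unique_solution:
  "\<exists>!x. x \<in> E \<and> (x - v) /\<^sub>R \<tau> + \<nu> *\<^sub>R stokes D x + galerkin_dual w N (B v x)
     = galerkin w N f - \<beta> *\<^sub>R galerkin w N (leray D (I (x - ut)))"
proof -
  let ?y = "v /\<^sub>R \<tau> + galerkin w N f + \<beta> *\<^sub>R galerkin w N (I ut)"
  have "(x - v) /\<^sub>R \<tau> + \<nu> *\<^sub>R stokes D x + galerkin_dual w N (B v x)
     = galerkin w N f - \<beta> *\<^sub>R galerkin w N (leray D (I (x - ut))) \<longleftrightarrow> T x = ?y" for x
    unfolding euler_op_def galerkin_leray linear_diff[OF linear_I] galerkin_diff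
    by (auto simp: algebra_simps)
  moreover have "?y \<in> E"
    by (intro span_add span_scale galerkin_in_span v)
  ultimately show ?thesis using euler_op_bij by simp
qed

end

end

text \<open>The relation R may depend on k because the velocity data change from step to
  step.\<close>

lemma unique_sequence_by_recursion:
  assumes step: "\<And>k v. v \<in> E \<Longrightarrow> \<exists>!x. x \<in> E \<and> R k v x" and v0: "v0 \<in> E"
  shows "\<exists>!v :: nat \<Rightarrow> 'a. (\<forall>k. v k \<in> E) \<and> v 0 = v0 \<and> (\<forall>k. R k (v k) (v (Suc k)))"
proof (rule ex_ex1I)
  define s where "s = rec_nat v0 (\<lambda>k v. THE x. x \<in> E \<and> R k v x)"
  \<comment> \<open>The description defining \<open>s\<close> is meaningful only while the iterates
    stay in E, so membership and the step relation come together.\<close>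
  have s_Suc: "s (Suc k) \<in> E \<and> R k (s k) (s (Suc k))" if "s k \<in> E" for k
    using theI'[OF step[OF that]] by (simp add: s_def)
  have "s k \<in> E" for k
    by (induction k) (use s_Suc v0 in \<open>auto simp: s_def\<close>)
  then show "\<exists>v. (\<forall>k. v k \<in> E) \<and> v 0 = v0 \<and> (\<forall>k. R k (v k) (v (Suc k)))"
    using s_Suc by (intro exI[of _ s]) (auto simp: s_def)
next
  fix v v' :: "nat \<Rightarrow> 'a"
  assume v: "(\<forall>k. v k \<in> E) \<and> v 0 = v0 \<and> (\<forall>k. R k (v k) (v (Suc k)))"
    and v': "(\<forall>k. v' k \<in> E) \<and> v' 0 = v0 \<and> (\<forall>k. R k (v' k) (v' (Suc k)))"
  have "v k = v' k" for k
  proof (induction k)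
    case (Suc k)
    then show ?case using step[of "v k" k] v v' by metis
  qed (use v v' in simp)
  then show "v = v'" by blast
qed

theorem proposition3p1:
  fixes D :: setting
    and \<nu> \<tau> \<beta> h c0 :: real
    and N :: nat
    and f v0 :: l2_field
    and u :: "real \<Rightarrow> l2_field"
    and B :: "l2_field \<Rightarrow> l2_field \<Rightarrow> l2_field \<Rightarrow> real"
    and w :: "nat \<Rightarrow> l2_field"
    and lam :: "nat \<Rightarrow> real"
    and I :: "l2_field \<Rightarrow> l2_field"
  assumes "admissible D"
    and "is_bilinear_term D B"
    and "stokes_eigenbasis D w lam"
    and "0 < \<nu>" and "f \<in> H_space D"
    and "ns_solution D \<nu> f B u"
    and "0 < c0" and "0 < h" and "interpolant D c0 h I"
    and "0 < \<tau>" and "1 \<le> N"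
    and "0 < \<beta>" and "c0 * \<beta> * h\<^sup>2 \<le> \<nu>"
    and "v0 \<in> galerkin w N ` H_space D"
  shows "\<exists>!v :: nat \<Rightarrow> l2_field.
           (\<forall>k. v k \<in> galerkin w N ` H_space D) \<and> v 0 = v0 \<and> euler_scheme D \<nu> f B w N \<tau> \<beta> I u v"
proof -
  interpret bilinear_setting D w lam B
    by standard (use assms in auto)
  let ?E = "span (w ` {..<N})"
  \<comment> \<open>The step from index k uses the velocity at the new time, hence
    \<open>Suc k\<close> in its argument.\<close>
  have "\<exists>!x. x \<in> ?E \<and> (x - y) /\<^sub>R \<tau> + \<nu> *\<^sub>R stokes D x + galerkin_dual w N (B y x)
      = galerkin w N f - \<beta> *\<^sub>R galerkin w N (leray D (I (x - u (real (Suc k) * \<tau>))))"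
    if "y \<in> ?E" for k y
    by (rule euler_step_unique_solution[of \<nu> \<tau> \<beta> h c0]) (use assms that in auto)
  moreover have "v0 \<in> ?E" using assms by (simp add: galerkin_image)
  ultimately show ?thesis
    unfolding galerkin_image euler_scheme_def by (rule unique_sequence_by_recursion)
qed

end
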